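(* Assume (H1), (H2) and (H3). For every $\alpha_0>0$ there is $r=r(\alpha_0)>0$ such that the following holds. Suppose that $t_0\in\mathbb{R}$ and $u_0\in C^b_{\rm unif}(\mathbb{R},\mathbb{R})$ satisfy: $u_0:\mathbb{R}\to[0,1]$, $u_0(-\infty)=1$ (i.e. $\lim_{x\to-\infty}u_0(x)=1$), and for some constant $C'>0$, $$|u_0(x)-u^f(t_0,x)|\le C' e^{-\alpha_0(x-\xi^f(t_0))}\quad\text{for all }x\in\mathbb{R}.$$ Then there exist $C=C(u_0)>0$ and $\zeta_*=\zeta_*(u_0)\in\mathbb{R}$ such that $$\sup_{x\in\mathbb{R}}|u(t,x;t_0,u_0)-u^f(t,x-\zeta_* )|\le C e^{-r(t-t_0)}\quad\text{for all }t\ge t_0.$$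
   Context: Let $f:\mathbb{R}\times\mathbb{R}\to\mathbb{R}$, $(t,u)\mapsto f(t,u)$, and consider the equation (E): $u_t=u_{xx}+f(t,u)$, $x\in\mathbb{R}$, $t\in\mathbb{R}$. Assumptions. (H1) There is $\theta\in(0,1)$ (the ignition temperature) such that for all $t\in\mathbb{R}$: $f(t,u)=0$ for $u\in(-\infty,\theta]\cup\{1\}$, $f(t,u)>0$ for $u\in(\theta,1)$, $f(t,u)<0$ for $u>1$. The family of functions $\{f(\cdot,u):u\in\mathbb{R}\}$ is locally uniformly Hölder continuous; the family $\{f(t,\cdot):t\in\mathbb{R}\}$ is locally uniformly Lipschitz continuous; for any $t\in\mathbb{R}$, $f(t,u)$ is continuously differentiable for $u\ge\theta$. (H2) There are Lipschitz continuous functions $f_{\inf},f_{\sup}\in C^1([\theta,\infty),\mathbb{R})$ with $f_{\inf}(u)=0=f_{\sup}(u)$ for $u\in[0,\theta]\cup\{1\}$, $0<(f_{\inf})_u^+(\theta)\le(f_{\sup})_u^+(\theta)$ (right derivatives), $0>(f_{\inf})_u(1)\ge(f_{\sup})_u(1)$, $0<f_{\inf}(u)<f_{\sup}(u)$ for $u\in(\theta,1)$, such that $f_{\inf}(u)\le f(t,u)\le f_{\sup}(u)$ for $u\in[\theta,1]$, $t\in\mathbb{R}$. (H3) There exist $\theta_*\in(\theta,1)$ and $\beta>0$ such that $f_u(t,u)\le-\beta$ for $u\ge\theta_*$ and $t\in\mathbb{R}$. Generalized traveling wave: a global-in-time classical solution $u(t,x)$ of (E) on $\mathbb{R}\times\mathbb{R}$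 with values in $(0,1)$ for which there is a function $\xi:\mathbb{R}\to\mathbb{R}$ (an interface location function) such that $\lim_{x\to-\infty}u(t,x+\xi(t))=1$ and $\lim_{x\to\infty}u(t,x+\xi(t))=0$ uniformly in $t\in\mathbb{R}$. The wave $u^f$: under (H1), (H2) it is known that (E) has a generalized traveling wave $u^f(t,x)$ with a continuously differentiable interface location function $\xi^f:\mathbb{R}\to\mathbb{R}$ satisfying $u^f(t,\xi^f(t))=\theta$ for all $t$ and $\sup_t|\dot\xi^f(t)|<\infty$, and with the properties: (i) $u^f_x(t,x)<0$ for all $t,x$; (ii) for any $M>0$ there is $C(M)>0$ with $u^f_x(t,x+\xi^f(t))<-C(M)$ for $x\in[-M,M]$, $t\in\mathbb{R}$; (iii) there is a continuous strictly decreasing $w:\mathbb{R}\to(0,1)$ with $w(x)\ge1-c_1e^{c_2x}$ for $x\le-c_3$ for some $c_1,c_2,c_3>0$ and $w(x)=\theta e^{-c_0x}$ for $x\ge0$ for some $c_0>0$, such that $u^f(t,x+\xi^f(t))\ge w(x)$ for $x\le0$ and $u^f(t,x+\xi^f(t))\le w(x)$ for $x\ge0$, for all $t$; (iv) there is $C>0$ with $u^f_x(t,x+\xi^f(t))\ge-Cw(x)$ for $x\ge0$ and all $t$. Throughout $u^f,\xi^f$ denote this fixed wave and its interface location. $C^b_{\rm unif}(\mathbb{R},\mathbb{R})$ is the space of bounded uniformly continuous functions on $\mathbb{R}$ with the uniform convergence topology. For $u_0\in C^b_{\rm unif}(\mathbb{R},\mathbb{R})$ and $t_0\in\mathbb{R}$,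 $u(t,\cdot;t_0,u_0)\in C^b_{\rm unif}(\mathbb{R},\mathbb{R})$, $t\ge t_0$, denotes the unique solution of (E) with $u(t_0,\cdot;t_0,u_0)=u_0$. The notation $r=r(\alpha_0)$ means that $r$ depends on the data $t_0,u_0$ only through $\alpha_0$ ($f$ and $u^f$ being fixed). *)

theory Defs
  imports "HOL-Analysis.Analysis"
begin

text \<open>
  A function of time and space is curried: \<open>u t x\<close>. The nonlinearity is \<open>f t u\<close>.
\<close>

text \<open>
  Continuous differentiability with derivatives taken within \<open>S\<close>, hence one-sided at a boundary
  point. The library's \<open>C1_differentiable_on\<close> asks for two-sided derivatives there, and an
  ignition nonlinearity has a kink at the ignition temperature.
\<close>
definition C1_within :: "real set \<Rightarrow> (real \<Rightarrow> real) \<Rightarrow> bool" where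
  "C1_within S g \<longleftrightarrow>
     (\<exists>g'. continuous_on S g' \<and> (\<forall>u\<in>S. (g has_real_derivative g' u) (at u within S)))"

text \<open>
  For a family of functions, "locally uniformly" means: the constants may depend on the compact
  interval in which the argument ranges, but not on the index of the family.
\<close>
definition locally_uniformly_Hoelder :: "('i \<Rightarrow> real \<Rightarrow> real) \<Rightarrow> bool" where
  "locally_uniformly_Hoelder g \<longleftrightarrow>
     (\<forall>a b. \<exists>\<gamma> L. 0 < \<gamma> \<and> \<gamma> \<le> 1 \<and>
        (\<forall>i. \<forall>s\<in>{a..b}. \<forall>t\<in>{a..b}. \<bar>g i s - g i t\<bar> \<le> L * \<bar>s - t\<bar> powr \<gamma>))"

definition locally_uniformly_Lipschitz :: "('i \<Rightarrow> real \<Rightarrow> real) \<Rightarrow> bool" where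
  "locally_uniformly_Lipschitz g \<longleftrightarrow> (\<forall>a b. \<exists>L. \<forall>i. L-lipschitz_on {a..b} (g i))"

definition H1 :: "(real \<Rightarrow> real \<Rightarrow> real) \<Rightarrow> real \<Rightarrow> bool" where
  "H1 f \<theta> \<longleftrightarrow>
     0 < \<theta> \<and> \<theta> < 1 \<and>
     (\<forall>t. (\<forall>u\<in>{..\<theta>} \<union> {1}. f t u = 0) \<and>
          (\<forall>u\<in>{\<theta><..<1}. f t u > 0) \<and>
          (\<forall>u>1. f t u < 0)) \<and>
     locally_uniformly_Hoelder (\<lambda>u t. f t u) \<and>
     locally_uniformly_Lipschitz (\<lambda>t u. f t u) \<and>
     (\<forall>t. C1_within {\<theta>..} (f t))"

definition H2 :: "(real \<Rightarrow> real \<Rightarrow> real) \<Rightarrow> real \<Rightarrow> bool" where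
  "H2 f \<theta> \<longleftrightarrow>
     (\<exists>f_inf f_sup.
        (\<exists>L. L-lipschitz_on {0..} f_inf) \<and> (\<exists>L. L-lipschitz_on {0..} f_sup) \<and>
        C1_within {\<theta>..} f_inf \<and> C1_within {\<theta>..} f_sup \<and>
        (\<forall>u\<in>{0..\<theta>} \<union> {1}. f_inf u = 0 \<and> f_sup u = 0) \<and>
        (\<exists>a b. (f_inf has_real_derivative a) (at_right \<theta>) \<and>
               (f_sup has_real_derivative b) (at_right \<theta>) \<and> 0 < a \<and> a \<le> b) \<and>
        0 > deriv f_inf 1 \<and> deriv f_inf 1 \<ge> deriv f_sup 1 \<and>
        (\<forall>u\<in>{\<theta><..<1}. 0 < f_inf u \<and> f_inf u < f_sup u) \<and>
        (\<forall>t. \<forall>u\<in>{\<theta>..1}. f_inf u \<le> f t u \<and> f t u \<le> f_sup u))"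

text \<open>
  Under \<open>H1\<close>, \<open>f t\<close> is differentiable at every point above \<open>\<theta>\<close>, so \<open>deriv (f t) u\<close> is the
  partial derivative in \<open>u\<close>.
\<close>
definition H3 :: "(real \<Rightarrow> real \<Rightarrow> real) \<Rightarrow> real \<Rightarrow> bool" where
  "H3 f \<theta> \<longleftrightarrow>
     (\<exists>\<theta>\<^sub>s \<beta>. \<theta> < \<theta>\<^sub>s \<and> \<theta>\<^sub>s < 1 \<and> 0 < \<beta> \<and> (\<forall>t. \<forall>u\<ge>\<theta>\<^sub>s. deriv (f t) u \<le> - \<beta>))"

text \<open>
  Classical solutions of \<open>u\<^sub>t = u\<^sub>x\<^sub>x + f(t, u)\<close> on \<open>I \<times> \<real>\<close>, where \<open>I\<close> is an open set of times: the
  derivatives occurring exist and are jointly continuous.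
\<close>
definition classical_solution ::
    "(real \<Rightarrow> real \<Rightarrow> real) \<Rightarrow> real set \<Rightarrow> (real \<Rightarrow> real \<Rightarrow> real) \<Rightarrow> bool" where
  "classical_solution f I u \<longleftrightarrow>
     (\<exists>ut ux uxx.
        continuous_on (I \<times> UNIV) (\<lambda>(t, x). ut t x) \<and>
        continuous_on (I \<times> UNIV) (\<lambda>(t, x). ux t x) \<and>
        continuous_on (I \<times> UNIV) (\<lambda>(t, x). uxx t x) \<and>
        (\<forall>t\<in>I. \<forall>x.
           ((\<lambda>s. u s x) has_real_derivative ut t x) (at t) \<and>
           (u t has_real_derivative ux t x) (at x) \<and>
           (ux t has_real_derivative uxx t x) (at x) \<and>
           ut t x = uxx t x + f t (u t x)))"

definition interface_location :: "(real \<Rightarrow> real \<Rightarrow> real) \<Rightarrow> (real \<Rightarrow> real) \<Rightarrow> bool" where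
  "interface_location u \<xi> \<longleftrightarrow>
     uniform_limit UNIV (\<lambda>x t. u t (x + \<xi> t)) (\<lambda>t. 1) at_bot \<and>
     uniform_limit UNIV (\<lambda>x t. u t (x + \<xi> t)) (\<lambda>t. 0) at_top"

definition generalized_traveling_wave ::
    "(real \<Rightarrow> real \<Rightarrow> real) \<Rightarrow> (real \<Rightarrow> real \<Rightarrow> real) \<Rightarrow> bool" where
  "generalized_traveling_wave f u \<longleftrightarrow>
     classical_solution f UNIV u \<and> (\<forall>t x. u t x \<in> {0<..<1}) \<and> (\<exists>\<xi>. interface_location u \<xi>)"

text \<open>
  The wave relative to which stability is stated: a generalized traveling wave \<open>u\<close> together with
  an interface location \<open>\<xi>\<close> that follows the ignition level, with monotonicity, steepness near the
  interface, and bounds by a common profile \<open>w\<close>. Under \<open>H1\<close> and \<open>H2\<close> such a pair is known to exist.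
\<close>
definition ignition_wave ::
    "(real \<Rightarrow> real \<Rightarrow> real) \<Rightarrow> real \<Rightarrow> (real \<Rightarrow> real \<Rightarrow> real) \<Rightarrow> (real \<Rightarrow> real) \<Rightarrow> bool" where
  "ignition_wave f \<theta> u \<xi> \<longleftrightarrow>
     generalized_traveling_wave f u \<and>
     interface_location u \<xi> \<and>
     \<xi> C1_differentiable_on UNIV \<and>
     (\<forall>t. u t (\<xi> t) = \<theta>) \<and>
     bounded (range (deriv \<xi>)) \<and>
     (\<forall>t x. deriv (u t) x < 0) \<and>
     (\<forall>M>0. \<exists>C>0. \<forall>t. \<forall>x\<in>{-M..M}. deriv (u t) (x + \<xi> t) < - C) \<and>
     (\<exists>w. continuous_on UNIV w \<and> strict_antimono_on UNIV w \<and> (\<forall>x. w x \<in> {0<..<1}) \<and>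
        (\<exists>c\<^sub>1>0. \<exists>c\<^sub>2>0. \<exists>c\<^sub>3>0. \<forall>x\<le>-c\<^sub>3. w x \<ge> 1 - c\<^sub>1 * exp (c\<^sub>2 * x)) \<and>
        (\<exists>c\<^sub>0>0. \<forall>x\<ge>0. w x = \<theta> * exp (- c\<^sub>0 * x)) \<and>
        (\<forall>t. \<forall>x\<le>0. u t (x + \<xi> t) \<ge> w x) \<and>
        (\<forall>t. \<forall>x\<ge>0. u t (x + \<xi> t) \<le> w x) \<and>
        (\<exists>C>0. \<forall>t. \<forall>x\<ge>0. deriv (u t) (x + \<xi> t) \<ge> - C * w x))"

definition Cb_unif :: "(real \<Rightarrow> real) set" where
  "Cb_unif = {g. bounded (range g) \<and> uniformly_continuous_on UNIV g}"

text \<open>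
  \<open>u\<close> solves the Cauchy problem from time \<open>t\<^sub>0\<close> with datum \<open>u\<^sub>0\<close>: a continuous curve in \<open>Cb_unif\<close>
  (uniform convergence topology) on \<open>[t\<^sub>0, \<infinity>)\<close>, classical for \<open>t > t\<^sub>0\<close>. Only the values \<open>u t\<close> with
  \<open>t \<ge> t\<^sub>0\<close> matter; under \<open>H1\<close> these are uniquely determined by \<open>t\<^sub>0\<close> and \<open>u\<^sub>0\<close>.
\<close>
definition cauchy_solution ::
    "(real \<Rightarrow> real \<Rightarrow> real) \<Rightarrow> real \<Rightarrow> (real \<Rightarrow> real) \<Rightarrow> (real \<Rightarrow> real \<Rightarrow> real) \<Rightarrow> bool" where
  "cauchy_solution f t\<^sub>0 u\<^sub>0 u \<longleftrightarrow>
     (\<forall>t\<ge>t\<^sub>0. u t \<in> Cb_unif) \<and>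
     (\<forall>t\<ge>t\<^sub>0. uniform_limit UNIV u (u t) (at t within {t\<^sub>0..})) \<and>
     u t\<^sub>0 = u\<^sub>0 \<and>
     classical_solution f {t\<^sub>0<..} u"

end

theory Submission
  imports Defs
begin

text \<open>
  Write \<open>U\<close> for the wave. A solution is kept between \<open>U t (x - a) - q \<Gamma>\<close> and \<open>U t (x - b) + q \<Gamma>\<close>,
  where \<open>\<Gamma>\<close> is about 1 behind the front and decays like \<open>exp (- \<alpha> (x - \<xi> t))\<close> ahead of it. Since
  the interface moves with positive mean speed, \<open>\<Gamma>\<close> is a supersolution of the heat equation for
  small \<open>\<alpha>\<close>; together with dissipation near 1 and the steepness of \<open>U\<close> in between, this makes \<open>q\<close>
  decay exponentially at the cost of a shift of order \<open>q\<close>. The gap \<open>b - a\<close> contracts: at the interface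
  the solution is away from one of the two shifted waves by a multiple of the gap, a parabolic
  gradient estimate spreads this to an interval, the strong maximum principle to any compact set, and
  then that side can be moved inward; outside the compact set \<open>U\<close> is so flat that the new error
  \<open>q\<close> costs less than what was gained. Iterating over time steps of fixed length gives a geometric
  rate. This rate depends on the initial gap only transiently: once the solution is close to one shift
  of the wave, the argument restarts with zero gap and a universal rate.
\<close>

section \<open>The heat operator and the maximum principle\<close>

text \<open>A spatially uniform error cannot decay ahead of the front, where the reaction vanishes
  identically below \<theta>; hence errors are measured against the weight \<open>Gam\<close>, whose
  forward motion supplies the missing damping. This requires a speed bounded below at every instant,
  whereas \<xi> is controlled only on average, so the weight is attached to a smoothed interface
  \<eta>. The exponent \<alpha> is limited three times: by the decay of the initial difference, by
  the speed of \<eta>, and by the decay of the wave, which must be negligible against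
  \<open>Gam\<close> far ahead. The gradient bound, the spreading of positivity and the mean speed
  are all comparisons with explicit barriers through a single maximum principle. The obstacle in the
  iteration is that pushing one side inward creates an error \<open>q\<close>, and removing
  \<open>q\<close> moves the sides outward again. The single quantity \<open>b - a + N * q\<close>
  accounts for both effects and shrinks by a fixed factor. The constants depend on the data only
  through a bound for the shifts, which is why a restart with both shifts zero yields a rate fixed
  in advance.\<close>

definition heat_at :: "(real \<Rightarrow> real \<Rightarrow> real) \<Rightarrow> real \<Rightarrow> real \<Rightarrow> real \<Rightarrow> bool" where
  "heat_at w t x d \<longleftrightarrow>
     (\<exists>wt wx wxx. ((\<lambda>s. w s x) has_real_derivative wt) (at t) \<and>
        (\<forall>y. (w t has_real_derivative wx y) (at y)) \<and>
        (wx has_real_derivative wxx) (at x) \<and> d = wt - wxx)"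

lemma heat_atI:
  assumes "((\<lambda>s. w s x) has_real_derivative wt) (at t)"
    and "\<And>y. (w t has_real_derivative wx y) (at y)"
    and "(wx has_real_derivative wxx) (at x)"
    and "d = wt - wxx"
  shows "heat_at w t x d"
  using assms unfolding heat_at_def by blast

lemma heat_at_add:
  assumes "heat_at v t x a" "heat_at w t x b"
  shows "heat_at (\<lambda>t x. v t x + w t x) t x (a + b)"
proof -
  obtain vt vx vxx where v: "((\<lambda>s. v s x) has_real_derivative vt) (at t)"
    "\<And>y. (v t has_real_derivative vx y) (at y)" "(vx has_real_derivative vxx) (at x)" "a = vt - vxx"
    using assms(1) unfolding heat_at_def by blast
  obtain wt wx wxx where w: "((\<lambda>s. w s x) has_real_derivative wt) (at t)"
    "\<And>y. (w t has_real_derivative wx y) (at y)" "(wx has_real_derivative wxx) (at x)" "b = wt - wxx"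
    using assms(2) unfolding heat_at_def by blast
  show ?thesis
  proof (rule heat_atI)
    show "((\<lambda>s. v s x + w s x) has_real_derivative vt + wt) (at t)" by (intro DERIV_add v w)
    show "\<And>y. ((\<lambda>x. v t x + w t x) has_real_derivative vx y + wx y) (at y)" by (intro DERIV_add v w)
    show "((\<lambda>y. vx y + wx y) has_real_derivative vxx + wxx) (at x)" by (intro DERIV_add v w)
  qed (use v w in simp)
qed

lemma heat_at_time_mult:
  assumes "heat_at w t x d" and g: "(g has_real_derivative g') (at t)"
  shows "heat_at (\<lambda>t x. g t * w t x) t x (g' * w t x + g t * d)"
proof -
  obtain wt wx wxx where w: "((\<lambda>s. w s x) has_real_derivative wt) (at t)"
    "\<And>y. (w t has_real_derivative wx y) (at y)" "(wx has_real_derivative wxx) (at x)" "d = wt - wxx"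
    using assms(1) unfolding heat_at_def by blast
  show ?thesis
  proof (rule heat_atI)
    show "((\<lambda>s. g s * w s x) has_real_derivative g' * w t x + wt * g t) (at t)"
      by (intro DERIV_mult g w)
    show "\<And>y. ((\<lambda>x. g t * w t x) has_real_derivative g t * wx y) (at y)" by (intro DERIV_cmult w)
    show "((\<lambda>y. g t * wx y) has_real_derivative g t * wxx) (at x)" by (intro DERIV_cmult w)
  qed (simp add: w(4) algebra_simps)
qed

lemma heat_at_cmult:
  assumes "heat_at w t x d"
  shows "heat_at (\<lambda>t x. k * w t x) t x (k * d)"
  using heat_at_time_mult[OF assms, of "\<lambda>_. k" 0] by simp

lemma heat_at_diff:
  assumes "heat_at v t x a" "heat_at w t x b"
  shows "heat_at (\<lambda>t x. v t x - w t x) t x (a - b)"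
  using heat_at_add[OF assms(1) heat_at_cmult[OF assms(2), of "-1"]] by simp

lemma heat_at_time:
  assumes "(g has_real_derivative g') (at t)"
  shows "heat_at (\<lambda>t x. g t) t x g'"
  by (rule heat_atI[where wx = "\<lambda>_. 0" and wxx = 0 and wt = g']) (use assms in auto)

text \<open>The operator is invariant under isometries of the line. The case \<sigma> = -1 is the
  reflection behind the odd differences in the gradient estimate.\<close>

lemma heat_at_affine:
  assumes "heat_at w t (m + \<sigma> * x) d" "\<sigma> * \<sigma> = 1"
  shows "heat_at (\<lambda>t x. w t (m + \<sigma> * x)) t x d"
proof -
  obtain wt wx wxx where w: "((\<lambda>s. w s (m + \<sigma> * x)) has_real_derivative wt) (at t)"
    "\<And>y. (w t has_real_derivative wx y) (at y)"
    "(wx has_real_derivative wxx) (at (m + \<sigma> * x))" "d = wt - wxx"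
    using assms(1) unfolding heat_at_def by blast
  have aff: "((\<lambda>x. m + \<sigma> * x) has_real_derivative \<sigma>) (at y)" for y
    by (auto intro!: derivative_eq_intros)
  show ?thesis
  proof (rule heat_atI)
    show "((\<lambda>s. w s (m + \<sigma> * x)) has_real_derivative wt) (at t)" by (rule w)
    show "\<And>y. ((\<lambda>x. w t (m + \<sigma> * x)) has_real_derivative wx (m + \<sigma> * y) * \<sigma>) (at y)"
      by (rule DERIV_chain2[OF w(2) aff])
    show "((\<lambda>y. wx (m + \<sigma> * y) * \<sigma>) has_real_derivative (wxx * \<sigma>) * \<sigma>) (at x)"
      by (intro DERIV_cmult_right DERIV_chain2[OF w(3) aff])
    show "d = wt - (wxx * \<sigma>) * \<sigma>" using w(4) assms(2) by (simp add: mult.assoc)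
  qed
qed

lemma heat_at_translate:
  assumes "heat_at w t (x + s) d"
  shows "heat_at (\<lambda>t x. w t (x + s)) t x d"
  using heat_at_affine[of w t s 1 x d] assms by (simp add: add.commute)

text \<open>A positive \<open>g2\<close> would make \<open>g1\<close> increase through its zero at
  \<open>x\<close>, so \<open>g\<close> would grow strictly to the right of
  \<open>x\<close>.\<close>

lemma second_derivative_at_max:
  fixes g :: "real \<Rightarrow> real"
  assumes g: "\<And>y. (g has_real_derivative g1 y) (at y)"
    and g1: "(g1 has_real_derivative g2) (at x)"
    and x: "x \<in> interior S" and max: "\<And>y. y \<in> S \<Longrightarrow> g y \<le> g x"
  shows "g2 \<le> 0"
proof (rule ccontr)
  assume "\<not> g2 \<le> 0"
  then have "0 < g2" by simp
  from DERIV_pos_inc_right[OF g1 this] obtain d where d: "d > 0" "\<And>h. 0 < h \<Longrightarrow> h < d \<Longrightarrow> g1 x < g1 (x + h)"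
    by auto
  obtain e where e: "e > 0" "ball x e \<subseteq> S"
    using x by (meson mem_interior)
  have "g1 x = 0"
  proof (rule DERIV_local_max[OF g e(1)])
    show "\<forall>y. \<bar>x - y\<bar> < e \<longrightarrow> g y \<le> g x"
      using max subsetD[OF e(2)] by (simp add: dist_real_def)
  qed
  define h where "h = min d e / 2"
  have h: "0 < h" "h < d" "h < e" using d(1) e(1) by (auto simp: h_def min_def)
  have "g x < g (x + h)"
  proof (rule DERIV_pos_imp_increasing_open[of x "x + h" g])
    fix u assume "x < u" "u < x + h"
    then show "\<exists>y. (g has_real_derivative y) (at u) \<and> 0 < y"
      using d(2)[of "u - x"] h g[of u] \<open>g1 x = 0\<close> by auto
  next
    show "continuous_on {x..x + h} g" by (intro continuous_at_imp_continuous_on ballI DERIV_isCont[OF g])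
  qed (use h in simp)
  moreover have "x + h \<in> ball x e" using h by (simp add: dist_real_def)
  then have "x + h \<in> S" using e(2) by blast
  ultimately show False using max[of "x + h"] by force
qed

text \<open>The hypothesis is needed only where \<open>w\<close> is positive, so a barrier may fail to be a
  subsolution where it is dominated anyway. The quadratic penalty makes the maximum attained.\<close>

lemma max_principle:
  fixes w :: "real \<Rightarrow> real \<Rightarrow> real"
  assumes S: "closed S" and cont: "continuous_on ({a..b} \<times> S) (\<lambda>(t, x). w t x)"
    and bdd: "\<And>t x. t \<in> {a..b} \<Longrightarrow> x \<in> S \<Longrightarrow> w t x \<le> B"
    and init: "\<And>x. x \<in> S \<Longrightarrow> w a x \<le> 0"
    and step: "\<And>t x. t \<in> {a<..b} \<Longrightarrow> x \<in> S \<Longrightarrow> w t x > 0 \<Longrightarrow>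
       x \<in> interior S \<and> (\<exists>d. heat_at w t x d \<and> d \<le> L * w t x)"
    and tx: "t \<in> {a..b}" "x \<in> S"
  shows "w t x \<le> 0"
proof (rule ccontr)
  assume "\<not> w t x \<le> 0"
  then have pos: "w t x > 0" by simp
  \<comment> \<open>Since \<open>l > L\<close>, the factor \<open>exp (- l * (t - a))\<close> turns
    the zero-order term into one with a definite sign.\<close>
  define l where "l = \<bar>L\<bar> + 1"
  \<comment> \<open>\<open>P\<close> grows quadratically, which confines the positive values of
    \<open>z\<close> to a compact set, and its time derivative minus its second space derivative is
    4 - 2 > 0, which makes the inequality at the maximum strict.\<close>
  define P where "P = (\<lambda>t x::real. 1 + x\<^sup>2 + 4 * (t - a))"
  define A where "A = exp (- l * (t - a)) * w t x"
  have A: "A > 0" using pos by (simp add: A_def)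
  have Pp: "P s y \<ge> 1 + y\<^sup>2" if "s \<ge> a" for s y using that by (simp add: P_def)
  have Pt: "P t x > 0" using Pp[of t x] tx by (smt (verit) atLeastAtMost_iff zero_le_power2)
  define e where "e = A / (2 * P t x)"
  have e: "e > 0" using A Pt by (simp add: e_def)
  define z where "z = (\<lambda>t x. exp (- l * (t - a)) * w t x - e * P t x)"
  have ztx: "z t x > 0"
  proof -
    have "e * P t x = A / 2" using Pt by (simp add: e_def)
    then show ?thesis using A by (simp add: z_def A_def)
  qed
  have zle: "z s y \<le> \<bar>B\<bar> - e * y\<^sup>2" if "s \<in> {a..b}" "y \<in> S" for s y
  proof -
    have "exp (- l * (s - a)) * w s y \<le> exp (- l * (s - a)) * \<bar>B\<bar>"
      using bdd[OF that] by (intro mult_left_mono) auto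
    also have "\<dots> \<le> 1 * \<bar>B\<bar>"
    proof (rule mult_right_mono)
      have "l \<ge> 0" by (simp add: l_def)
      then have "l * (s - a) \<ge> 0" using that by auto
      then show "exp (- l * (s - a)) \<le> 1" by simp
    qed simp
    finally have "exp (- l * (s - a)) * w s y \<le> \<bar>B\<bar>" by simp
    moreover have "e * P s y \<ge> e * y\<^sup>2"
      using Pp[of s y] that e by (intro mult_left_mono) auto
    ultimately show ?thesis by (simp add: z_def)
  qed
  define R where "R = sqrt (\<bar>B\<bar> / e)"
  have out: "\<bar>y\<bar> \<le> R" if "s \<in> {a..b}" "y \<in> S" "z s y > 0" for s y
  proof -
    have "e * y\<^sup>2 \<le> \<bar>B\<bar>" using zle[OF that(1,2)] that(3) by simp
    then have "y\<^sup>2 \<le> \<bar>B\<bar> / e" using e by (simp add: field_simps)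
    then show ?thesis unfolding R_def using real_le_rsqrt by (simp add: real_le_rsqrt)
  qed
  define Q where "Q = {a..b} \<times> (S \<inter> {-R..R})"
  have Qc: "compact Q" unfolding Q_def
    by (intro compact_Times closed_Int_compact S) auto
  have inQ: "(t, x) \<in> Q" using out[OF tx ztx] tx by (auto simp: Q_def)
  have zc: "continuous_on Q (\<lambda>p. z (fst p) (snd p))"
  proof -
    have "continuous_on Q (\<lambda>(t, x). w t x)"
      by (rule continuous_on_subset[OF cont]) (auto simp: Q_def)
    then have "continuous_on Q (\<lambda>p. w (fst p) (snd p))" by (simp add: case_prod_beta')
    then show ?thesis unfolding z_def P_def by (intro continuous_intros)
  qed
  obtain p where p: "p \<in> Q" "\<And>p'. p' \<in> Q \<Longrightarrow> z (fst p') (snd p') \<le> z (fst p) (snd p)"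
    using continuous_attains_sup[OF Qc _ zc] inQ by blast
  obtain t1 x1 where p1: "p = (t1, x1)" by (cases p)
  have t1: "t1 \<in> {a..b}" and x1: "x1 \<in> S" using p(1) by (auto simp: Q_def p1)
  have z1: "z t1 x1 > 0" using p(2)[OF inQ] ztx by (simp add: p1)
  have zmax: "z s y \<le> z t1 x1" if "s \<in> {a..b}" "y \<in> S" for s y
  proof (cases "z s y > 0")
    case True
    then have "(s, y) \<in> Q" using out[OF that True] that by (auto simp: Q_def)
    then show ?thesis using p(2) by (fastforce simp: p1)
  qed (use z1 in simp)
  have w1: "w t1 x1 > 0"
  proof -
    have "e * P t1 x1 > 0" using Pp[of t1 x1] t1 e
      by (smt (verit) atLeastAtMost_iff mult_pos_pos zero_le_power2)
    then have "exp (- l * (t1 - a)) * w t1 x1 > 0" using z1 by (simp add: z_def)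
    then show ?thesis by (simp add: zero_less_mult_iff)
  qed
  then have "t1 \<noteq> a" using init[OF x1] by auto
  then have t1': "t1 \<in> {a<..b}" using t1 by auto
  from step[OF t1' x1 w1] obtain d where x1i: "x1 \<in> interior S"
    and d: "heat_at w t1 x1 d" "d \<le> L * w t1 x1" by blast
  obtain wt wx wxx where w: "((\<lambda>s. w s x1) has_real_derivative wt) (at t1)"
    "\<And>y. (w t1 has_real_derivative wx y) (at y)" "(wx has_real_derivative wxx) (at x1)" "d = wt - wxx"
    using d(1) unfolding heat_at_def by blast
  let ?E = "exp (- l * (t1 - a))"
  have "?E * wxx - 2 * e \<le> 0"
  proof (rule second_derivative_at_max[where g = "z t1" and x = x1 and S = S])
    show "(z t1 has_real_derivative ?E * wx y - e * (2 * y)) (at y)" for y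
      unfolding z_def P_def by (rule derivative_eq_intros w refl | simp)+
    show "((\<lambda>y. ?E * wx y - e * (2 * y)) has_real_derivative ?E * wxx - 2 * e) (at x1)"
      by (rule derivative_eq_intros w refl | simp)+
  qed (use x1i zmax t1 in auto)
  \<comment> \<open>The maximum may sit at the final time, so it is compared with earlier times
    only; this gives a one-sided sign for the time derivative.\<close>
  moreover have "?E * (wt - l * w t1 x1) - 4 * e \<ge> 0"
  proof (rule ccontr)
    let ?D = "?E * (wt - l * w t1 x1) - 4 * e"
    assume "\<not> ?D \<ge> 0"
    then have "?D < 0" by simp
    have "((\<lambda>s. z s x1) has_real_derivative ?D) (at t1)"
      unfolding z_def P_def
      by (rule derivative_eq_intros w refl | simp)+ (simp add: algebra_simps)
    from DERIV_neg_dec_left[OF this \<open>?D < 0\<close>] obtain d0 where d0: "d0 > 0"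
      "\<And>h. 0 < h \<Longrightarrow> h < d0 \<Longrightarrow> z t1 x1 < z (t1 - h) x1" by auto
    define h where "h = min d0 (t1 - a) / 2"
    have h: "0 < h" "h < d0" "h < t1 - a" using d0(1) t1' by (auto simp: h_def min_def)
    then have "z (t1 - h) x1 \<le> z t1 x1" using t1 x1 by (intro zmax) auto
    then show False using d0(2)[OF h(1,2)] by simp
  qed
  moreover have "?E * (d - l * w t1 x1) = ?E * (wt - l * w t1 x1) - ?E * wxx"
    using w(4) by (simp add: right_diff_distrib)
  ultimately have "?E * (d - l * w t1 x1) > 0" using e by linarith
  then have "d > l * w t1 x1" by (simp add: zero_less_mult_iff)
  moreover have "l * w t1 x1 \<ge> L * w t1 x1" using w1 by (intro mult_right_mono) (auto simp: l_def)
  ultimately show False using d(2) by simp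
qed

section \<open>Interior gradient estimate by comparison\<close>

text \<open>The odd difference \<open>D t (x\<^sub>0 + y) - D t (x\<^sub>0 - y)\<close> solves a heat equation in \<open>(t, y)\<close> and vanishes
  at \<open>y = 0\<close>; the factor \<open>t - a\<close> removes the initial layer.\<close>

lemma odd_difference_bound:
  fixes D :: "real \<Rightarrow> real \<Rightarrow> real"
  assumes cont: "continuous_on ({a..a+1} \<times> UNIV) (\<lambda>(t, x). D t x)"
    and heat: "\<And>t x. t \<in> {a<..a+1} \<Longrightarrow> \<bar>x - x0\<bar> \<le> 1 \<Longrightarrow> \<exists>d. heat_at D t x d \<and> \<bar>d\<bar> \<le> B"
    and bdd: "\<And>t x. t \<in> {a..a+1} \<Longrightarrow> \<bar>x - x0\<bar> \<le> 1 \<Longrightarrow> \<bar>D t x\<bar> \<le> B"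
    and y: "y \<in> {0..1}"
  shows "D (a + 1) (x0 + y) - D (a + 1) (x0 - y) \<le> 4 * B * y"
proof -
  have B: "B \<ge> 0" using bdd[of a x0] by simp
  \<comment> \<open>The barrier \<open>2 * B * (y * (2 - y))\<close> contributes
    \<open>4 * B\<close> under the heat operator: \<open>2 * B\<close> absorbs the derivative of the
    factor \<open>t - a\<close>, and \<open>2 * B\<close> absorbs the two source terms. At
    \<open>y = 1\<close> it equals \<open>2 * B\<close> and dominates the difference. The forms
    \<open>1 * y\<close> and \<open>(-1) * y\<close> match \<open>heat_at_affine\<close>.\<close>
  define w where "w = (\<lambda>t y. (t - a) * (D t (x0 + 1 * y) - D t (x0 + (-1) * y)) - 2 * B * (y * (2 - y)))"
  have "w (a + 1) y \<le> 0"
  proof (rule max_principle[where S = "{0..1}" and a = a and b = "a + 1" and w = w and L = 0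
        and B = "2 * B"])
    have c: "continuous_on ({a..a+1} \<times> {0..1}) (\<lambda>p. D (fst p) (x0 + s * snd p))" for s
    proof -
      have "continuous_on ({a..a+1} \<times> {0..1}) (\<lambda>p. (fst p, x0 + s * snd p))"
        by (intro continuous_intros)
      from continuous_on_compose2[OF cont this] show ?thesis by (simp add: image_subset_iff)
    qed
    show "continuous_on ({a..a+1} \<times> {0..1}) (\<lambda>(t, x). w t x)"
      unfolding w_def case_prod_beta' by (intro continuous_intros c)
    have W: "\<bar>D t (x0 + 1 * y) - D t (x0 + (-1) * y)\<bar> \<le> 2 * B" if "t \<in> {a..a+1}" "y \<in> {0..1}" for t y
      using bdd[of t "x0 + y"] bdd[of t "x0 - y"] that by simp
    have W': "(t - a) * (D t (x0 + 1 * y) - D t (x0 + (-1) * y)) \<le> 2 * B"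
      if "t \<in> {a..a+1}" "y \<in> {0..1}" for t y
    proof -
      have "(t - a) * (D t (x0 + 1 * y) - D t (x0 + (-1) * y)) \<le> (t - a) * (2 * B)"
        using W[OF that] that by (intro mult_left_mono) auto
      also have "\<dots> \<le> 1 * (2 * B)" using that B by (intro mult_right_mono) auto
      finally show ?thesis by simp
    qed
    show "w t y \<le> 2 * B" if "t \<in> {a..a+1}" "y \<in> {0..1}" for t y
    proof -
      have "2 * B * (y * (2 - y)) \<ge> 0" using that B by auto
      then show ?thesis using W'[OF that] by (simp add: w_def)
    qed
    show "w a y \<le> 0" if "y \<in> {0..1}" for y using that B by (simp add: w_def)
    show "y \<in> interior {0..1} \<and> (\<exists>d. heat_at w t y d \<and> d \<le> 0 * w t y)"
      if t: "t \<in> {a<..a+1}" and y: "y \<in> {0..1}" and w: "w t y > 0" for t y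
    proof
      have "y \<noteq> 0" using w by (auto simp: w_def)
      moreover have "y \<noteq> 1" using w W'[of t 1] t by (auto simp: w_def)
      ultimately show "y \<in> interior {0..1}" using y by (simp add: interior_atLeastAtMost_real)
      obtain d1 where d1: "heat_at D t (x0 + 1 * y) d1" "\<bar>d1\<bar> \<le> B"
        using heat[of t "x0 + 1 * y"] t y by auto
      obtain d2 where d2: "heat_at D t (x0 + (-1) * y) d2" "\<bar>d2\<bar> \<le> B"
        using heat[of t "x0 + (-1) * y"] t y by auto
      let ?W = "D t (x0 + 1 * y) - D t (x0 + (-1) * y)"
      have q: "heat_at (\<lambda>t y. 2 * B * (y * (2 - y))) t y (4 * B)"
        by (rule heat_atI[where wt = 0 and wx = "\<lambda>y. 2 * B * (2 - 2 * y)" and wxx = "- 4 * B"])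
          (rule derivative_eq_intros refl | simp add: algebra_simps)+
      have "heat_at w t y ((1 * ?W + (t - a) * (d1 - d2)) - 4 * B)"
        unfolding w_def
        by (intro heat_at_diff heat_at_time_mult heat_at_affine d1 d2 q)
          (auto intro!: derivative_eq_intros)
      moreover have "(t - a) * (d1 - d2) \<le> 1 * (2 * B)"
      proof -
        have "(t - a) * (d1 - d2) \<le> (t - a) * (2 * B)" using d1 d2 t by (intro mult_left_mono) auto
        also have "\<dots> \<le> 1 * (2 * B)" using t B by (intro mult_right_mono) auto
        finally show ?thesis .
      qed
      moreover have "?W \<le> 2 * B" using W[of t y] t y by auto
      ultimately show "\<exists>d. heat_at w t y d \<and> d \<le> 0 * w t y" by (intro exI) auto
    qed
  qed (use y in auto)
  moreover have "2 * B * (y * (2 - y)) \<le> 4 * B * y" 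
    using mult_nonneg_nonneg[of B "y * y"] B by (simp add: algebra_simps)
  ultimately show ?thesis by (simp add: w_def)
qed

text \<open>The odd difference about the midpoint of \<open>x\<close> and \<open>x'\<close> is
  applied to \<open>D\<close> and to \<open>- D\<close>. The midpoint is within 1/2 of
  \<open>x\<close>, so the unit interval around it stays within distance 2 of
  \<open>x\<close>.\<close>

lemma local_lipschitz_bound:
  fixes D :: "real \<Rightarrow> real \<Rightarrow> real"
  assumes cont: "continuous_on ({a..a+1} \<times> UNIV) (\<lambda>(t, x). D t x)"
    and heat: "\<And>t y. t \<in> {a<..a+1} \<Longrightarrow> \<bar>y - x\<bar> \<le> 2 \<Longrightarrow> \<exists>d. heat_at D t y d \<and> \<bar>d\<bar> \<le> B"
    and bdd: "\<And>t y. t \<in> {a..a+1} \<Longrightarrow> \<bar>y - x\<bar> \<le> 2 \<Longrightarrow> \<bar>D t y\<bar> \<le> B"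
    and x': "\<bar>x - x'\<bar> \<le> 1"
  shows "\<bar>D (a + 1) x - D (a + 1) x'\<bar> \<le> 2 * B * \<bar>x - x'\<bar>"
proof -
  define m where "m = (x + x') / 2"
  define y where "y = \<bar>x - x'\<bar> / 2"
  have m: "\<bar>z - x\<bar> \<le> 2" if "\<bar>z - m\<bar> \<le> 1" for z
    using that x' unfolding m_def abs_le_iff by (auto simp: field_simps)
  have y: "y \<in> {0..1}" using x' by (simp add: y_def)
  have "D (a + 1) (m + y) - D (a + 1) (m - y) \<le> 4 * B * y"
    by (rule odd_difference_bound[OF cont]) (use heat bdd m y in auto)
  moreover have "(- D (a + 1) (m + y)) - (- D (a + 1) (m - y)) \<le> 4 * B * y"
  proof (rule odd_difference_bound[of _ "\<lambda>t x. - D t x"])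
    show "continuous_on ({a..a + 1} \<times> UNIV) (\<lambda>(t, x). - D t x)"
      using cont by (auto simp: case_prod_beta' intro: continuous_intros)
    show "\<exists>d. heat_at (\<lambda>t x. - D t x) t z d \<and> \<bar>d\<bar> \<le> B" if tz: "t \<in> {a<..a+1}" "\<bar>z - m\<bar> \<le> 1" for t z
    proof -
      obtain d where "heat_at D t z d" "\<bar>d\<bar> \<le> B" using heat[OF tz(1) m[OF tz(2)]] by auto
      then show ?thesis using heat_at_cmult[of D t z d "-1"] by (intro exI[of _ "- d"]) simp
    qed
  qed (use bdd m y in auto)
  moreover have "(x = m + y \<and> x' = m - y) \<or> (x = m - y \<and> x' = m + y)"
    unfolding m_def y_def by (cases "x \<ge> x'") (simp_all add: field_simps)
  ultimately show ?thesis by (auto simp: y_def)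
qed

section \<open>Spreading of positivity by the heat kernel\<close>

lemma gaussian_small:
  fixes d k :: real
  assumes "d > 0" "k > 0"
  shows "\<exists>s. 0 < s \<and> s \<le> 1 \<and> exp (- d\<^sup>2 / (4 * s)) / sqrt s < k"
proof -
  \<comment> \<open>From \<open>exp y \<ge> y\<close> the quotient is at most
    \<open>4 * sqrt s / d\<^sup>2\<close>, and this choice of \<open>s\<close> makes that at most
    \<open>k / 2\<close>.\<close>
  define s where "s = min 1 ((k * d\<^sup>2 / 8)\<^sup>2)"
  have s: "0 < s" "s \<le> 1" using assms by (auto simp: s_def)
  have "d\<^sup>2 / (4 * s) \<le> exp (d\<^sup>2 / (4 * s))" using exp_ge_add_one_self[of "d\<^sup>2 / (4 * s)"] by linarith
  then have "exp (- (d\<^sup>2 / (4 * s))) \<le> 4 * s / d\<^sup>2"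
    using assms s by (simp add: exp_minus field_simps)
  then have "exp (- d\<^sup>2 / (4 * s)) / sqrt s \<le> (4 * s / d\<^sup>2) / sqrt s"
    using s by (intro divide_right_mono) auto
  also have "\<dots> = 4 * (s / sqrt s) / d\<^sup>2" by simp
  also have "\<dots> = 4 * sqrt s / d\<^sup>2" using s real_div_sqrt[of s] by simp
  also have "\<dots> \<le> 4 * (k * d\<^sup>2 / 8) / d\<^sup>2"
  proof -
    have "sqrt s \<le> k * d\<^sup>2 / 8" using assms by (intro real_le_lsqrt) (auto simp: s_def)
    then show ?thesis by (intro divide_right_mono) auto
  qed
  also have "\<dots> < k" using assms by simp
  finally show ?thesis using s by blast
qed

text \<open>The Gauss kernel up to its normalizing constant; the peak value is
  \<open>1 / sqrt s\<close>.\<close>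

definition heat_kernel :: "real \<Rightarrow> real \<Rightarrow> real" where
  "heat_kernel s x = exp (- x\<^sup>2 / (4 * s)) / sqrt s"

lemma heat_kernel_inverse: "heat_kernel s x = exp (- (x\<^sup>2 / 4) * inverse s) * inverse (sqrt s)"
  by (simp add: heat_kernel_def field_simps)

lemma heat_kernel_heat:
  assumes "t + s0 > 0"
  shows "heat_at (\<lambda>t x. heat_kernel (t + s0) (x - c)) t x 0"
proof -
  define s where "s = t + s0"
  have s: "s > 0" using assms by (simp add: s_def)
  define j where "j = inverse s"
  define k where "k = inverse (sqrt s)"
  \<comment> \<open>The two identities bring the time derivative and the second space derivative to
    the same form, the kernel times \<open>(z / 2)\<^sup>2 * j\<^sup>2 - j / 2\<close>.\<close>
  have alg1: "E * (- (z\<^sup>2 / 4) * - (j ^ Suc (Suc 0))) * k + - (k / 2 * j) * E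
      = E * k * ((z / 2)\<^sup>2 * j\<^sup>2 - j / 2)" for E z
    by (simp add: algebra_simps power2_eq_square)
  have alg2: "h * (- (z / 2) * j) * (- (z / 2) * j) + - (1 / 2) * j * h
      = h * ((z / 2)\<^sup>2 * j\<^sup>2 - j / 2)" for h z
    by (simp add: algebra_simps power2_eq_square)
  have k3: "inverse ((sqrt s) ^ Suc (Suc 0)) = j" using s by (simp add: j_def)
  show ?thesis
  proof (rule heat_atI[where w = "\<lambda>t x. heat_kernel (t + s0) (x - c)"])
    have 1: "((\<lambda>s. - ((x - c)\<^sup>2 / 4) * inverse s) has_real_derivative - ((x - c)\<^sup>2 / 4) * - (j ^ Suc (Suc 0))) (at s)"
      using DERIV_cmult[OF DERIV_inverse[of s], of "- ((x - c)\<^sup>2 / 4)"] s unfolding j_def by blast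
    have 2: "((\<lambda>s. inverse (sqrt s)) has_real_derivative - (k / 2 * j)) (at s)"
      using DERIV_inverse_fun[OF DERIV_real_sqrt[OF s]] s unfolding k3 k_def by simp
    from DERIV_mult[OF DERIV_fun_exp[OF 1] 2]
    have "((\<lambda>s. heat_kernel s (x - c)) has_real_derivative
       heat_kernel s (x - c) * (((x - c) / 2)\<^sup>2 * j\<^sup>2 - j / 2)) (at (t + s0))"
      unfolding heat_kernel_inverse s_def[symmetric]
      by (rule DERIV_cong) (unfold j_def[symmetric] k_def[symmetric], rule alg1)
    then show "((\<lambda>t. heat_kernel (t + s0) (x - c)) has_real_derivative
       heat_kernel s (x - c) * (((x - c) / 2)\<^sup>2 * j\<^sup>2 - j / 2)) (at t)"
      by (simp add: DERIV_shift)
    have 3: "((\<lambda>x. heat_kernel s (x - c)) has_real_derivative heat_kernel s (y - c) * (- ((y - c) / 2) * j)) (at y)" for y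
    proof -
      have "((\<lambda>x. - ((x - c)\<^sup>2 / 4) * j) has_real_derivative - ((y - c) / 2) * j) (at y)"
        by (auto intro!: derivative_eq_intros)
      from DERIV_cmult_right[OF DERIV_fun_exp[OF this], of k]
      show ?thesis unfolding heat_kernel_inverse j_def k_def by (rule DERIV_cong) (simp add: mult_ac)
    qed
    then show "((\<lambda>x. heat_kernel (t + s0) (x - c)) has_real_derivative heat_kernel s (y - c) * (- ((y - c) / 2) * j)) (at y)" for y
      unfolding s_def by blast
    have "((\<lambda>y. - ((y - c) / 2) * j) has_real_derivative - (1 / 2) * j) (at x)"
      by (auto intro!: derivative_eq_intros)
    from DERIV_mult[OF 3 this]
    show "((\<lambda>y. heat_kernel s (y - c) * (- ((y - c) / 2) * j)) has_real_derivative
       heat_kernel s (x - c) * (((x - c) / 2)\<^sup>2 * j\<^sup>2 - j / 2)) (at x)"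
      by (rule DERIV_cong) (rule alg2)
  qed simp
qed

text \<open>The comparison function is a heat kernel minus its value at distance \<open>\<delta>\<close> at the starting
  time, so that it is positive initially only within that distance.\<close>

lemma positivity_spreads:
  fixes \<delta> R L :: real
  assumes \<delta>: "\<delta> > 0" and R: "R \<ge> 0" and L: "L \<ge> 0"
  shows "\<exists>\<mu>>0. \<forall>a m x0 D. m \<ge> 0 \<longrightarrow>
     continuous_on ({a..a+1} \<times> UNIV) (\<lambda>(t, x). D t x) \<longrightarrow>
     (\<forall>t\<in>{a..a+1}. \<forall>x. D t x \<ge> 0) \<longrightarrow>
     (\<forall>t\<in>{a<..a+1}. \<forall>x. \<exists>d. heat_at D t x d \<and> d \<ge> - L * D t x) \<longrightarrow>
     (\<forall>x. \<bar>x - x0\<bar> \<le> \<delta> \<longrightarrow> D a x \<ge> m) \<longrightarrow>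
     (\<forall>x. \<bar>x - x0\<bar> \<le> R \<longrightarrow> D (a + 1) x \<ge> \<mu> * m)"
proof -
  \<comment> \<open>\<open>K\<close> bounds the kernel from below within distance \<open>R\<close>
    after unit time, when its age \<open>1 + s0\<close> lies between 1 and 2. Then \<open>s0\<close>
    is taken so small that the subtracted value at distance \<delta> uses up at most half of
    \<open>K\<close>.\<close>
  define K where "K = exp (- R\<^sup>2 / 4) / sqrt 2"
  have "K > 0" by (simp add: K_def)
  then obtain s0 where s0: "0 < s0" "s0 \<le> 1" "heat_kernel s0 \<delta> < K / 2"
    using gaussian_small[OF \<delta>, of "K / 2"] by (auto simp: heat_kernel_def)
  define \<mu> where "\<mu> = sqrt s0 * exp (- L) * (K / 2)"
  show ?thesis
  proof (intro exI[of _ \<mu>] conjI allI impI)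
    show "\<mu> > 0" using s0 \<open>K > 0\<close> by (simp add: \<mu>_def)
    fix a m x0 D x
    assume m: "(0::real) \<le> m" and cont: "continuous_on ({a..a+1} \<times> UNIV) (\<lambda>(t, x). D t x)"
      and D0: "\<forall>t\<in>{a..a+1}. \<forall>x. D t x \<ge> (0::real)"
      and heat: "\<forall>t\<in>{a<..a+1}. \<forall>x. \<exists>d. heat_at D t x d \<and> d \<ge> - L * D t x"
      and init: "\<forall>x. \<bar>x - x0\<bar> \<le> \<delta> \<longrightarrow> D a x \<ge> m" and x: "\<bar>x - x0\<bar> \<le> R"
    define \<phi> where "\<phi> = (\<lambda>t x. heat_kernel (t + (s0 - a)) (x - x0) - heat_kernel s0 \<delta>)"
    \<comment> \<open>The factor \<open>sqrt s0\<close> normalizes the initial peak to 1, so the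
      barrier starts below \<open>m\<close>. The exponential factor absorbs the zero-order term
      \<open>- L * D\<close>.\<close>
    define w where "w = (\<lambda>t x. (m * sqrt s0 * exp (- L * (t - a))) * \<phi> t x - D t x)"
    have heat_kernel_le: "heat_kernel s y \<le> 1 / sqrt s" if "s > 0" for s y
      unfolding heat_kernel_def using that by (intro divide_right_mono) auto
    have "w (a + 1) x \<le> 0"
    proof (rule max_principle[where S = UNIV and a = a and b = "a + 1" and w = w and L = 0
          and B = "m * sqrt s0 * (1 / sqrt s0)"])
      have "continuous_on ({a..a+1} \<times> UNIV) (\<lambda>p. D (fst p) (snd p))"
        using cont by (simp add: case_prod_beta')
      then show "continuous_on ({a..a+1} \<times> UNIV) (\<lambda>(t, x). w t x)"
        unfolding w_def \<phi>_def heat_kernel_def case_prod_beta'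
        using s0 by (intro continuous_intros) auto
      have \<phi>_le: "\<phi> t y \<le> 1 / sqrt s0" if "t \<in> {a..a+1}" for t y
      proof -
        have "heat_kernel (t + (s0 - a)) (y - x0) \<le> 1 / sqrt (t + (s0 - a))" using that s0 by (intro heat_kernel_le) auto
        also have "\<dots> \<le> 1 / sqrt s0" using that s0 by (intro divide_left_mono) auto
        finally have "heat_kernel (t + (s0 - a)) (y - x0) \<le> 1 / sqrt s0" .
        moreover have "heat_kernel s0 \<delta> \<ge> 0" using s0 by (simp add: heat_kernel_def)
        ultimately show ?thesis unfolding \<phi>_def by linarith
      qed
      show "w t y \<le> m * sqrt s0 * (1 / sqrt s0)" if "t \<in> {a..a+1}" for t y
      proof -
        have "(m * sqrt s0 * exp (- L * (t - a))) * \<phi> t y \<le> (m * sqrt s0 * exp (- L * (t - a))) * (1 / sqrt s0)"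
          using m s0 by (intro mult_left_mono \<phi>_le that) auto
        also have "\<dots> \<le> (m * sqrt s0 * 1) * (1 / sqrt s0)"
          using m s0 L that by (intro mult_right_mono mult_left_mono) auto
        finally have "(m * sqrt s0 * exp (- L * (t - a))) * \<phi> t y \<le> m * sqrt s0 * (1 / sqrt s0)" by simp
        moreover have "D t y \<ge> 0" using D0 that by blast
        ultimately show ?thesis unfolding w_def by linarith
      qed
      show "w a y \<le> 0" for y
      proof (cases "\<bar>y - x0\<bar> \<le> \<delta>")
        case True
        have "m * sqrt s0 * \<phi> a y \<le> m * sqrt s0 * (1 / sqrt s0)"
          using m s0 by (intro mult_left_mono \<phi>_le) auto
        then have "m * sqrt s0 * \<phi> a y \<le> m" using s0 by simp
        moreover have "D a y \<ge> m" using init True by blast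
        ultimately show ?thesis by (simp add: w_def)
      next
        case False
        then have "\<delta>\<^sup>2 \<le> (y - x0)\<^sup>2" using \<delta> power_mono[of \<delta> "\<bar>y - x0\<bar>" 2] by simp
        then have "\<phi> a y \<le> 0" using s0 by (auto simp: \<phi>_def heat_kernel_def intro!: divide_right_mono)
        then have "m * sqrt s0 * \<phi> a y \<le> 0" using m s0 by (simp add: mult_nonneg_nonpos)
        then show ?thesis using D0[rule_format, of a y] by (simp add: w_def)
      qed
      show "y \<in> interior UNIV \<and> (\<exists>d. heat_at w t y d \<and> d \<le> 0 * w t y)"
        if t: "t \<in> {a<..a+1}" and w: "w t y > 0" for t y
      proof -
        obtain d where d: "heat_at D t y d" "d \<ge> - L * D t y" using heat t by blast
        let ?g = "\<lambda>t. m * sqrt s0 * exp (- L * (t - a))"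
        have g: "(?g has_real_derivative - L * ?g t) (at t)"
          by (rule derivative_eq_intros refl | simp)+
        have c: "heat_at (\<lambda>t x. heat_kernel s0 \<delta>) t y 0" by (rule heat_at_time) simp
        have h: "heat_at (\<lambda>t x. heat_kernel (t + (s0 - a)) (x - x0)) t y 0"
          by (rule heat_kernel_heat) (use t s0 in auto)
        have "heat_at w t y ((- L * ?g t * \<phi> t y + ?g t * (0 - 0)) - d)"
          unfolding w_def \<phi>_def by (intro heat_at_diff heat_at_time_mult g h c d)
        moreover have "(- L * ?g t * \<phi> t y + ?g t * (0 - 0)) - d \<le> - L * w t y"
          using d(2) by (simp add: w_def algebra_simps)
        moreover have "- L * w t y \<le> 0" using L w by simp
        ultimately show ?thesis by (intro conjI exI) auto
      qed
    qed auto
    then have "D (a + 1) x \<ge> m * sqrt s0 * exp (- L) * \<phi> (a + 1) x" by (simp add: w_def)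
    moreover have "\<phi> (a + 1) x \<ge> K / 2"
    proof -
      have "(x - x0)\<^sup>2 / (4 * (1 + s0)) \<le> R\<^sup>2 / 4"
      proof -
        have "(x - x0)\<^sup>2 \<le> R\<^sup>2" using x by (metis abs_ge_zero power2_abs power_mono)
        then show ?thesis using s0 by (intro frac_le) auto
      qed
      then have "K \<le> heat_kernel (1 + s0) (x - x0)"
        unfolding K_def heat_kernel_def using s0 by (intro frac_le) auto
      then show ?thesis using s0(3) by (simp add: \<phi>_def add.commute)
    qed
    then have "m * sqrt s0 * exp (- L) * \<phi> (a + 1) x \<ge> m * sqrt s0 * exp (- L) * (K / 2)"
      using m s0 by (intro mult_left_mono) auto
    ultimately show "\<mu> * m \<le> D (a + 1) x" by (simp add: \<mu>_def mult_ac)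
  qed
qed

section \<open>The wave and its weight\<close>

text \<open>The hypotheses in directly usable form: \<open>f_dec\<close> is (H3) integrated,
  \<open>U_deriv\<close> is the joint differentiability needed to differentiate along a moving
  shift, and \<open>f_lip\<close> lives on a larger interval than [0,1] because sub- and
  supersolutions leave [0,1] by at most 1.\<close>

locale ignition_front =
  fixes f U Ut Ux Uxx :: "real \<Rightarrow> real \<Rightarrow> real" and \<xi> :: "real \<Rightarrow> real"
    and \<theta> \<theta>\<^sub>s \<beta> L c\<^sub>0 V :: real
  assumes theta: "0 < \<theta>" "\<theta> < \<theta>\<^sub>s" "\<theta>\<^sub>s < 1"
    and beta: "0 < \<beta>" and L: "1 \<le> L" and c0: "0 < c\<^sub>0" and V: "0 \<le> V"
    and f_zero: "\<And>t u. u \<le> \<theta> \<Longrightarrow> f t u = 0"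
    and f_one: "\<And>t. f t 1 = 0"
    and f_lip: "\<And>t u v. u \<in> {-1..2} \<Longrightarrow> v \<in> {-1..2} \<Longrightarrow> \<bar>f t u - f t v\<bar> \<le> L * \<bar>u - v\<bar>"
    and f_dec: "\<And>t u v. \<theta>\<^sub>s \<le> u \<Longrightarrow> u \<le> v \<Longrightarrow> f t v - f t u \<le> - \<beta> * (v - u)"
    and U_deriv: "\<And>t x. ((\<lambda>(t, x). U t x) has_derivative (\<lambda>(h, k). Ut t x * h + Ux t x * k)) (at (t, x))"
    and Ux_deriv: "\<And>t x. (Ux t has_real_derivative Uxx t x) (at x)"
    and U_eq: "\<And>t x. Ut t x = Uxx t x + f t (U t x)"
    and U_range: "\<And>t x. U t x \<in> {0<..<1}"
    and Ux_neg: "\<And>t x. Ux t x < 0"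
    and steep: "\<And>M. \<exists>C>0. \<forall>t x. \<bar>x - \<xi> t\<bar> \<le> M \<longrightarrow> Ux t x \<le> - C"
    and U_ahead: "\<And>t x. \<xi> t \<le> x \<Longrightarrow> U t x \<le> \<theta> * exp (- c\<^sub>0 * (x - \<xi> t))"
    and U_behind: "\<And>\<epsilon>. \<epsilon> > 0 \<Longrightarrow> \<exists>M. \<forall>t x. x \<le> \<xi> t - M \<longrightarrow> 1 - \<epsilon> \<le> U t x"
    and xi_lip: "\<And>t s. \<bar>\<xi> t - \<xi> s\<bar> \<le> V * \<bar>t - s\<bar>"
begin

lemma U_bounds: "0 < U t x" "U t x < 1"
  using U_range[of t x] by auto

lemma U_cont: "continuous_on S (\<lambda>p. U (fst p) (snd p))"
proof -
  have "isCont (\<lambda>(t, x). U t x) p" for p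
    using has_derivative_continuous[OF U_deriv] by (cases p) auto
  then show ?thesis by (intro continuous_at_imp_continuous_on) (simp add: case_prod_beta')
qed

lemma U_deriv_curve:
  assumes g: "(g has_real_derivative g') (at t)" and h: "(h has_real_derivative h') (at t)"
  shows "((\<lambda>s. U (g s) (h s)) has_real_derivative Ut (g t) (h t) * g' + Ux (g t) (h t) * h') (at t)"
proof -
  have "((\<lambda>s. (g s, h s)) has_derivative (\<lambda>s. (g' * s, h' * s))) (at t)"
    using g h unfolding has_field_derivative_def by (intro has_derivative_Pair)
  from has_derivative_compose[OF this U_deriv[of "g t" "h t"]]
  have "((\<lambda>s. U (g s) (h s)) has_derivative (\<lambda>s. Ut (g t) (h t) * (g' * s) + Ux (g t) (h t) * (h' * s))) (at t)"
    by simp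
  then show ?thesis unfolding has_field_derivative_def
    by (rule has_derivative_eq_rhs) (simp add: fun_eq_iff algebra_simps)
qed

lemma U_deriv_x: "(U t has_real_derivative Ux t x) (at x)"
  using U_deriv_curve[of "\<lambda>_. t" 0 x "\<lambda>x. x" 1] by simp

lemma U_antimono: "x \<le> y \<Longrightarrow> U t y \<le> U t x"
proof (rule DERIV_nonpos_imp_nonincreasing[of x y "U t"])
  fix z
  show "\<exists>d. (U t has_real_derivative d) (at z) \<and> d \<le> 0"
    using U_deriv_x[of t z] Ux_neg[of t z] by (intro exI[of _ "Ux t z"]) simp
qed

text \<open>Besides the reaction, the drift of the shift appears as \<open>- \<zeta>' * Ux\<close>,
  which has the sign of \<open>\<zeta>'\<close>. On the steep part of the wave this term pays for
  errors of the reaction.\<close>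

lemma heat_moving_wave:
  assumes "(\<zeta> has_real_derivative \<zeta>') (at t)"
  shows "heat_at (\<lambda>t x. U t (x - \<zeta> t)) t x (f t (U t (x - \<zeta> t)) - \<zeta>' * Ux t (x - \<zeta> t))"
proof (rule heat_atI)
  have "((\<lambda>s. x - \<zeta> s) has_real_derivative - \<zeta>') (at t)"
    using assms by (auto intro!: derivative_eq_intros)
  from U_deriv_curve[OF DERIV_ident this]
  show "((\<lambda>s. U s (x - \<zeta> s)) has_real_derivative Ut t (x - \<zeta> t) - \<zeta>' * Ux t (x - \<zeta> t)) (at t)"
    by (simp add: mult.commute)
  have sh: "((\<lambda>x. x - z) has_real_derivative 1) (at y)" for y z :: real
    by (auto intro!: derivative_eq_intros)
  show "((\<lambda>x. U t (x - \<zeta> t)) has_real_derivative Ux t (y - \<zeta> t)) (at y)" for y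
    using DERIV_chain2[OF U_deriv_x sh] by simp
  show "((\<lambda>y. Ux t (y - \<zeta> t)) has_real_derivative Uxx t (x - \<zeta> t)) (at x)"
    using DERIV_chain2[OF Ux_deriv sh] by simp
  show "f t (U t (x - \<zeta> t)) - \<zeta>' * Ux t (x - \<zeta> t) =
    Ut t (x - \<zeta> t) - \<zeta>' * Ux t (x - \<zeta> t) - Uxx t (x - \<zeta> t)" by (simp add: U_eq)
qed

lemma heat_wave: "heat_at (\<lambda>t x. U t (x - z)) t x (f t (U t (x - z)))"
  using heat_moving_wave[of "\<lambda>_. z" 0 t x] by simp

lemma f_abs_le: "u \<in> {0..1} \<Longrightarrow> \<bar>f t u\<bar> \<le> L * u" "u \<in> {0..1} \<Longrightarrow> \<bar>f t u\<bar> \<le> L * (1 - u)"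
  using f_lip[of u 0 t] f_lip[of u 1 t] f_zero[of 0 t] f_one[of t] theta by auto

text \<open>Both 0 and 1 are zeros of the reaction, so \<open>U - k\<close> solves a heat equation
  whose source is at most \<open>L\<close> times its own size. Closeness of the wave to either state
  therefore makes it flat there.\<close>

lemma U_local_lipschitz:
  assumes x': "\<bar>x - x'\<bar> \<le> 1" and k: "k = 0 \<or> k = 1"
    and B: "\<And>s y. s \<in> {t-1..t} \<Longrightarrow> \<bar>y - x\<bar> \<le> 2 \<Longrightarrow> \<bar>U s y - k\<bar> \<le> B"
  shows "\<bar>U t x - U t x'\<bar> \<le> 2 * L * B * \<bar>x - x'\<bar>"
proof -
  have B0: "B \<ge> 0" using B[of t x] by simp
  have "\<bar>(U (t - 1 + 1) x - k) - (U (t - 1 + 1) x' - k)\<bar> \<le> 2 * (L * B) * \<bar>x - x'\<bar>"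
  proof (rule local_lipschitz_bound[where D = "\<lambda>t x. U t x - k" and a = "t - 1"])
    show "continuous_on ({t - 1..t - 1 + 1} \<times> UNIV) (\<lambda>(t, x). U t x - k)"
      unfolding case_prod_beta' by (intro continuous_intros U_cont)
    show "\<exists>d. heat_at (\<lambda>t x. U t x - k) s y d \<and> \<bar>d\<bar> \<le> L * B"
      if "s \<in> {t-1<..t-1+1}" "\<bar>y - x\<bar> \<le> 2" for s y
    proof (intro exI conjI)
      show "heat_at (\<lambda>t x. U t x - k) s y (f s (U s y) - 0)"
        by (rule heat_at_diff) (use heat_wave[of 0] heat_at_time[of "\<lambda>_. k" 0] in auto)
      have "\<bar>f s (U s y)\<bar> \<le> L * \<bar>U s y - k\<bar>"
        using k f_abs_le[of "U s y" s] U_bounds[of s y] by auto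
      also have "\<dots> \<le> L * B" using B[of s y] that L by (intro mult_left_mono) auto
      finally show "\<bar>f s (U s y) - 0\<bar> \<le> L * B" by simp
    qed
    show "\<bar>U s y - k\<bar> \<le> L * B" if "s \<in> {t-1..t-1+1}" "\<bar>y - x\<bar> \<le> 2" for s y
    proof -
      have "1 * B \<le> L * B" using L B0 by (intro mult_right_mono) auto
      then show ?thesis using B[of s y] that by auto
    qed
  qed (rule x')
  then show ?thesis by simp
qed

text \<open>The notion keeps just what comparison arguments use: joint continuity up to the initial
  time, values in [0,1], and the equation in the pointwise sense of \<open>heat_at\<close>.\<close>

definition sol :: "real \<Rightarrow> (real \<Rightarrow> real \<Rightarrow> real) \<Rightarrow> bool" where
  "sol \<tau> u \<longleftrightarrow> continuous_on ({\<tau>..} \<times> UNIV) (\<lambda>p. u (fst p) (snd p)) \<and>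
     (\<forall>t\<ge>\<tau>. \<forall>x. u t x \<in> {0..1}) \<and> (\<forall>t>\<tau>. \<forall>x. heat_at u t x (f t (u t x)))"

lemma sol_mono: "sol \<tau> u \<Longrightarrow> \<tau> \<le> \<tau>' \<Longrightarrow> sol \<tau>' u"
  unfolding sol_def by (auto elim!: continuous_on_subset)

lemma sol_translate:
  assumes "sol \<tau> u"
  shows "sol \<tau> (\<lambda>t x. u t (x + s))"
proof -
  have "continuous_on ({\<tau>..} \<times> UNIV) (\<lambda>p::real \<times> real. (fst p, snd p + s))"
    by (intro continuous_intros)
  from continuous_on_compose2[OF _ this, of "{\<tau>..} \<times> UNIV" "\<lambda>p. u (fst p) (snd p)"] assms
  have "continuous_on ({\<tau>..} \<times> UNIV) (\<lambda>p. u (fst p) (snd p + s))"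
    by (simp add: sol_def image_subset_iff)
  then show ?thesis using assms unfolding sol_def by (auto intro: heat_at_translate)
qed

end

text \<open>\<eta> is a substitute for \<xi> at bounded distance whose speed never drops below
  \<open>c\<close>. The bound \<open>2 * \<alpha> \<le> c\<close> makes the weight a supersolution;
  \<open>2 * \<alpha> \<le> c\<^sub>0\<close> makes the wave decay at twice the exponent of the
  weight.\<close>

locale weighted_front = ignition_front +
  fixes \<eta> \<eta>' :: "real \<Rightarrow> real" and \<alpha> c D :: real
  assumes eta_deriv: "\<And>t. (\<eta> has_real_derivative \<eta>' t) (at t)"
    and eta': "\<And>t. c \<le> \<eta>' t"
    and eta_xi: "\<And>t. \<bar>\<eta> t - \<xi> t\<bar> \<le> D"
    and c: "0 < c" and alpha: "0 < \<alpha>" "2 * \<alpha> \<le> c" "2 * \<alpha> \<le> c\<^sub>0"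
begin

text \<open>A logistic profile: its space derivative is
  \<open>- \<alpha> * (Gam * (1 - Gam))\<close>, so all derivatives are polynomials in
  \<open>Gam\<close> and no smooth cut-off is required to join the constant to the
  exponential.\<close>

definition Gam :: "real \<Rightarrow> real \<Rightarrow> real" where
  "Gam t x = 1 / (1 + exp (\<alpha> * (x - \<eta> t)))"

lemma D_nonneg: "0 \<le> D"
  using eta_xi[of 0] by simp

lemma Gam_pos: "0 < Gam t x" and Gam_less: "Gam t x < 1"
  by (auto simp: Gam_def add_pos_pos)

lemma Gam_le_half:
  assumes "\<eta> t \<le> x"
  shows "Gam t x \<le> 1 / 2"
proof -
  have "1 \<le> exp (\<alpha> * (x - \<eta> t))" using alpha assms by simp
  then have "2 \<le> 1 + exp (\<alpha> * (x - \<eta> t))" by linarith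
  then show ?thesis unfolding Gam_def by (intro frac_le) auto
qed

lemma eta_diff: "\<bar>t - s\<bar> \<le> 1 \<Longrightarrow> \<bar>\<eta> t - \<eta> s\<bar> \<le> V + 2 * D"
proof -
  assume "\<bar>t - s\<bar> \<le> 1"
  then have "V * \<bar>t - s\<bar> \<le> V * 1" using V by (intro mult_left_mono) auto
  then show ?thesis using xi_lip[of t s] eta_xi[of t] eta_xi[of s] by linarith
qed

text \<open>A Harnack-type comparison: the logarithm of the logistic profile has slope at most
  \<alpha>, so displacements of the point and of \<eta> cost only an exponential factor.\<close>

lemma Gam_compare_gen: "Gam t x \<le> exp (\<alpha> * (\<bar>x - y\<bar> + \<bar>\<eta> t - \<eta> s\<bar>)) * Gam s y"
proof -
  let ?E = "exp (\<alpha> * (\<bar>x - y\<bar> + \<bar>\<eta> t - \<eta> s\<bar>))"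
  have "\<alpha> * (y - \<eta> s) \<le> \<alpha> * (\<bar>x - y\<bar> + \<bar>\<eta> t - \<eta> s\<bar>) + \<alpha> * (x - \<eta> t)"
    unfolding distrib_left[symmetric] using alpha by (intro mult_left_mono) auto
  then have "exp (\<alpha> * (y - \<eta> s)) \<le> ?E * exp (\<alpha> * (x - \<eta> t))"
    unfolding exp_add[symmetric] by simp
  moreover have "1 \<le> ?E" using alpha by simp
  ultimately have "1 + exp (\<alpha> * (y - \<eta> s)) \<le> ?E * (1 + exp (\<alpha> * (x - \<eta> t)))"
    unfolding distrib_left[of ?E] by linarith
  then show ?thesis unfolding Gam_def by (simp add: field_simps add_pos_pos)
qed

lemma Gam_compare:
  assumes "\<bar>t - s\<bar> \<le> 1" "\<bar>x - y\<bar> \<le> R"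
  shows "Gam t x \<le> exp (\<alpha> * (R + V + 2 * D)) * Gam s y"
proof -
  have "exp (\<alpha> * (\<bar>x - y\<bar> + \<bar>\<eta> t - \<eta> s\<bar>)) \<le> exp (\<alpha> * (R + V + 2 * D))"
    using alpha eta_diff[OF assms(1)] assms(2) by simp
  then have "exp (\<alpha> * (\<bar>x - y\<bar> + \<bar>\<eta> t - \<eta> s\<bar>)) * Gam s y \<le> exp (\<alpha> * (R + V + 2 * D)) * Gam s y"
    using Gam_pos[of s y] by (intro mult_right_mono) auto
  then show ?thesis using Gam_compare_gen[of t x y s] by linarith
qed

lemma Gam_translate: "Gam t x \<le> exp (\<alpha> * \<bar>x - y\<bar>) * Gam t y"
  using Gam_compare_gen[of t x y t] by simp

text \<open>A lower bound for the weight at and behind \<xi>; the exponent accounts for the distance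
  \<open>D\<close> between \<eta> and \<xi>.\<close>

definition g0 :: real where "g0 = exp (- \<alpha> * D) / 2"

lemma g0: "0 < g0" "g0 \<le> 1"
proof -
  have "exp (- \<alpha> * D) \<le> 1" using alpha D_nonneg by simp
  then show "g0 \<le> 1" unfolding g0_def by linarith
qed (simp add: g0_def)

lemma Gam_lower: "0 \<le> p \<Longrightarrow> x - \<xi> t \<le> p \<Longrightarrow> g0 * exp (- \<alpha> * p) \<le> Gam t x"
proof -
  assume p: "0 \<le> p" "x - \<xi> t \<le> p"
  have "exp (\<alpha> * (x - \<eta> t)) \<le> exp (\<alpha> * (D + p))"
    using alpha eta_xi[of t] p by simp
  moreover have "1 \<le> exp (\<alpha> * (D + p))" using alpha p D_nonneg by simp
  ultimately have "1 + exp (\<alpha> * (x - \<eta> t)) \<le> 2 * exp (\<alpha> * (D + p))" by linarith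
  then have "1 / (2 * exp (\<alpha> * (D + p))) \<le> Gam t x"
    unfolding Gam_def by (intro divide_left_mono) (auto simp: add_pos_pos)
  then show ?thesis by (simp add: g0_def exp_minus exp_add field_simps)
qed

text \<open>With G = \<open>Gam t x\<close> the operator equals
  \<open>\<alpha> * G * (1 - G) * (\<eta>' - \<alpha> * (1 - 2 * G))\<close>, and
  \<open>2 * \<alpha> \<le> c\<close> leaves at least half the speed in the last factor. The gain
  degenerates behind the front, where G is close to 1; there the reaction has to take over.\<close>

lemma heat_Gam: "\<exists>d. heat_at Gam t x d \<and> \<alpha> * c / 2 * (Gam t x * (1 - Gam t x)) \<le> d"
proof -
  let ?G = "Gam t x"
  have e: "1 + exp p \<noteq> (0::real)" for p by (smt (verit) exp_gt_zero)
  define g where "g = (\<lambda>p::real. 1 / (1 + exp p))"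
  have g: "(g has_real_derivative - (g p * (1 - g p))) (at p)" for p
  proof -
    have "(g has_real_derivative (0 * (1 + exp p) - 1 * (0 + exp p)) / ((1 + exp p) * (1 + exp p))) (at p)"
      unfolding g_def by (intro DERIV_divide DERIV_add DERIV_exp DERIV_const e)
    moreover have "(0 * (1 + exp p) - 1 * (0 + exp p)) / ((1 + exp p) * (1 + exp p)) = - (g p * (1 - g p))"
      unfolding g_def using e[of p] by (simp add: divide_simps)
    ultimately show ?thesis by simp
  qed
  have g2: "((\<lambda>p. - (g p * (1 - g p))) has_real_derivative g p * (1 - g p) * (1 - 2 * g p)) (at p)" for p
    by (auto intro!: derivative_eq_intros g simp: algebra_simps)
  have G: "Gam t = (\<lambda>x. g (\<alpha> * (x - \<eta> t)))" for t by (simp add: Gam_def g_def fun_eq_iff)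
  have px: "((\<lambda>x. \<alpha> * (x - \<eta> t)) has_real_derivative \<alpha>) (at y)" for y
    by (auto intro!: derivative_eq_intros)
  have pt: "((\<lambda>s. \<alpha> * (x - \<eta> s)) has_real_derivative - \<alpha> * \<eta>' t) (at t)"
    by (auto intro!: derivative_eq_intros eta_deriv)
  have "heat_at Gam t x (\<alpha> * (?G * (1 - ?G)) * (\<eta>' t - \<alpha> * (1 - 2 * ?G)))"
  proof (rule heat_atI)
    show "((\<lambda>s. Gam s x) has_real_derivative - (?G * (1 - ?G)) * (- \<alpha> * \<eta>' t)) (at t)"
      unfolding G by (rule DERIV_chain2[OF g pt])
    show "(Gam t has_real_derivative - (Gam t y * (1 - Gam t y)) * \<alpha>) (at y)" for y
      unfolding G by (rule DERIV_chain2[OF g px])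
    show "((\<lambda>y. - (Gam t y * (1 - Gam t y)) * \<alpha>) has_real_derivative
       (?G * (1 - ?G) * (1 - 2 * ?G)) * \<alpha> * \<alpha>) (at x)"
      unfolding G by (intro DERIV_cmult_right DERIV_chain2[OF g2 px])
  qed (simp add: algebra_simps)
  moreover have "\<alpha> * (?G * (1 - ?G)) * (\<eta>' t - \<alpha> * (1 - 2 * ?G)) \<ge> \<alpha> * (?G * (1 - ?G)) * (c / 2)"
  proof (rule mult_left_mono)
    have "\<alpha> * (1 - 2 * ?G) \<le> \<alpha> * 1" using alpha Gam_pos[of t x] by (intro mult_left_mono) auto
    then show "c / 2 \<le> \<eta>' t - \<alpha> * (1 - 2 * ?G)" using eta'[of t] alpha c by linarith
    show "0 \<le> \<alpha> * (?G * (1 - ?G))" using alpha Gam_pos[of t x] Gam_less[of t x] by simp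
  qed
  ultimately show ?thesis by (intro exI conjI) (auto simp: mult_ac)
qed

lemma Gam_cont: "continuous_on S (\<lambda>p. Gam (fst p) (snd p))"
proof -
  have eta: "continuous_on T \<eta>" for T
    by (intro continuous_at_imp_continuous_on ballI DERIV_isCont[OF eta_deriv])
  have "continuous_on S (\<lambda>p. \<eta> (fst p))"
    by (rule continuous_on_compose2[OF eta[of UNIV]]) (auto intro: continuous_intros)
  moreover have "1 + exp p \<noteq> (0::real)" for p by (smt (verit) exp_gt_zero)
  ultimately show ?thesis unfolding Gam_def by (intro continuous_intros) auto
qed

text \<open>The wave is at most \<open>exp (- \<alpha> * z)\<close> squared at distance
  \<open>z\<close> ahead of the interface. One factor becomes smaller than
  \<open>\<epsilon> * g0\<close>, the other is comparable with \<open>Gam\<close>.\<close>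

lemma U_small_ahead:
  assumes "\<epsilon> > 0"
  shows "\<exists>M\<ge>0. \<forall>t x. \<xi> t + M \<le> x \<longrightarrow> U t x \<le> \<epsilon> * Gam t x"
proof -
  define M where "M = max 0 (- ln (\<epsilon> * g0) / \<alpha>)"
  have eg: "0 < \<epsilon> * g0" using assms g0 by simp
  show ?thesis
  proof (intro exI[of _ M] conjI allI impI)
    show "0 \<le> M" by (simp add: M_def)
    fix t x assume x: "\<xi> t + M \<le> x"
    let ?z = "x - \<xi> t"
    have z: "0 \<le> ?z" "M \<le> ?z" using x \<open>0 \<le> M\<close> by auto
    have "- ln (\<epsilon> * g0) / \<alpha> \<le> ?z" using z(2) by (simp add: M_def)
    then have "- \<alpha> * ?z \<le> ln (\<epsilon> * g0)" using alpha by (simp add: field_simps)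
    then have small: "exp (- \<alpha> * ?z) \<le> \<epsilon> * g0" using eg by (metis exp_le_cancel_iff exp_ln)
    have "2 * \<alpha> * ?z \<le> c\<^sub>0 * ?z" using alpha z by (intro mult_right_mono) auto
    then have "U t x \<le> \<theta> * exp (- \<alpha> * ?z + - \<alpha> * ?z)"
      using U_ahead[of t x] z theta by (intro order_trans[OF U_ahead] mult_left_mono) auto
    also have "\<dots> \<le> 1 * exp (- \<alpha> * ?z + - \<alpha> * ?z)" using theta by (intro mult_right_mono) auto
    also have "\<dots> = exp (- \<alpha> * ?z) * exp (- \<alpha> * ?z)" by (simp only: exp_add mult_1)
    also have "\<dots> \<le> (\<epsilon> * g0) * exp (- \<alpha> * ?z)" using small by (intro mult_right_mono) auto
    also have "\<dots> = \<epsilon> * (g0 * exp (- \<alpha> * ?z))" by simp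
    also have "\<dots> \<le> \<epsilon> * Gam t x" using Gam_lower[OF z(1) order_refl] assms by (intro mult_left_mono) auto
    finally show "U t x \<le> \<epsilon> * Gam t x" .
  qed
qed

lemma U_le_Gam: "\<exists>C\<ge>1. \<forall>t x. U t x \<le> C * Gam t x"
proof -
  obtain M where M: "M \<ge> 0" "\<And>t x. \<xi> t + M \<le> x \<Longrightarrow> U t x \<le> 1 * Gam t x"
    using U_small_ahead[of 1] by auto
  define C where "C = max 1 (1 / (g0 * exp (- \<alpha> * M)))"
  show ?thesis
  proof (intro exI[of _ C] conjI allI)
    show "1 \<le> C" by (simp add: C_def)
    fix t x
    show "U t x \<le> C * Gam t x"
    proof (cases "\<xi> t + M \<le> x")
      case True
      have "1 * Gam t x \<le> C * Gam t x" using Gam_pos[of t x] by (intro mult_right_mono) (auto simp: C_def)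
      then show ?thesis using M(2)[OF True] by linarith
    next
      case False
      have p: "0 < g0 * exp (- \<alpha> * M)" using g0 by simp
      have "1 = 1 / (g0 * exp (- \<alpha> * M)) * (g0 * exp (- \<alpha> * M))" using g0 by simp
      also have "\<dots> \<le> C * Gam t x"
        using False M(1) p by (intro mult_mono Gam_lower) (auto simp: C_def)
      finally show ?thesis using U_bounds(2)[of t x] by linarith
    qed
  qed
qed

text \<open>The gradient estimate around the state 0, combined with the fact that the weight varies
  by at most a constant factor over the unit of time and the distance 2 which that estimate
  sees.\<close>

lemma U_lipschitz_unit:
  "\<exists>C\<ge>1. \<forall>t x x'. \<bar>x - x'\<bar> \<le> 1 \<longrightarrow> \<bar>U t x - U t x'\<bar> \<le> C * Gam t x * \<bar>x - x'\<bar>"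
proof -
  obtain C where C: "C \<ge> 1" "\<And>t x. U t x \<le> C * Gam t x" using U_le_Gam by auto
  define E where "E = exp (\<alpha> * (2 + V + 2 * D))"
  have E: "1 \<le> E" using alpha V D_nonneg by (simp add: E_def)
  show ?thesis
  proof (intro exI[of _ "2 * L * (C * E)"] conjI allI impI)
    have "1 * (1 * 1) \<le> L * (C * E)" using L C E by (intro mult_mono) auto
    then show "1 \<le> 2 * L * (C * E)" by simp
    fix t x x' :: real assume x: "\<bar>x - x'\<bar> \<le> 1"
    have "\<bar>U t x - U t x'\<bar> \<le> 2 * L * (C * (E * Gam t x)) * \<bar>x - x'\<bar>"
    proof (rule U_local_lipschitz[where k = 0, OF x])
      fix s y assume "s \<in> {t - 1..t}" "\<bar>y - x\<bar> \<le> 2"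
      then have "Gam s y \<le> E * Gam t x" unfolding E_def by (intro Gam_compare) auto
      then have "C * Gam s y \<le> C * (E * Gam t x)" using C by (intro mult_left_mono) auto
      then show "\<bar>U s y - 0\<bar> \<le> C * (E * Gam t x)" using C(2)[of s y] U_bounds[of s y] by simp
    qed simp
    then show "\<bar>U t x - U t x'\<bar> \<le> 2 * L * (C * E) * Gam t x * \<bar>x - x'\<bar>" by (simp add: mult_ac)
  qed
qed

text \<open>Beyond distance 1 the sum of the two values of \<open>U\<close> is already a sufficient
  bound, since the factor \<open>\<bar>x - x'\<bar>\<close> is then at least 1.\<close>

lemma U_lipschitz:
  "\<exists>C\<ge>1. \<forall>t x x'. \<bar>x - x'\<bar> \<le> R \<longrightarrow> \<bar>U t x - U t x'\<bar> \<le> C * Gam t x * \<bar>x - x'\<bar>"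
proof -
  obtain C1 where C1: "C1 \<ge> 1" "\<And>t x x'. \<bar>x - x'\<bar> \<le> 1 \<Longrightarrow> \<bar>U t x - U t x'\<bar> \<le> C1 * Gam t x * \<bar>x - x'\<bar>"
    using U_lipschitz_unit by blast
  obtain C where C: "C \<ge> 1" "\<And>t x. U t x \<le> C * Gam t x" using U_le_Gam by auto
  define E where "E = exp (\<alpha> * \<bar>R\<bar>)"
  have E: "E \<ge> 1" using alpha by (simp add: E_def)
  define K where "K = C1 + C * E + C"
  show ?thesis
  proof (intro exI[of _ K] conjI allI impI)
    have CE: "0 \<le> C * E" using C E by simp
    then show "1 \<le> K" using C C1 by (simp add: K_def)
    fix t x x' :: real assume x: "\<bar>x - x'\<bar> \<le> R"
    show "\<bar>U t x - U t x'\<bar> \<le> K * Gam t x * \<bar>x - x'\<bar>"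
    proof (cases "\<bar>x - x'\<bar> \<le> 1")
      case True
      have "C1 * Gam t x * \<bar>x - x'\<bar> \<le> K * Gam t x * \<bar>x - x'\<bar>"
        using Gam_pos[of t x] C CE by (intro mult_right_mono) (auto simp: K_def)
      then show ?thesis using C1(2)[OF True, of t] by linarith
    next
      case False
      have "exp (\<alpha> * \<bar>x' - x\<bar>) \<le> E" unfolding E_def using x alpha by (auto simp: abs_minus_commute)
      then have "exp (\<alpha> * \<bar>x' - x\<bar>) * Gam t x \<le> E * Gam t x"
        using Gam_pos[of t x] by (intro mult_right_mono) auto
      then have "Gam t x' \<le> E * Gam t x" using Gam_translate[of t x' x] by linarith
      then have "C * Gam t x' \<le> C * (E * Gam t x)" using C by (intro mult_left_mono) auto
      then have "\<bar>U t x - U t x'\<bar> \<le> C * (E * Gam t x) + C * Gam t x"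
        using C(2)[of t x] C(2)[of t x'] U_bounds[of t x] U_bounds[of t x'] by linarith
      also have "\<dots> \<le> K * Gam t x"
        using Gam_pos[of t x] C1 unfolding K_def by (simp add: algebra_simps)
      also have "\<dots> = K * Gam t x * 1" by simp
      also have "\<dots> \<le> K * Gam t x * \<bar>x - x'\<bar>"
        using Gam_pos[of t x] C C1 CE False by (intro mult_left_mono mult_nonneg_nonneg) (auto simp: K_def)
      finally show ?thesis .
    qed
  qed
qed

text \<open>Ahead of the interface the wave is small relative to \<open>Gam\<close>; behind it
  \<open>1 - U\<close> is small while \<open>Gam\<close> stays above \<open>g0\<close>. The gradient
  estimate around 0 and around 1 turns both facts into flatness.\<close>

lemma U_flat:
  assumes "\<epsilon> > 0"
  shows "\<exists>M\<ge>0. \<forall>t x x'. M \<le> \<bar>x - \<xi> t\<bar> \<longrightarrow> \<bar>x - x'\<bar> \<le> 1 \<longrightarrow>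
    \<bar>U t x - U t x'\<bar> \<le> \<epsilon> * Gam t x * \<bar>x - x'\<bar>"
proof -
  define E where "E = exp (\<alpha> * (2 + V + 2 * D))"
  have E: "1 \<le> E" using alpha V D_nonneg by (simp add: E_def)
  define e where "e = \<epsilon> / (2 * L * E)"
  have e: "0 < e" using assms L E by (simp add: e_def)
  obtain M1 where M1: "M1 \<ge> 0" "\<And>t x. \<xi> t + M1 \<le> x \<Longrightarrow> U t x \<le> e * Gam t x"
    using U_small_ahead[OF e] by auto
  define e2 where "e2 = e * g0"
  have e2: "0 < e2" using e g0 by (simp add: e2_def)
  obtain M2 where M2: "\<And>t x. x \<le> \<xi> t - M2 \<Longrightarrow> 1 - e2 \<le> U t x"
    using U_behind[OF e2] by blast
  \<comment> \<open>The gradient estimate looks 2 to either side and one time unit back, during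
    which the interface moves by at most \<open>V\<close>.\<close>
  define M where "M = max M1 \<bar>M2\<bar> + 2 + V"
  have eE: "2 * L * (e * E) = \<epsilon>" using L E by (simp add: e_def)
  show ?thesis
  proof (intro exI[of _ M] conjI allI impI)
    show "0 \<le> M" using M1 V by (simp add: M_def)
    fix t x x' :: real assume x: "M \<le> \<bar>x - \<xi> t\<bar>" and xx: "\<bar>x - x'\<bar> \<le> 1"
    have xi: "\<bar>\<xi> s - \<xi> t\<bar> \<le> V" if "s \<in> {t-1..t}" for s
    proof -
      have "V * \<bar>s - t\<bar> \<le> V * 1" using that V by (intro mult_left_mono) auto
      then show ?thesis using xi_lip[of s t] by simp
    qed
    show "\<bar>U t x - U t x'\<bar> \<le> \<epsilon> * Gam t x * \<bar>x - x'\<bar>"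
    proof (cases "x \<ge> \<xi> t")
      case True
      have "\<bar>U t x - U t x'\<bar> \<le> 2 * L * (e * (E * Gam t x)) * \<bar>x - x'\<bar>"
      proof (rule U_local_lipschitz[where k = 0, OF xx])
        fix s y assume s: "s \<in> {t - 1..t}" "\<bar>y - x\<bar> \<le> 2"
        then have "Gam s y \<le> E * Gam t x" unfolding E_def by (intro Gam_compare) auto
        then have "e * Gam s y \<le> e * (E * Gam t x)" using e by (intro mult_left_mono) auto
        moreover have "\<xi> s + M1 \<le> y" using xi[OF s(1)] s(2) x True unfolding M_def by linarith
        then have "U s y \<le> e * Gam s y" by (rule M1)
        ultimately show "\<bar>U s y - 0\<bar> \<le> e * (E * Gam t x)" using U_bounds[of s y] by simp
      qed simp
      then have "\<bar>U t x - U t x'\<bar> \<le> (2 * L * (e * E)) * Gam t x * \<bar>x - x'\<bar>" by (simp add: mult_ac)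
      then show ?thesis unfolding eE .
    next
      case False
      have "\<bar>U t x - U t x'\<bar> \<le> 2 * L * e2 * \<bar>x - x'\<bar>"
      proof (rule U_local_lipschitz[where k = 1, OF xx])
        fix s y assume s: "s \<in> {t - 1..t}" "\<bar>y - x\<bar> \<le> 2"
        have "y \<le> \<xi> s - M2" using xi[OF s(1)] s(2) x False unfolding M_def by linarith
        then have "1 - e2 \<le> U s y" by (rule M2)
        then show "\<bar>U s y - 1\<bar> \<le> e2" using U_bounds[of s y] by simp
      qed simp
      also have "2 * L * e2 * \<bar>x - x'\<bar> \<le> \<epsilon> * Gam t x * \<bar>x - x'\<bar>"
      proof (rule mult_right_mono)
        have "g0 \<le> Gam t x" using Gam_lower[of 0 x t] False by simp
        then have "2 * L * e * g0 \<le> 2 * L * e * Gam t x" using L e by (intro mult_left_mono) auto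
        also have "\<dots> = (2 * L * e * Gam t x) * 1" by simp
        also have "\<dots> \<le> (2 * L * e * Gam t x) * E"
          using L e E Gam_pos[of t x] by (intro mult_left_mono) auto
        also have "\<dots> = (2 * L * (e * E)) * Gam t x" by (simp add: mult_ac)
        finally show "2 * L * e2 \<le> \<epsilon> * Gam t x" unfolding eE e2_def by (simp add: mult_ac)
      qed simp
      finally show ?thesis .
    qed
  qed
qed

section \<open>Sub- and supersolutions\<close>

text \<open>One-sided on purpose: \<sigma> = 1 is a bound from above and \<sigma> = -1 a bound from
  below, so that each argument covers both sides at once.\<close>

definition sandwiched :: "real \<Rightarrow> real \<Rightarrow> real \<Rightarrow> (real \<Rightarrow> real \<Rightarrow> real) \<Rightarrow> real \<Rightarrow> bool" where
  "sandwiched \<sigma> \<zeta> q u t \<longleftrightarrow> (\<forall>x. \<sigma> * (u t x - U t (x - \<zeta>)) \<le> q * Gam t x)"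

text \<open>The weaker of the two available dampings: \<beta> from the reaction behind the front,
  and \<open>\<alpha> * c / 4\<close> from the motion of the weight ahead of it, where
  \<open>1 - Gam\<close> is at least 1/2.\<close>

definition rate :: real where "rate = min \<beta> (\<alpha> * c / 4)"

lemma rate_pos: "rate > 0"
  using beta alpha c by (simp add: rate_def)

lemma sandwiched_mono:
  assumes "sandwiched \<sigma> \<zeta> q u t" "\<sigma> = 1 \<or> \<sigma> = -1" "\<sigma> * \<zeta> \<le> \<sigma> * \<zeta>'" "q \<le> q'"
  shows "sandwiched \<sigma> \<zeta>' q' u t"
  unfolding sandwiched_def
proof
  fix x
  have "q * Gam t x \<le> q' * Gam t x" using assms(4) Gam_pos[of t x] by (intro mult_right_mono) auto
  moreover have "\<sigma> * (u t x - U t (x - \<zeta>')) \<le> \<sigma> * (u t x - U t (x - \<zeta>))"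
    using assms(2,3) U_antimono[of "x - \<zeta>'" "x - \<zeta>" t] U_antimono[of "x - \<zeta>" "x - \<zeta>'" t] by auto
  moreover have "\<sigma> * (u t x - U t (x - \<zeta>)) \<le> q * Gam t x" using assms(1) by (simp add: sandwiched_def)
  ultimately show "\<sigma> * (u t x - U t (x - \<zeta>')) \<le> q' * Gam t x" by linarith
qed

text \<open>The super- and subsolutions \<open>U t (x - \<zeta> t) \<plusminus> q t * Gam t x\<close> of Fife and McLeod: behind the
  front the reaction is dissipative, ahead of it \<open>Gam\<close> is a strict supersolution of the heat
  equation, and in between the drift of \<open>\<zeta>\<close> acts on the steep part of the wave.\<close>

lemma sandwich_persists:
  "\<exists>K>0. \<exists>q\<^sub>0>0. q\<^sub>0 \<le> 1 \<and> K * q\<^sub>0 \<le> 1 \<and>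
     (\<forall>\<tau> u \<sigma> \<zeta> q t. sol \<tau> u \<longrightarrow> \<sigma> = 1 \<or> \<sigma> = -1 \<longrightarrow> \<bar>\<zeta>\<bar> \<le> Z \<longrightarrow> 0 \<le> q \<longrightarrow> q \<le> q\<^sub>0 \<longrightarrow>
        sandwiched \<sigma> \<zeta> q u \<tau> \<longrightarrow> \<tau> \<le> t \<longrightarrow> sandwiched \<sigma> (\<zeta> + \<sigma> * K * q) (q * exp (- rate * (t - \<tau>))) u t)"
proof -
  let ?r = rate
  define e where "e = (1 - \<theta>\<^sub>s) / 2"
  have e: "0 < e" using theta by (simp add: e_def)
  obtain M1 where M1: "\<And>t x. x \<le> \<xi> t - M1 \<Longrightarrow> 1 - e \<le> U t x"
    using U_behind[OF e] by blast
  obtain M2 where M2: "M2 \<ge> 0" "\<And>t x. \<xi> t + M2 \<le> x \<Longrightarrow> U t x \<le> (\<theta> / 2) * Gam t x"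
    using U_small_ahead[of "\<theta> / 2"] theta by auto
  \<comment> \<open>Wide enough for the three regions below to cover the line: the moving shift
    stays within \<open>\<bar>Z\<bar> + 1\<close>, and \<open>D\<close> ensures that a point ahead
    of the middle region is also ahead of \<eta>.\<close>
  define M where "M = \<bar>M1\<bar> + M2 + \<bar>Z\<bar> + 1 + D"
  obtain C where C: "C > 0" "\<And>t x. \<bar>x - \<xi> t\<bar> \<le> M \<Longrightarrow> Ux t x \<le> - C"
    using steep[of M] by blast
  \<comment> \<open>Chosen so that \<open>K * rate * C = L + rate\<close>: on the steep part the
    drift then outweighs both the Lipschitz error of the reaction and the decrease of
    \<open>Q\<close>.\<close>
  define K where "K = (L + ?r) / (?r * C)"
  have K: "K > 0" using L C rate_pos by (simp add: K_def)
  have KrC: "K * ?r * C = L + ?r" using C rate_pos by (simp add: K_def)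
  \<comment> \<open>The bound \<open>1 / K\<close> limits the total drift to 1, \<open>e\<close>
    keeps the barrier above \<open>\<theta>\<^sub>s\<close> behind the front, and
    \<open>\<theta> / 2\<close> keeps it below ignition ahead of the front.\<close>
  define q0 where "q0 = Min {1, 1 / K, e, \<theta> / 2}"
  have q0: "0 < q0" "q0 \<le> 1" "q0 \<le> 1 / K" "q0 \<le> e" "q0 \<le> \<theta> / 2"
    using K e theta by (auto simp: q0_def)
  have Kq0: "K * q0 \<le> 1" using q0(3) K by (simp add: field_simps)
  show ?thesis
  proof (rule exI[of _ K], rule conjI[OF K], rule exI[of _ q0], intro conjI allI impI)
    fix \<tau> u \<sigma> \<zeta> q T
    assume u: "sol \<tau> u" and \<sigma>: "\<sigma> = 1 \<or> \<sigma> = (-1::real)" and \<zeta>: "\<bar>\<zeta>\<bar> \<le> Z"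
      and q: "0 \<le> q" "q \<le> q0" and init: "sandwiched \<sigma> \<zeta> q u \<tau>" and T: "\<tau> \<le> T"
    define Q where "Q = (\<lambda>t. q * exp (- ?r * (t - \<tau>)))"
    \<comment> \<open>The drift is proportional to the error already spent, so its total over all
      time is at most \<open>K * q\<close>.\<close>
    define zt where "zt = (\<lambda>t. \<zeta> + \<sigma> * K * (q - Q t))"
    have Qd: "(Q has_real_derivative - ?r * Q t) (at t)" for t
      unfolding Q_def by (auto intro!: derivative_eq_intros)
    have ztd: "(zt has_real_derivative \<sigma> * (K * ?r * Q t)) (at t)" for t
      unfolding zt_def by (auto intro!: derivative_eq_intros Qd)
    have Q: "0 \<le> Q t" "Q t \<le> q" if "t \<ge> \<tau>" for t
      using q rate_pos that by (auto simp: Q_def mult_left_le)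
    have \<sigma>2: "\<sigma> * \<sigma> = 1" "\<bar>\<sigma>\<bar> = 1" using \<sigma> by auto
    have zt: "\<bar>zt t\<bar> \<le> \<bar>Z\<bar> + 1" if "t \<ge> \<tau>" for t
    proof -
      have "K * (q - Q t) \<le> K * q0" using Q[OF that] q K by (intro mult_left_mono) auto
      moreover have "0 \<le> K * (q - Q t)" using Q[OF that] K by simp
      moreover have "zt t = \<zeta> + K * (q - Q t) \<or> zt t = \<zeta> - K * (q - Q t)"
        using \<sigma> by (auto simp: zt_def)
      ultimately show ?thesis using \<zeta> Kq0 by linarith
    qed
    define w where "w = (\<lambda>t x. \<sigma> * (u t x - U t (x - zt t)) - Q t * Gam t x)"
    have U01: "0 < U t x" "U t x < 1" for t x by (rule U_bounds)+
    have "w T x \<le> 0" for x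
    proof (rule max_principle[where S = UNIV and w = w and a = \<tau> and b = T and L = L and B = 2])
      have zc: "continuous_on S zt" "continuous_on S Q" for S
        by (intro continuous_at_imp_continuous_on ballI DERIV_isCont[OF ztd] DERIV_isCont[OF Qd])+
      have c1: "continuous_on ({\<tau>..T} \<times> UNIV) (\<lambda>p. u (fst p) (snd p))"
        using u unfolding sol_def by (auto elim!: continuous_on_subset)
      have c2: "continuous_on ({\<tau>..T} \<times> UNIV) (\<lambda>p. U (fst p) (snd p - zt (fst p)))"
      proof -
        have "continuous_on ({\<tau>..T} \<times> UNIV) (\<lambda>p. (fst p, snd p - zt (fst p)))"
          by (intro continuous_intros continuous_on_compose2[OF zc(1)[of UNIV]]) auto
        from continuous_on_compose2[OF U_cont[of UNIV] this] show ?thesis by simp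
      qed
      have c3: "continuous_on ({\<tau>..T} \<times> UNIV) (\<lambda>p. Q (fst p))"
        by (intro continuous_on_compose2[OF zc(2)[of UNIV]] continuous_intros) auto
      show "continuous_on ({\<tau>..T} \<times> UNIV) (\<lambda>(t, x). w t x)"
        unfolding w_def case_prod_beta' by (intro continuous_intros c1 c2 c3 Gam_cont)
      show "w t x \<le> 2" if "t \<in> {\<tau>..T}" for t x
      proof -
        have "u t x \<in> {0..1}" using u that by (auto simp: sol_def)
        moreover have "0 \<le> Q t * Gam t x" using Q(1)[of t] that Gam_pos[of t x] by auto
        ultimately show ?thesis using \<sigma> U01[of t "x - zt t"] by (auto simp: w_def)
      qed
      show "w \<tau> x \<le> 0" for x
        using init by (auto simp: w_def sandwiched_def Q_def zt_def)
      show "x \<in> interior UNIV \<and> (\<exists>d. heat_at w t x d \<and> d \<le> L * w t x)"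
        if t: "t \<in> {\<tau><..T}" and w: "w t x > 0" for t x
      proof
        have Qt: "0 \<le> Q t" "Q t \<le> q" using Q t by auto
        define G where "G = Gam t x"
        define p where "p = U t (x - zt t)"
        define P where "P = Ux t (x - zt t)"
        define v where "v = p + \<sigma> * (Q t * G)"
        have G: "0 < G" "G < 1" using Gam_pos Gam_less by (auto simp: G_def)
        have QG: "0 \<le> Q t * G" "Q t * G \<le> Q t" using Qt G by (auto simp: mult_left_le)
        obtain d where d: "heat_at Gam t x d" "\<alpha> * c / 2 * (G * (1 - G)) \<le> d"
          using heat_Gam[of t x] by (auto simp: G_def)
        have hu: "heat_at u t x (f t (u t x))" using u t by (auto simp: sol_def)
        have ux: "u t x \<in> {0..1}" using u t by (auto simp: sol_def)
        have p: "0 < p" "p < 1" using U01 by (auto simp: p_def)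
        have v: "v \<in> {-1..2}" using p QG Qt q q0 \<sigma> by (auto simp: v_def)
        have wv: "w t x = \<sigma> * (u t x - v)"
          using \<sigma> by (auto simp: w_def v_def p_def G_def algebra_simps)
        have "heat_at w t x (\<sigma> * (f t (u t x) - (f t p - \<sigma> * (K * ?r * Q t) * P)) - (- ?r * Q t * G + Q t * d))"
          unfolding w_def p_def P_def G_def
          by (intro heat_at_diff heat_at_cmult heat_at_time_mult hu d heat_moving_wave ztd Qd)
        \<comment> \<open>The split separates the comparison of \<open>u\<close> with the barrier
          \<open>v\<close>, which costs \<open>L * w\<close>, from the residual of the barrier
          itself, which must be nonpositive.\<close>
        moreover have "\<sigma> * (f t (u t x) - (f t p - \<sigma> * (K * ?r * Q t) * P)) - (- ?r * Q t * G + Q t * d)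
          = \<sigma> * (f t (u t x) - f t v) + (\<sigma> * (f t v - f t p) + K * ?r * Q t * P + ?r * Q t * G - Q t * d)"
          using \<sigma>2(1) by (auto simp: algebra_simps)
        moreover have "\<sigma> * (f t (u t x) - f t v) \<le> L * w t x"
        proof -
          have "\<sigma> * (f t (u t x) - f t v) \<le> \<bar>f t (u t x) - f t v\<bar>" using \<sigma> by auto
          also have "\<dots> \<le> L * \<bar>u t x - v\<bar>" using ux v by (intro f_lip) auto
          also have "\<bar>u t x - v\<bar> = w t x" using w wv \<sigma> by auto
          finally show ?thesis .
        qed
        moreover have "\<sigma> * (f t v - f t p) + K * ?r * Q t * P + ?r * Q t * G - Q t * d \<le> 0"
        proof -
          have Pneg: "P < 0" using Ux_neg by (simp add: P_def)
          have d0: "0 \<le> d" 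
          proof -
            have "0 \<le> \<alpha> * c / 2 * (G * (1 - G))" using alpha c G by simp
            then show ?thesis using d(2) by linarith
          qed
          have Qd0: "0 \<le> Q t * d" using Qt d0 by simp
          have KP: "K * ?r * Q t * P \<le> 0" using K rate_pos Qt Pneg by (simp add: mult_nonneg_nonpos)
          have vp: "\<bar>v - p\<bar> = Q t * G" using \<sigma> QG by (auto simp: v_def)
          have lip: "\<sigma> * (f t v - f t p) \<le> L * (Q t * G)"
          proof -
            have "\<sigma> * (f t v - f t p) \<le> \<bar>f t v - f t p\<bar>" using \<sigma> by auto
            also have "\<dots> \<le> L * \<bar>v - p\<bar>" using p v by (intro f_lip) auto
            finally show ?thesis using vp by simp
          qed
          consider (behind) "x - zt t \<le> \<xi> t - \<bar>M1\<bar>" | (ahead) "\<xi> t + M2 \<le> x - zt t" "\<eta> t \<le> x"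
            | (middle) "\<bar>(x - zt t) - \<xi> t\<bar> \<le> M"
            using zt[of t] eta_xi[of t] t M2(1) D_nonneg unfolding M_def abs_le_iff by fastforce
          then show ?thesis
          proof cases
            case behind
            then have "1 - e \<le> p" unfolding p_def by (intro M1) auto
            moreover have "\<theta>\<^sub>s = 1 - e - e" by (simp add: e_def)
            ultimately have ge: "\<theta>\<^sub>s \<le> p" "\<theta>\<^sub>s \<le> v" using QG Qt q q0 \<sigma> e by (auto simp: v_def)
            have "\<sigma> * (f t v - f t p) \<le> - \<beta> * (Q t * G)"
              using \<sigma> f_dec[OF ge(1), of v t] f_dec[OF ge(2), of p t] QG by (auto simp: v_def)
            moreover have "?r * Q t * G \<le> \<beta> * (Q t * G)"
              using mult_right_mono[of ?r \<beta> "Q t * G"] QG by (simp add: rate_def mult.assoc)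
            ultimately show ?thesis using KP Qd0 by linarith
          next
            case ahead
            have "p \<le> \<theta> / 2 * Gam t (x - zt t)" unfolding p_def by (rule M2) (rule ahead)
            also have "\<dots> \<le> \<theta> / 2 * 1" using Gam_less theta by (intro mult_left_mono) (auto intro: less_imp_le)
            finally have "p \<le> \<theta>" "v \<le> \<theta>" using theta QG Qt q q0 \<sigma> by (auto simp: v_def)
            then have f0: "f t p = 0" "f t v = 0" by (auto intro: f_zero)
            have "G \<le> 1 / 2" unfolding G_def by (rule Gam_le_half) (rule ahead)
            then have "\<alpha> * c / 2 * (G * (1 / 2)) \<le> \<alpha> * c / 2 * (G * (1 - G))"
              using alpha c G by (intro mult_left_mono) auto
            moreover have "\<alpha> * c / 4 * G = \<alpha> * c / 2 * (G * (1 / 2))" by simp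
            ultimately have "\<alpha> * c / 4 * G \<le> d" using d(2) by linarith
            moreover have "?r * G \<le> \<alpha> * c / 4 * G" using G by (intro mult_right_mono) (auto simp: rate_def)
            ultimately have "Q t * (?r * G) \<le> Q t * d" using Qt by (intro mult_left_mono) auto
            then show ?thesis using f0 KP by (simp add: mult_ac)
          next
            case middle
            then have "P \<le> - C" unfolding P_def by (rule C)
            then have "K * ?r * Q t * P \<le> K * ?r * Q t * (- C)"
              using K rate_pos Qt by (intro mult_left_mono) auto
            also have "\<dots> = - (K * ?r * C) * Q t" by simp
            also have "\<dots> = - (L * Q t) - ?r * Q t" unfolding KrC by (simp add: algebra_simps)
            finally have "K * ?r * Q t * P \<le> - (L * Q t) - ?r * Q t" .
            moreover have "L * (Q t * G) \<le> L * Q t" using QG L by (intro mult_left_mono) auto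
            moreover have "?r * (Q t * G) \<le> ?r * Q t" using QG rate_pos by (intro mult_left_mono) auto
            ultimately show ?thesis using lip Qd0 by (simp add: mult.assoc)
          qed
        qed
        ultimately show "\<exists>d. heat_at w t x d \<and> d \<le> L * w t x"
          by (intro exI conjI) (assumption, linarith)
      qed simp
    qed (use T in auto)
    then have "sandwiched \<sigma> (zt T) (Q T) u T" by (simp add: sandwiched_def w_def)
    then show "sandwiched \<sigma> (\<zeta> + \<sigma> * K * q) (q * exp (- ?r * (T - \<tau>))) u T"
    proof (rule sandwiched_mono[OF _ \<sigma>])
      have "\<sigma> * zt T = \<sigma> * \<zeta> + (\<sigma> * \<sigma>) * (K * (q - Q T))" by (simp add: zt_def algebra_simps)
      moreover have "\<sigma> * (\<zeta> + \<sigma> * K * q) = \<sigma> * \<zeta> + (\<sigma> * \<sigma>) * (K * q)" by (simp add: algebra_simps)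
      moreover have "K * (q - Q T) \<le> K * q" using K Q[OF T] by simp
      ultimately show "\<sigma> * zt T \<le> \<sigma> * (\<zeta> + \<sigma> * K * q)" unfolding \<sigma>2 by linarith
    qed (simp add: Q_def)
  qed (use K q0 Kq0 in auto)
qed

lemma sol_heat_difference:
  assumes "sol \<tau> u" "\<tau> < t" "\<sigma> = 1 \<or> \<sigma> = -1"
  shows "\<exists>d. heat_at (\<lambda>t x. \<sigma> * (U t (x - z) - u t x)) t x d \<and>
    \<bar>d\<bar> \<le> L * \<bar>\<sigma> * (U t (x - z) - u t x)\<bar>"
proof (intro exI conjI)
  let ?d = "\<sigma> * (f t (U t (x - z)) - f t (u t x))"
  have "heat_at u t x (f t (u t x))" using assms by (auto simp: sol_def)
  then show "heat_at (\<lambda>t x. \<sigma> * (U t (x - z) - u t x)) t x ?d"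
    by (intro heat_at_cmult heat_at_diff heat_wave)
  have "u t x \<in> {0..1}" using assms by (auto simp: sol_def)
  then have "\<bar>f t (U t (x - z)) - f t (u t x)\<bar> \<le> L * \<bar>U t (x - z) - u t x\<bar>"
    using U_bounds[of t "x - z"] by (intro f_lip) auto
  then show "\<bar>?d\<bar> \<le> L * \<bar>\<sigma> * (U t (x - z) - u t x)\<bar>" using assms(3) by (auto simp: abs_mult)
qed

lemma sol_cont_difference:
  assumes "sol \<tau> u" "\<tau> \<le> a"
  shows "continuous_on ({a..b} \<times> UNIV) (\<lambda>p. \<sigma> * (U (fst p) (snd p - z) - u (fst p) (snd p)))"
proof -
  have 1: "continuous_on ({a..b} \<times> UNIV) (\<lambda>p. u (fst p) (snd p))"
    using assms unfolding sol_def by (auto elim!: continuous_on_subset)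
  have "continuous_on ({a..b} \<times> UNIV) (\<lambda>p::real \<times> real. (fst p, snd p - z))"
    by (intro continuous_intros)
  from continuous_on_compose2[OF U_cont[of UNIV] this]
  have 2: "continuous_on ({a..b} \<times> UNIV) (\<lambda>p. U (fst p) (snd p - z))" by simp
  show ?thesis by (intro continuous_intros 1 2)
qed

text \<open>Near the interface the side moves inward at no cost. Away from it the price is an error
  \<open>\<epsilon> * \<kappa> * h\<close> with \<open>\<epsilon>\<close> as small as desired, because the wave is flat there.\<close>

lemma push_inward:
  assumes Z: "0 \<le> Z" and \<epsilon>: "0 < \<epsilon>" and C1: "0 < C1" and c1: "0 < c1"
  shows "\<exists>\<kappa>\<^sub>0>0. \<exists>A\<ge>1. \<forall>\<sigma> \<tau> u z h \<kappa> q. sol \<tau> u \<longrightarrow> \<sigma> = 1 \<or> \<sigma> = -1 \<longrightarrow> \<bar>z\<bar> \<le> Z \<longrightarrow> 0 \<le> h \<longrightarrow>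
     0 \<le> q \<longrightarrow> 0 \<le> \<kappa> \<longrightarrow> \<kappa> \<le> \<kappa>\<^sub>0 \<longrightarrow> \<kappa> * h \<le> 1 \<longrightarrow>
     (\<forall>t\<ge>\<tau>. sandwiched \<sigma> z q u t) \<longrightarrow>
     (\<forall>t\<ge>\<tau>. \<forall>x. \<bar>U t (x - z) - u t x\<bar> \<le> C1 * (h + q)) \<longrightarrow>
     c1 * h \<le> \<sigma> * (U (\<tau> + 1) (\<xi> (\<tau> + 1) - z) - u (\<tau> + 1) (\<xi> (\<tau> + 1))) \<longrightarrow>
     sandwiched \<sigma> (z - \<sigma> * (\<kappa> * h)) (A * q + \<epsilon> * (\<kappa> * h)) u (\<tau> + 2)"
proof -
  \<comment> \<open>Over the distance \<delta> the gradient estimate loses at most half of the gap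
    measured at the interface.\<close>
  define \<delta> where "\<delta> = min 1 (c1 / (4 * L * C1))"
  have \<delta>: "0 < \<delta>" "\<delta> \<le> 1" "2 * L * C1 * \<delta> \<le> c1 / 2"
  proof -
    have "0 < 4 * L * C1" using L C1 by simp
    then show "0 < \<delta>" using c1 by (simp add: \<delta>_def)
    have "4 * L * C1 * \<delta> \<le> 4 * L * C1 * (c1 / (4 * L * C1))"
      using \<open>0 < 4 * L * C1\<close> unfolding \<delta>_def by (intro mult_left_mono) auto
    then show "2 * L * C1 * \<delta> \<le> c1 / 2" using L C1 by simp
  qed (simp add: \<delta>_def)
  define Ez where "Ez = exp (\<alpha> * Z)"
  have Ez: "1 \<le> Ez" using alpha Z by (simp add: Ez_def)
  \<comment> \<open>The factor \<open>Ez\<close> pays for moving the weight from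
    \<open>x - z\<close> back to \<open>x\<close>.\<close>
  have "\<epsilon> / Ez > 0" using \<epsilon> Ez by simp
  from U_flat[OF this] obtain M where M: "0 \<le> M"
    "\<And>t x x'. M \<le> \<bar>x - \<xi> t\<bar> \<Longrightarrow> \<bar>x - x'\<bar> \<le> 1 \<Longrightarrow> \<bar>U t x - U t x'\<bar> \<le> \<epsilon> / Ez * Gam t x * \<bar>x - x'\<bar>"
    by blast
  \<comment> \<open>Positivity is centred at the interface of time \<open>\<tau> + 1\<close>. At
    time \<open>\<tau> + 2\<close>, a point farther than \<open>R\<close> from that centre is, after
    translation by \<open>z\<close>, still at distance at least \<open>M\<close> from the current
    interface.\<close>
  define R where "R = M + Z + V"
  have R: "0 \<le> R" using M Z V by (simp add: R_def)
  obtain C2 where C2: "C2 \<ge> 1"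
    "\<And>t x x'. \<bar>x - x'\<bar> \<le> 1 \<Longrightarrow> \<bar>U t x - U t x'\<bar> \<le> C2 * Gam t x * \<bar>x - x'\<bar>"
    using U_lipschitz_unit by blast
  have "0 \<le> L" using L by simp
  from positivity_spreads[OF \<delta>(1) R this] obtain \<mu> where \<mu>: "0 < \<mu>" and spread:
    "\<And>a m x0 D. 0 \<le> m \<Longrightarrow> continuous_on ({a..a+1} \<times> UNIV) (\<lambda>(t, x). D t x) \<Longrightarrow>
     (\<forall>t\<in>{a..a+1}. \<forall>x. 0 \<le> D t x) \<Longrightarrow>
     (\<forall>t\<in>{a<..a+1}. \<forall>x. \<exists>d. heat_at D t x d \<and> d \<ge> - L * D t x) \<Longrightarrow>
     (\<forall>x. \<bar>x - x0\<bar> \<le> \<delta> \<longrightarrow> m \<le> D a x) \<Longrightarrow> (\<forall>x. \<bar>x - x0\<bar> \<le> R \<longrightarrow> \<mu> * m \<le> D (a + 1) x)"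
    by metis
  \<comment> \<open>Moving the side by \<open>\<kappa> * h\<close> changes the wave by at most
    \<open>C2 * \<kappa> * h\<close>, and this choice keeps the change below the gap
    \<open>\<mu> * (c1 / 2 * h)\<close> delivered by \<open>spread\<close>.\<close>
  define k0 where "k0 = \<mu> * (c1 / 2) / C2"
  have k0: "0 < k0" using \<mu> c1 C2 by (simp add: k0_def)
  \<comment> \<open>The 1 compensates the amount by which \<open>D\<close> may be negative;
    \<open>c1\<close> covers the part of the gradient loss that is proportional to
    \<open>q\<close>.\<close>
  define A0 where "A0 = 1 + c1"
  \<comment> \<open>On the compact set the weight is at least \<gamma>, which converts a spatially
    constant error into a multiple of \<open>Gam\<close>.\<close>
  define \<gamma> where "\<gamma> = g0 * exp (- \<alpha> * (R + V))"
  have \<gamma>: "0 < \<gamma>" "\<gamma> \<le> 1"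
  proof -
    show "0 < \<gamma>" using g0 by (simp add: \<gamma>_def)
    have "exp (- \<alpha> * (R + V)) \<le> 1" using alpha R V by simp
    then show "\<gamma> \<le> 1" unfolding \<gamma>_def using g0 by (intro mult_le_one) auto
  qed
  define A where "A = A0 * exp L / \<gamma>"
  have A: "1 \<le> A"
  proof -
    have "1 * 1 \<le> A0 * exp L" using c1 L by (intro mult_mono) (auto simp: A0_def)
    then show ?thesis using \<gamma> by (simp add: A_def)
  qed
  show ?thesis
  proof (rule exI[of _ k0], rule conjI[OF k0], rule exI[of _ A], rule conjI[OF A], intro allI impI)
    fix \<sigma> \<tau> u z h \<kappa> q
    assume u: "sol \<tau> u" and \<sigma>: "\<sigma> = 1 \<or> \<sigma> = (-1::real)" and z: "\<bar>z\<bar> \<le> Z" and h: "0 \<le> h"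
      and q: "0 \<le> q" and \<kappa>: "0 \<le> \<kappa>" "\<kappa> \<le> k0" "\<kappa> * h \<le> 1"
      and sand: "\<forall>t\<ge>\<tau>. sandwiched \<sigma> z q u t"
      and close: "\<forall>t\<ge>\<tau>. \<forall>x. \<bar>U t (x - z) - u t x\<bar> \<le> C1 * (h + q)"
      and gap: "c1 * h \<le> \<sigma> * (U (\<tau> + 1) (\<xi> (\<tau> + 1) - z) - u (\<tau> + 1) (\<xi> (\<tau> + 1)))"
    define D where "D = (\<lambda>t x. \<sigma> * (U t (x - z) - u t x))"
    define x0 where "x0 = \<xi> (\<tau> + 1)"
    have Dabs: "\<bar>D t x\<bar> \<le> C1 * (h + q)" if "t \<ge> \<tau>" for t x
      using close that \<sigma> by (auto simp: D_def abs_mult)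
    have Dlow: "- (q * Gam t x) \<le> D t x" if "t \<ge> \<tau>" for t x
    proof -
      have "\<sigma> * (u t x - U t (x - z)) \<le> q * Gam t x" using sand that by (auto simp: sandwiched_def)
      then show ?thesis by (simp add: D_def algebra_simps)
    qed
    have Dheat: "\<exists>d. heat_at D t x d \<and> \<bar>d\<bar> \<le> L * \<bar>D t x\<bar>" if "t > \<tau>" for t x
      unfolding D_def by (rule sol_heat_difference[OF u that \<sigma>])
    have hq: "0 \<le> h + q" using h q by simp
    \<comment> \<open>The first time unit is spent on the gradient estimate, the second on the
      spreading of positivity; hence the conclusion at \<open>\<tau> + 2\<close>.\<close>
    have near: "c1 / 2 * h - A0 * q \<le> D (\<tau> + 1) x" if x: "\<bar>x - x0\<bar> \<le> \<delta>" for x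
    proof -
      have "\<bar>D (\<tau> + 1) x0 - D (\<tau> + 1) x\<bar> \<le> 2 * (L * (C1 * (h + q))) * \<bar>x0 - x\<bar>"
      proof (rule local_lipschitz_bound)
        show "continuous_on ({\<tau>..\<tau> + 1} \<times> UNIV) (\<lambda>(t, x). D t x)"
          unfolding D_def case_prod_beta' by (rule sol_cont_difference[OF u order_refl])
        show "\<exists>d. heat_at D t y d \<and> \<bar>d\<bar> \<le> L * (C1 * (h + q))" if t: "t \<in> {\<tau><..\<tau> + 1}" for t y
        proof -
          obtain d where d: "heat_at D t y d" "\<bar>d\<bar> \<le> L * \<bar>D t y\<bar>" using Dheat[of t y] t by auto
          moreover have "L * \<bar>D t y\<bar> \<le> L * (C1 * (h + q))" using Dabs[of t y] t L by (intro mult_left_mono) auto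
          ultimately show ?thesis by (meson order_trans)
        qed
        show "\<bar>D t y\<bar> \<le> L * (C1 * (h + q))" if t: "t \<in> {\<tau>..\<tau> + 1}" for t y
        proof -
          have "1 * (C1 * (h + q)) \<le> L * (C1 * (h + q))" using L C1 hq by (intro mult_right_mono) auto
          then show ?thesis using Dabs[of t y] t by auto
        qed
        show "\<bar>x0 - x\<bar> \<le> 1" using x \<delta> by simp
      qed
      also have "\<dots> \<le> 2 * (L * (C1 * (h + q))) * \<delta>"
        using x L C1 hq by (intro mult_left_mono) auto
      also have "\<dots> = (2 * L * C1 * \<delta>) * (h + q)" by (simp add: mult_ac)
      also have "\<dots> \<le> c1 / 2 * (h + q)" using \<delta>(3) hq by (intro mult_right_mono) auto
      finally have "D (\<tau> + 1) x0 - c1 / 2 * (h + q) \<le> D (\<tau> + 1) x" by linarith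
      moreover have "c1 * h \<le> D (\<tau> + 1) x0" using gap by (simp add: D_def x0_def)
      moreover have "c1 / 2 * (h + q) = c1 / 2 * h + c1 / 2 * q" by (simp add: distrib_left)
      moreover have "c1 / 2 * q \<le> A0 * q" using c1 q by (intro mult_right_mono) (auto simp: A0_def)
      ultimately show ?thesis by linarith
    qed
    \<comment> \<open>\<open>D\<close> is nonnegative only up to \<open>q\<close>. Adding a
      spatially constant function with growth rate \<open>L\<close> restores the sign and keeps the
      differential inequality, whichever sign \<open>D\<close> has.\<close>
    define P where "P = (\<lambda>t. A0 * q * exp (L * (t - (\<tau> + 1))))"
    have Pd: "(P has_real_derivative L * P t) (at t)" for t
      unfolding P_def by (auto intro!: derivative_eq_intros)
    have A0: "1 \<le> A0" using c1 by (simp add: A0_def)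
    have P: "q \<le> P t" if "t \<ge> \<tau> + 1" for t
    proof -
      have "1 \<le> exp (L * (t - (\<tau> + 1)))" using L that by simp
      then have "1 * q * 1 \<le> A0 * q * exp (L * (t - (\<tau> + 1)))" using A0 q by (intro mult_mono) auto
      then show ?thesis by (simp add: P_def)
    qed
    have spr: "\<forall>x. \<bar>x - x0\<bar> \<le> R \<longrightarrow> \<mu> * (c1 / 2 * h) \<le> D ((\<tau> + 1) + 1) x + P ((\<tau> + 1) + 1)"
    proof (rule spread[where D = "\<lambda>t x. D t x + P t"])
      show "0 \<le> c1 / 2 * h" using c1 h by simp
      have Pc: "continuous_on ({\<tau> + 1..\<tau> + 1 + 1} \<times> UNIV) (\<lambda>p::real\<times>real. P (fst p))"
        unfolding P_def by (intro continuous_intros)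
      show "continuous_on ({\<tau> + 1..\<tau> + 1 + 1} \<times> UNIV) (\<lambda>(t, x). D t x + P t)"
        unfolding D_def case_prod_beta'
        by (intro continuous_on_add Pc sol_cont_difference[OF u]) simp
      show pos: "\<forall>t\<in>{\<tau> + 1..\<tau> + 1 + 1}. \<forall>x. 0 \<le> D t x + P t"
      proof (intro ballI allI)
        fix t x assume t: "t \<in> {\<tau> + 1..\<tau> + 1 + 1}"
        have "q * Gam t x \<le> q * 1" using q Gam_less[of t x] by (intro mult_left_mono) auto
        then show "0 \<le> D t x + P t" using Dlow[of t x] P[of t] t by auto
      qed
      show "\<forall>t\<in>{\<tau> + 1<..\<tau> + 1 + 1}. \<forall>x. \<exists>d. heat_at (\<lambda>t x. D t x + P t) t x d \<and> - L * (D t x + P t) \<le> d"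
      proof (intro ballI allI)
        fix t x assume t: "t \<in> {\<tau> + 1<..\<tau> + 1 + 1}"
        obtain d where d: "heat_at D t x d" "\<bar>d\<bar> \<le> L * \<bar>D t x\<bar>" using Dheat[of t x] t by auto
        have PL: "0 \<le> L * P t" using L P[of t] q t by simp
        have DP: "0 \<le> L * (D t x + P t)" using pos t L by simp
        have "- L * (D t x + P t) \<le> d + L * P t"
        proof (cases "0 \<le> D t x")
          case True
          then have "\<bar>d\<bar> \<le> L * D t x" using d(2) by simp
          then show ?thesis using PL by (simp add: algebra_simps)
        next
          case False
          then have "\<bar>d\<bar> \<le> - (L * D t x)" using d(2) by simp
          then show ?thesis using DP by (simp add: algebra_simps)
        qed
        then show "\<exists>d. heat_at (\<lambda>t x. D t x + P t) t x d \<and> - L * (D t x + P t) \<le> d"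
          using heat_at_add[OF d(1) heat_at_time[OF Pd]] by blast
      qed
      show "\<forall>x. \<bar>x - x0\<bar> \<le> \<delta> \<longrightarrow> c1 / 2 * h \<le> D (\<tau> + 1) x + P (\<tau> + 1)"
        using near by (fastforce simp: P_def)
    qed
    define t2 where "t2 = \<tau> + 2"
    have t2: "(\<tau> + 1) + 1 = t2" by (simp add: t2_def)
    have P2: "P t2 = A0 * exp L * q" by (simp add: P_def t2_def)
    define k where "k = \<kappa> * h"
    have k: "0 \<le> k" "k \<le> 1" using \<kappa> h by (auto simp: k_def)
    show "sandwiched \<sigma> (z - \<sigma> * (\<kappa> * h)) (A * q + \<epsilon> * (\<kappa> * h)) u (\<tau> + 2)"
      unfolding sandwiched_def k_def[symmetric] t2_def[symmetric]
    proof
      fix x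
      define y where "y = x - z"
      define y' where "y' = x - (z - \<sigma> * k)"
      have yy: "\<bar>y - y'\<bar> = k" using \<sigma> k by (auto simp: y_def y'_def)
      have lhs: "\<sigma> * (u t2 x - U t2 y') \<le> - D t2 x + \<bar>U t2 y - U t2 y'\<bar>"
      proof -
        have "\<sigma> * (u t2 x - U t2 y') = - D t2 x + \<sigma> * (U t2 y - U t2 y')"
          by (simp add: D_def y_def algebra_simps)
        moreover have "\<sigma> * (U t2 y - U t2 y') \<le> \<bar>U t2 y - U t2 y'\<bar>" using \<sigma> by auto
        ultimately show ?thesis by linarith
      qed
      have G: "0 < Gam t2 x" by (rule Gam_pos)
      have xi: "\<bar>\<xi> t2 - x0\<bar> \<le> V" using xi_lip[of t2 "\<tau> + 1"] by (simp add: t2_def x0_def)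
      have "- D t2 x + \<bar>U t2 y - U t2 y'\<bar> \<le> (A * q + \<epsilon> * k) * Gam t2 x"
      proof (cases "\<bar>x - x0\<bar> \<le> R")
        case True
        have "\<bar>U t2 y - U t2 y'\<bar> \<le> C2 * Gam t2 y * k" using C2(2)[of y y' t2] yy k by simp
        also have "\<dots> \<le> C2 * 1 * k"
          using C2(1) k Gam_less[of t2 y] by (intro mult_right_mono mult_left_mono) auto
        also have "\<dots> = (C2 * \<kappa>) * h" by (simp add: k_def)
        also have "\<dots> \<le> (C2 * k0) * h" using \<kappa> h C2 by (intro mult_right_mono mult_left_mono) auto
        also have "\<dots> = \<mu> * (c1 / 2 * h)" using C2 by (simp add: k0_def)
        finally have 1: "\<bar>U t2 y - U t2 y'\<bar> \<le> \<mu> * (c1 / 2 * h)" .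
        have 2: "\<mu> * (c1 / 2 * h) \<le> D t2 x + A0 * exp L * q" using spr True unfolding t2 P2 by blast
        have "\<gamma> \<le> Gam t2 x"
          unfolding \<gamma>_def using True xi R V by (intro Gam_lower) auto
        then have "A * q * \<gamma> \<le> A * q * Gam t2 x" using A q by (intro mult_left_mono) auto
        moreover have "A * q * \<gamma> = A0 * exp L * q" using \<gamma> by (simp add: A_def)
        moreover have "0 \<le> \<epsilon> * k * Gam t2 x" using \<epsilon> k G by simp
        ultimately show ?thesis using 1 2 by (simp add: distrib_right)
      next
        case False
        have "M \<le> \<bar>y - \<xi> t2\<bar>" using False xi z unfolding R_def y_def by linarith
        then have "\<bar>U t2 y - U t2 y'\<bar> \<le> \<epsilon> / Ez * Gam t2 y * k" using M(2)[of y t2 y'] yy k by simp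
        also have "\<dots> \<le> \<epsilon> / Ez * (Ez * Gam t2 x) * k"
        proof -
          have "exp (\<alpha> * \<bar>y - x\<bar>) \<le> Ez" unfolding Ez_def y_def using z alpha by simp
          then have "exp (\<alpha> * \<bar>y - x\<bar>) * Gam t2 x \<le> Ez * Gam t2 x" using G by (intro mult_right_mono) auto
          then have "Gam t2 y \<le> Ez * Gam t2 x" using Gam_translate[of t2 y x] by linarith
          then show ?thesis using \<epsilon> Ez k by (intro mult_right_mono mult_left_mono) auto
        qed
        also have "\<dots> = \<epsilon> * k * Gam t2 x" using Ez by simp
        finally have 1: "\<bar>U t2 y - U t2 y'\<bar> \<le> \<epsilon> * k * Gam t2 x" .
        have "q * Gam t2 x \<le> A * q * Gam t2 x"
          using mult_right_mono[of 1 A "q * Gam t2 x"] A q G by (simp add: mult.assoc)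
        moreover have "- (q * Gam t2 x) \<le> D t2 x" by (rule Dlow) (simp add: t2_def)
        ultimately show ?thesis using 1 by (simp add: distrib_right)
      qed
      then show "\<sigma> * (u t2 x - U t2 y') \<le> (A * q + \<epsilon> * k) * Gam t2 x" using lhs by linarith
    qed
  qed
qed

lemma U_gap_at_interface:
  "\<exists>c>0. \<forall>t a b. \<bar>a\<bar> \<le> Y \<longrightarrow> \<bar>b\<bar> \<le> Y \<longrightarrow> a \<le> b \<longrightarrow> c * (b - a) \<le> U t (\<xi> t - b) - U t (\<xi> t - a)"
proof -
  obtain c where c: "c > 0" "\<And>t x. \<bar>x - \<xi> t\<bar> \<le> Y \<Longrightarrow> Ux t x \<le> - c"
    using steep[of Y] by blast
  show ?thesis
  proof (intro exI[of _ c] conjI allI impI)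
    fix t a b :: real assume ab: "\<bar>a\<bar> \<le> Y" "\<bar>b\<bar> \<le> Y" "a \<le> b"
    show "c * (b - a) \<le> U t (\<xi> t - b) - U t (\<xi> t - a)"
    proof (cases "a = b")
      case False
      then have "\<xi> t - b < \<xi> t - a" using ab by simp
      from MVT2[OF this, of "U t" "Ux t"] U_deriv_x obtain y where
        y: "\<xi> t - b < y" "y < \<xi> t - a" "U t (\<xi> t - a) - U t (\<xi> t - b) = (\<xi> t - a - (\<xi> t - b)) * Ux t y"
        by blast
      have "Ux t y \<le> - c" using y ab by (intro c) auto
      then have "(b - a) * Ux t y \<le> (b - a) * (- c)" using ab by (intro mult_left_mono) auto
      then show ?thesis using y(3) by (simp add: algebra_simps)
    qed simp
  qed (rule c)
qed

section \<open>Contraction of the shift gap\<close>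

text \<open>At the interface the two shifted waves differ by a multiple of their gap, so the
  solution is at least half of that away from one of them, and that side can be pushed inward.
  Persistence then restarts the decay of the error at time \<open>\<tau> + 2\<close>. The crude
  first conclusion, valid at all later times, serves to bridge the time between two steps.\<close>

lemma squeeze:
  assumes Y: "0 \<le> Y"
  shows "\<exists>\<kappa>>0. \<exists>B\<ge>1. \<exists>q\<^sub>1>0. \<kappa> < 1 \<and> (\<forall>\<tau> u a b q. sol \<tau> u \<longrightarrow> \<bar>a\<bar> \<le> Y \<longrightarrow> \<bar>b\<bar> \<le> Y \<longrightarrow> a \<le> b \<longrightarrow>
      0 \<le> q \<longrightarrow> q \<le> q\<^sub>1 \<longrightarrow> sandwiched 1 b q u \<tau> \<longrightarrow> sandwiched (-1) a q u \<tau> \<longrightarrow>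
      (\<forall>t\<ge>\<tau>. sandwiched 1 (b + B * q) q u t \<and> sandwiched (-1) (a - B * q) q u t) \<and>
      (\<exists>a' b'. a' \<le> b' \<and> b' - a' \<le> (1 - \<kappa> / 2) * (b - a) + B * q \<and>
         b' \<le> b + \<kappa> / 4 * (b - a) + B * q \<and> a - \<kappa> / 4 * (b - a) - B * q \<le> a' \<and>
         (\<forall>t\<ge>\<tau> + 2. sandwiched 1 b' ((B * q + (b - a)) * exp (- rate * (t - \<tau> - 2))) u t \<and>
            sandwiched (-1) a' ((B * q + (b - a)) * exp (- rate * (t - \<tau> - 2))) u t)))"
proof -
  obtain K q0 where K: "K > 0" and q0: "q0 > 0" "q0 \<le> 1" "K * q0 \<le> 1"
    and persist: "\<And>\<tau> u \<sigma> \<zeta> q t. sol \<tau> u \<Longrightarrow> \<sigma> = 1 \<or> \<sigma> = -1 \<Longrightarrow> \<bar>\<zeta>\<bar> \<le> Y + 1 \<Longrightarrow> 0 \<le> q \<Longrightarrow> q \<le> q0 \<Longrightarrow>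
        sandwiched \<sigma> \<zeta> q u \<tau> \<Longrightarrow> \<tau> \<le> t \<Longrightarrow> sandwiched \<sigma> (\<zeta> + \<sigma> * K * q) (q * exp (- rate * (t - \<tau>))) u t"
    using sandwich_persists[of "Y + 1"] by metis
  obtain C1 where C1: "C1 \<ge> 1"
    "\<And>t x x'. \<bar>x - x'\<bar> \<le> 2 * (Y + 1) \<Longrightarrow> \<bar>U t x - U t x'\<bar> \<le> C1 * Gam t x * \<bar>x - x'\<bar>"
    using U_lipschitz[of "2 * (Y + 1)"] by blast
  obtain c where c: "c > 0" and ugap: "\<And>t a b. \<bar>a\<bar> \<le> Y + 1 \<Longrightarrow> \<bar>b\<bar> \<le> Y + 1 \<Longrightarrow> a \<le> b \<Longrightarrow>
     c * (b - a) \<le> U t (\<xi> t - b) - U t (\<xi> t - a)"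
    using U_gap_at_interface[of "Y + 1"] by blast
  \<comment> \<open>With \<open>K * \<epsilon> \<le> 1 / 4\<close>, each side gives back at most
    about a quarter of the gain \<open>\<kappa> * h\<close> when the new error is removed, so a net
    gain of half remains.\<close>
  define \<epsilon> where "\<epsilon> = 1 / (4 * (K + 1))"
  have \<epsilon>: "0 < \<epsilon>" "\<epsilon> \<le> 1" "K * \<epsilon> \<le> 1 / 4" using K by (auto simp: \<epsilon>_def field_simps)
  have "0 \<le> Y + 1" "0 < C1" "0 < c / 2" using Y C1 c by auto
  from push_inward[OF this(1) \<epsilon>(1) this(2,3)] obtain k0 A where k0: "k0 > 0" and A: "A \<ge> 1"
    and push: "\<And>\<sigma> \<tau> u z h \<kappa> q. sol \<tau> u \<Longrightarrow> \<sigma> = 1 \<or> \<sigma> = -1 \<Longrightarrow> \<bar>z\<bar> \<le> Y + 1 \<Longrightarrow> 0 \<le> h \<Longrightarrow>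
     0 \<le> q \<Longrightarrow> 0 \<le> \<kappa> \<Longrightarrow> \<kappa> \<le> k0 \<Longrightarrow> \<kappa> * h \<le> 1 \<Longrightarrow>
     (\<forall>t\<ge>\<tau>. sandwiched \<sigma> z q u t) \<Longrightarrow>
     (\<forall>t\<ge>\<tau>. \<forall>x. \<bar>U t (x - z) - u t x\<bar> \<le> C1 * (h + q)) \<Longrightarrow>
     c / 2 * h \<le> \<sigma> * (U (\<tau> + 1) (\<xi> (\<tau> + 1) - z) - u (\<tau> + 1) (\<xi> (\<tau> + 1))) \<Longrightarrow>
     sandwiched \<sigma> (z - \<sigma> * (\<kappa> * h)) (A * q + \<epsilon> * (\<kappa> * h)) u (\<tau> + 2)"
    by metis
  \<comment> \<open>The gap after the preliminary drift is at most \<open>2 * Y + 2\<close>. The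
    last two entries therefore keep the displacement below 1 and below \<open>q0 / 2\<close>;
    together with \<open>A * q1 = q0 / 2\<close> the new error stays admissible for
    persistence.\<close>
  define \<kappa> where "\<kappa> = Min {k0, 1 / (2 * Y + 3), q0 / (2 * (2 * Y + 3))}"
  have \<kappa>: "0 < \<kappa>" "\<kappa> \<le> k0" "\<kappa> \<le> 1 / (2 * Y + 3)" "\<kappa> \<le> q0 / (2 * (2 * Y + 3))"
    using k0 Y q0 by (auto simp: \<kappa>_def)
  have \<kappa>1: "\<kappa> < 1"
  proof -
    have "1 / (2 * Y + 3) < 1" using Y by simp
    then show ?thesis using \<kappa>(3) by linarith
  qed
  have \<kappa>h: "\<kappa> * h \<le> 1" "\<kappa> * h \<le> q0 / 2" if "0 \<le> h" "h \<le> 2 * Y + 2" for h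
  proof -
    have "\<kappa> * h \<le> 1 / (2 * Y + 3) * (2 * Y + 3)" using \<kappa> that Y by (intro mult_mono) auto
    then show "\<kappa> * h \<le> 1" using Y by simp
    have "\<kappa> * h \<le> q0 / (2 * (2 * Y + 3)) * (2 * Y + 3)" using \<kappa> that Y q0 by (intro mult_mono) auto
    also have "\<dots> = q0 / 2" using Y by (simp add: field_simps)
    finally show "\<kappa> * h \<le> q0 / 2" .
  qed
  define q1 where "q1 = q0 / (2 * A)"
  have q1: "0 < q1" "q1 \<le> q0" "A * q1 = q0 / 2"
    using q0 A by (auto simp: q1_def field_simps)
  define B where "B = 1 + 4 * K + 2 * (K * A) + A"
  have KA: "0 < K * A" using K A by simp
  have B: "B \<ge> 1" using K A KA by (simp add: B_def)
  show ?thesis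
  proof (rule exI[of _ \<kappa>], rule conjI[OF \<kappa>(1)], rule exI[of _ B], rule conjI[OF B],
      rule exI[of _ q1], rule conjI[OF q1(1)], rule conjI[OF \<kappa>1], intro allI impI)
    fix \<tau> u a b q
    assume u: "sol \<tau> u" and a: "\<bar>a\<bar> \<le> Y" and b: "\<bar>b\<bar> \<le> Y" and ab: "a \<le> b" and q: "0 \<le> q" "q \<le> q1"
      and Sb: "sandwiched 1 b q u \<tau>" and Sa: "sandwiched (-1) a q u \<tau>"
    define h where "h = b - a"
    define a1 where "a1 = a - K * q"
    define b1 where "b1 = b + K * q"
    define h1 where "h1 = h + 2 * (K * q)"
    have qq0: "q \<le> q0" using q q1 by linarith
    have Kq: "0 \<le> K * q" "K * q \<le> 1"
    proof -
      have "K * q \<le> K * q0" using qq0 K by (intro mult_left_mono) auto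
      then show "K * q \<le> 1" using q0 by linarith
    qed (use K q in simp)
    have h: "0 \<le> h" using ab by (simp add: h_def)
    have h1: "0 \<le> h1" "h1 \<le> 2 * Y + 2" "h1 = b1 - a1"
      using h Kq a b by (auto simp: h1_def h_def a1_def b1_def)
    have a1: "\<bar>a1\<bar> \<le> Y + 1" and b1: "\<bar>b1\<bar> \<le> Y + 1" using a b Kq by (auto simp: a1_def b1_def)
    have decay: "q * exp (- rate * (t - \<tau>)) \<le> q" if "\<tau> \<le> t" for t
      using that q rate_pos by (intro mult_left_le) auto
    have up: "sandwiched 1 b1 q u t" if t: "\<tau> \<le> t" for t
    proof -
      have "\<bar>b\<bar> \<le> Y + 1" using b by simp
      with persist[OF u _ _ q(1) qq0 Sb t]
      have "sandwiched 1 (b + 1 * K * q) (q * exp (- rate * (t - \<tau>))) u t" by blast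
      then show ?thesis by (rule sandwiched_mono) (use decay[OF t] in \<open>auto simp: b1_def\<close>)
    qed
    have lo: "sandwiched (-1) a1 q u t" if t: "\<tau> \<le> t" for t
    proof -
      have "\<bar>a\<bar> \<le> Y + 1" using a by simp
      with persist[OF u _ _ q(1) qq0 Sa t]
      have "sandwiched (-1) (a + (-1) * K * q) (q * exp (- rate * (t - \<tau>))) u t" by blast
      then show ?thesis by (rule sandwiched_mono) (use decay[OF t] in \<open>auto simp: a1_def\<close>)
    qed
    have KB: "K * q \<le> B * q" using KA K A q by (intro mult_right_mono) (auto simp: B_def)
    have first: "\<forall>t\<ge>\<tau>. sandwiched 1 (b + B * q) q u t \<and> sandwiched (-1) (a - B * q) q u t"
      using sandwiched_mono[OF up, of _ "b + B * q" q] sandwiched_mono[OF lo, of _ "a - B * q" q] KB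
      by (auto simp: a1_def b1_def)
    have wgap: "\<bar>U t (x - b1) - U t (x - a1)\<bar> \<le> C1 * h1" for t x
    proof -
      have "\<bar>U t (x - b1) - U t (x - a1)\<bar> \<le> C1 * Gam t (x - b1) * \<bar>(x - b1) - (x - a1)\<bar>"
        using h1 by (intro C1) auto
      also have "\<dots> = C1 * Gam t (x - b1) * h1" using h1 by simp
      also have "\<dots> \<le> C1 * 1 * h1"
        using h1 C1 Gam_less[of t "x - b1"] by (intro mult_right_mono mult_left_mono) auto
      finally show ?thesis by simp
    qed
    have qC: "q * Gam t x \<le> C1 * q" for t x
      using mult_left_mono[of "Gam t x" 1 q] Gam_less[of t x] q mult_right_mono[of 1 C1 q] C1 by simp
    have sup: "u t x - U t (x - b1) \<le> C1 * q" "U t (x - a1) - u t x \<le> C1 * q" if "\<tau> \<le> t" for t x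
      using up[OF that] lo[OF that] qC[of t x] unfolding sandwiched_def by (smt (verit))+
    have C1h: "0 \<le> C1 * h1" "0 \<le> C1 * q" using C1 h1 q by auto
    have closeb: "\<bar>U t (x - b1) - u t x\<bar> \<le> C1 * (h1 + q)" and closea: "\<bar>U t (x - a1) - u t x\<bar> \<le> C1 * (h1 + q)"
      if "\<tau> \<le> t" for t x
      using sup[OF that, of x] wgap[of t x] C1h unfolding distrib_left by linarith+
    define q' where "q' = A * q + \<epsilon> * (\<kappa> * h1)"
    have \<kappa>h1: "0 \<le> \<kappa> * h1" "\<kappa> * h1 \<le> 1" "\<kappa> * h1 \<le> q0 / 2" using \<kappa>h[of h1] h1 \<kappa> by auto
    have \<epsilon>\<kappa>: "0 \<le> \<epsilon> * (\<kappa> * h1)" "\<epsilon> * (\<kappa> * h1) \<le> \<kappa> * h1" 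
      using \<epsilon> \<kappa>h1 by (auto simp: mult_left_le_one_le)
    have Aq: "q \<le> A * q" "A * q \<le> q0 / 2"
      using mult_right_mono[of 1 A q] A q mult_left_mono[of q q1 A] q1 by auto
    have q': "q \<le> q'" "q' \<le> q0" "0 \<le> q'" using Aq \<epsilon>\<kappa> \<kappa>h1 q by (auto simp: q'_def)
    have "\<exists>a2 b2. \<bar>a2\<bar> \<le> Y + 1 \<and> \<bar>b2\<bar> \<le> Y + 1 \<and> a1 \<le> a2 \<and> b2 \<le> b1 \<and> b2 - a2 = (1 - \<kappa>) * h1 \<and>
       sandwiched 1 b2 q' u (\<tau> + 2) \<and> sandwiched (-1) a2 q' u (\<tau> + 2)"
    proof -
      let ?s = "\<tau> + 1" and ?x = "\<xi> (\<tau> + 1)"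
      have \<kappa>h1': "\<kappa> * h1 \<le> h1" using \<kappa> \<kappa>1 h1 by (simp add: mult_left_le_one_le)
      have "c * h1 \<le> U ?s (?x - b1) - U ?s (?x - a1)" unfolding h1(3)
        using a1 b1 h1 by (intro ugap) auto
      \<comment> \<open>The two alternatives add up to the gap between the waves, so one of them
        holds with half the constant.\<close>
      then consider (upper) "c / 2 * h1 \<le> U ?s (?x - b1) - u ?s ?x" | (lower) "c / 2 * h1 \<le> u ?s ?x - U ?s (?x - a1)"
        by fastforce
      then show ?thesis
      proof cases
        case upper
        have "sandwiched 1 (b1 - 1 * (\<kappa> * h1)) (A * q + \<epsilon> * (\<kappa> * h1)) u (\<tau> + 2)"
          by (rule push[OF u _ b1 h1(1) q(1)]) (use \<kappa> \<kappa>h1 up closeb upper in auto)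
        moreover have "sandwiched (-1) a1 q' u (\<tau> + 2)"
          by (rule sandwiched_mono[OF lo]) (use q' in auto)
        ultimately show ?thesis
          using a1 b1 \<kappa>h1 \<kappa>h1' h1(3) unfolding q'_def
          by (intro exI[of _ a1] exI[of _ "b1 - \<kappa> * h1"]) (auto simp: algebra_simps)
      next
        case lower
        have "sandwiched (-1) (a1 - (-1) * (\<kappa> * h1)) (A * q + \<epsilon> * (\<kappa> * h1)) u (\<tau> + 2)"
          by (rule push[OF u _ a1 h1(1) q(1)]) (use \<kappa> \<kappa>h1 lo closea lower in auto)
        moreover have "sandwiched 1 b1 q' u (\<tau> + 2)"
          by (rule sandwiched_mono[OF up]) (use q' in auto)
        ultimately show ?thesis
          using a1 b1 \<kappa>h1 \<kappa>h1' h1(3) unfolding q'_def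
          by (intro exI[of _ "a1 + \<kappa> * h1"] exI[of _ b1]) (auto simp: algebra_simps)
      qed
    qed
    then obtain a2 b2 where a2: "\<bar>a2\<bar> \<le> Y + 1" "a1 \<le> a2" and b2: "\<bar>b2\<bar> \<le> Y + 1" "b2 \<le> b1"
      and h2: "b2 - a2 = (1 - \<kappa>) * h1" and S2: "sandwiched 1 b2 q' u (\<tau> + 2)" "sandwiched (-1) a2 q' u (\<tau> + 2)"
      by blast
    define a' where "a' = a2 - K * q'"
    define b' where "b' = b2 + K * q'"
    have Kq': "0 \<le> K * q'" "K * q' \<le> (K * A) * q + \<kappa> / 4 * h + K * q"
    proof -
      show "0 \<le> K * q'" using K q' by simp
      have "K * q' = (K * A) * q + (K * \<epsilon>) * (\<kappa> * h1)" by (simp add: q'_def algebra_simps)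
      also have "\<dots> \<le> (K * A) * q + 1 / 4 * (\<kappa> * h1)"
        using \<epsilon> \<kappa>h1 by (intro add_left_mono mult_right_mono) auto
      also have "\<dots> = (K * A) * q + \<kappa> / 4 * h + \<kappa> * (K * q / 2)" by (simp add: h1_def algebra_simps)
      also have "\<dots> \<le> (K * A) * q + \<kappa> / 4 * h + 1 * (K * q)"
        using \<kappa> \<kappa>1 Kq by (intro add_left_mono mult_mono) auto
      finally show "K * q' \<le> (K * A) * q + \<kappa> / 4 * h + K * q" by simp
    qed
    have Bq: "B * q = q + 4 * (K * q) + 2 * ((K * A) * q) + A * q" by (simp add: B_def algebra_simps)
    have KAq: "0 \<le> (K * A) * q" using KA q by simp
    have \<kappa>hh: "(1 - \<kappa>) * h1 \<le> (1 - \<kappa>) * h + 2 * (K * q)"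
    proof -
      have "(1 - \<kappa>) * (2 * (K * q)) \<le> 1 * (2 * (K * q))" using \<kappa> Kq by (intro mult_right_mono) auto
      then show ?thesis by (simp add: h1_def distrib_left)
    qed
    have g1: "a' \<le> b'"
    proof -
      have "0 \<le> (1 - \<kappa>) * h1" using \<kappa>1 h1 by simp
      then show ?thesis using h2 Kq' by (simp add: a'_def b'_def)
    qed
    have g2: "b' - a' \<le> (1 - \<kappa> / 2) * h + B * q"
    proof -
      have "b' - a' = (1 - \<kappa>) * h1 + 2 * (K * q')" using h2 by (simp add: a'_def b'_def)
      moreover have "(1 - \<kappa>) * h + \<kappa> / 2 * h = (1 - \<kappa> / 2) * h" by (simp add: algebra_simps)
      ultimately show ?thesis using Kq' \<kappa>hh q Aq Bq by linarith
    qed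
    have g3: "b' \<le> b + \<kappa> / 4 * h + B * q" "a - \<kappa> / 4 * h - B * q \<le> a'"
      using Kq' a2 b2 q Aq Bq KAq Kq by (auto simp: a'_def b'_def a1_def b1_def)
    have g4: "q' \<le> B * q + h"
    proof -
      have "\<kappa> * h1 \<le> h1" using \<kappa> \<kappa>1 h1 by (simp add: mult_left_le_one_le)
      then show ?thesis using \<epsilon>\<kappa> Bq KAq Kq q unfolding q'_def h1_def by linarith
    qed
    have fin: "sandwiched 1 b' ((B * q + h) * exp (- rate * (t - \<tau> - 2))) u t \<and>
            sandwiched (-1) a' ((B * q + h) * exp (- rate * (t - \<tau> - 2))) u t" if t: "\<tau> + 2 \<le> t" for t
    proof -
      have u2: "sol (\<tau> + 2) u" by (rule sol_mono[OF u]) simp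
      have e: "q' * exp (- rate * (t - (\<tau> + 2))) \<le> (B * q + h) * exp (- rate * (t - \<tau> - 2))"
        using g4 by (simp add: diff_diff_eq)
      show ?thesis
        using sandwiched_mono[OF persist[OF u2 _ b2(1) q'(3,2) S2(1) t], of b'] 
          sandwiched_mono[OF persist[OF u2 _ a2(1) q'(3,2) S2(2) t], of a'] e
        by (auto simp: a'_def b'_def)
    qed
    show "(\<forall>t\<ge>\<tau>. sandwiched 1 (b + B * q) q u t \<and> sandwiched (-1) (a - B * q) q u t) \<and>
      (\<exists>a' b'. a' \<le> b' \<and> b' - a' \<le> (1 - \<kappa> / 2) * (b - a) + B * q \<and>
         b' \<le> b + \<kappa> / 4 * (b - a) + B * q \<and> a - \<kappa> / 4 * (b - a) - B * q \<le> a' \<and>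
         (\<forall>t\<ge>\<tau> + 2. sandwiched 1 b' ((B * q + (b - a)) * exp (- rate * (t - \<tau> - 2))) u t \<and>
            sandwiched (-1) a' ((B * q + (b - a)) * exp (- rate * (t - \<tau> - 2))) u t))"
      using first g1 g2 g3 fin unfolding h_def by blast
  qed
qed

end

section \<open>Geometric iteration and convergence to a single shift\<close>

lemma exp_decay_small:
  fixes r \<epsilon> C :: real
  assumes "r > 0" "\<epsilon> > 0"
  shows "\<exists>s\<ge>0. C * exp (- r * s) \<le> \<epsilon>"
proof -
  define s where "s = max 0 (ln ((\<bar>C\<bar> + 1) / \<epsilon>) / r)"
  have "ln ((\<bar>C\<bar> + 1) / \<epsilon>) \<le> r * s" using assms by (simp add: s_def max_def field_simps)
  moreover have "0 < (\<bar>C\<bar> + 1) / \<epsilon>" using assms by (simp add: add_nonneg_pos)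
  ultimately have "(\<bar>C\<bar> + 1) / \<epsilon> \<le> exp (r * s)" by (metis exp_le_cancel_iff exp_ln)
  then have "\<bar>C\<bar> + 1 \<le> \<epsilon> * exp (r * s)" using assms by (simp add: field_simps)
  then have "C \<le> \<epsilon> * exp (r * s)" by linarith
  then have "C * exp (- r * s) \<le> \<epsilon>" by (simp add: exp_minus field_simps)
  then show ?thesis by (intro exI[of _ s]) (simp add: s_def)
qed

text \<open>Nested intervals: with \<open>w n\<close> the tail of the geometric series,
  \<open>b n - w n\<close> increases and \<open>b n + w n\<close> decreases. The supremum of the
  lower endpoints lies in all the intervals.\<close>

lemma geometric_increments_limit:
  fixes b :: "nat \<Rightarrow> real"
  assumes \<rho>: "0 \<le> \<rho>" "\<rho> < 1" and b: "\<And>n. \<bar>b (Suc n) - b n\<bar> \<le> K * \<rho> ^ n"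
  shows "\<exists>\<zeta>. \<forall>n. \<bar>b n - \<zeta>\<bar> \<le> K / (1 - \<rho>) * \<rho> ^ n"
proof -
  define w where "w = (\<lambda>n. K / (1 - \<rho>) * \<rho> ^ n)"
  have w: "w n - w (Suc n) = K * \<rho> ^ n" for n
  proof -
    have "w n - w (Suc n) = K / (1 - \<rho>) * ((1 - \<rho>) * \<rho> ^ n)"
      by (simp add: w_def algebra_simps)
    then show ?thesis using \<rho> by simp
  qed
  have "K \<ge> 0" using b[of 0] by simp
  then have w0: "0 \<le> w n" for n using \<rho> by (simp add: w_def)
  have "incseq (\<lambda>n. b n - w n)"
  proof (rule incseq_SucI)
    show "b n - w n \<le> b (Suc n) - w (Suc n)" for n using b[of n] w[of n] by linarith
  qed
  moreover have "decseq (\<lambda>n. b n + w n)"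
  proof (rule decseq_SucI)
    show "b (Suc n) + w (Suc n) \<le> b n + w n" for n using b[of n] w[of n] by linarith
  qed
  ultimately have le: "b m - w m \<le> b n + w n" for m n
  proof -
    have "b m - w m \<le> b (max m n) - w (max m n)"
      using incseqD[OF \<open>incseq _\<close>, of m "max m n"] by simp
    moreover have "b (max m n) + w (max m n) \<le> b n + w n"
      using decseqD[OF \<open>decseq _\<close>, of n "max m n"] by simp
    ultimately show ?thesis using w0[of "max m n"] by linarith
  qed
  define z where "z = (SUP n. b n - w n)"
  have "bdd_above (range (\<lambda>n. b n - w n))" using le[of _ 0] by (auto intro!: bdd_aboveI)
  then have "b n - w n \<le> z" for n unfolding z_def by (intro cSUP_upper) auto
  moreover have "z \<le> b n + w n" for n unfolding z_def using le by (intro cSUP_least) auto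
  ultimately have "\<bar>b n - z\<bar> \<le> w n" for n by (smt (verit))
  then show ?thesis unfolding w_def by blast
qed

context weighted_front
begin

text \<open>Iterating \<open>squeeze\<close> with a fixed time step makes
  \<open>b - a + N * q\<close> decay geometrically; the sides then move by summable amounts and
  close in on one shift. Both \<open>r\<close> and the admissible error are fixed by
  \<open>Z\<close> before the solution is given.\<close>

lemma converge:
  assumes Z: "0 \<le> Z"
  shows "\<exists>r>0. \<exists>q\<^sub>0>0. \<forall>\<tau> u a b q. sol \<tau> u \<longrightarrow> \<bar>a\<bar> \<le> Z \<longrightarrow> \<bar>b\<bar> \<le> Z \<longrightarrow> a \<le> b \<longrightarrow> 0 \<le> q \<longrightarrow> q \<le> q\<^sub>0 \<longrightarrow>
     sandwiched 1 b q u \<tau> \<longrightarrow> sandwiched (-1) a q u \<tau> \<longrightarrow>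
     (\<exists>C \<zeta>. \<forall>t\<ge>\<tau>. \<forall>x. \<bar>u t x - U t (x - \<zeta>)\<bar> \<le> C * exp (- r * (t - \<tau>)) * Gam t x)"
proof -
  \<comment> \<open>At the start \<open>b - a + N * q \<le> 2 * Z + 1\<close>, so adding it to
    \<open>b\<close> or to \<open>- a\<close> gives at most \<open>Y\<close>.\<close>
  define Y where "Y = 3 * Z + 1"
  have Y: "0 \<le> Y" using Z by (simp add: Y_def)
  obtain \<kappa> B q1 where \<kappa>: "0 < \<kappa>" "\<kappa> < 1" and B: "1 \<le> B" and q1: "0 < q1"
    and squeeze_step: "\<forall>\<tau> u a b q. sol \<tau> u \<longrightarrow> \<bar>a\<bar> \<le> Y \<longrightarrow> \<bar>b\<bar> \<le> Y \<longrightarrow> a \<le> b \<longrightarrow>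
      0 \<le> q \<longrightarrow> q \<le> q1 \<longrightarrow> sandwiched 1 b q u \<tau> \<longrightarrow> sandwiched (-1) a q u \<tau> \<longrightarrow>
      (\<forall>t\<ge>\<tau>. sandwiched 1 (b + B * q) q u t \<and> sandwiched (-1) (a - B * q) q u t) \<and>
      (\<exists>a' b'. a' \<le> b' \<and> b' - a' \<le> (1 - \<kappa> / 2) * (b - a) + B * q \<and>
         b' \<le> b + \<kappa> / 4 * (b - a) + B * q \<and> a - \<kappa> / 4 * (b - a) - B * q \<le> a' \<and>
         (\<forall>t\<ge>\<tau> + 2. sandwiched 1 b' ((B * q + (b - a)) * exp (- rate * (t - \<tau> - 2))) u t \<and>
            sandwiched (-1) a' ((B * q + (b - a)) * exp (- rate * (t - \<tau> - 2))) u t))"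
    using squeeze[OF Y] by (elim exE conjE) (rule that, assumption+)
  note sq = squeeze_step[rule_format]
  \<comment> \<open>One step adds the term \<open>B * q\<close> to the gap and another
    \<open>B * q\<close> to the weighted new error; with this weight their sum is half of
    \<open>N * q\<close>.\<close>
  define N where "N = 4 * B"
  have N: "N \<ge> 4" using B by (simp add: N_def)
  \<comment> \<open>The waiting time makes the decay factor so small that the gap feeds at most
    \<open>\<kappa> / 4 * h\<close> into the weighted error, that the old error feeds at most
    \<open>B * q\<close> into it, and that the new error is again at most \<open>q1\<close>.\<close>
  define w0 where "w0 = Min {\<kappa> / (4 * N), 1 / (4 * B), q1 / (B * q1 + 2 * Y + 1)}"
  have "0 < B * q1 + 2 * Y + 1" using B q1 Y by (simp add: add_nonneg_pos)
  then have "0 < w0" using \<kappa> N B q1 by (simp add: w0_def)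
  from exp_decay_small[OF rate_pos this, of 1] obtain s where s: "s \<ge> 0" "exp (- rate * s) \<le> w0" by auto
  define \<omega> where "\<omega> = exp (- rate * s)"
  have \<omega>: "0 < \<omega>" "N * \<omega> \<le> \<kappa> / 4" "B * \<omega> \<le> 1 / 4" "\<omega> * (B * q1 + 2 * Y + 1) \<le> q1"
  proof -
    have l: "\<omega> \<le> \<kappa> / (4 * N)" "\<omega> \<le> 1 / (4 * B)" "\<omega> \<le> q1 / (B * q1 + 2 * Y + 1)"
      using s(2) by (auto simp: w0_def \<omega>_def)
    show "N * \<omega> \<le> \<kappa> / 4" using l(1) N by (simp add: field_simps)
    show "B * \<omega> \<le> 1 / 4" using l(2) B by (simp add: field_simps)
    show "\<omega> * (B * q1 + 2 * Y + 1) \<le> q1" using l(3) \<open>0 < B * q1 + 2 * Y + 1\<close> by (simp add: pos_le_divide_eq)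
  qed (simp add: \<omega>_def)
  define T where "T = s + 2"
  have T: "T > 0" using s by (simp add: T_def)
  define \<rho> where "\<rho> = 1 - \<kappa> / 4"
  have \<rho>: "1 / 2 < \<rho>" "\<rho> < 1" using \<kappa> by (auto simp: \<rho>_def)
  define r where "r = - ln \<rho> / T"
  have "ln \<rho> < 0" using \<rho> by simp
  then have r: "r > 0" using T unfolding r_def by (intro divide_pos_pos) auto
  define q0 where "q0 = min q1 (1 / N)"
  have q0: "0 < q0" "q0 \<le> q1" "N * q0 \<le> 1" 
  proof -
    show "N * q0 \<le> 1" using N mult_left_mono[of q0 "1 / N" N] by (simp add: q0_def)
  qed (use q1 N in \<open>auto simp: q0_def\<close>)
  show ?thesis
  proof (rule exI[of _ r], rule conjI[OF r], rule exI[of _ q0], rule conjI[OF q0(1)], intro allI impI)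
    fix \<tau> u a b q
    assume u: "sol \<tau> u" and a: "\<bar>a\<bar> \<le> Z" and b: "\<bar>b\<bar> \<le> Z" and ab: "a \<le> b" and q: "0 \<le> q" "q \<le> q0"
      and Sb: "sandwiched 1 b q u \<tau>" and Sa: "sandwiched (-1) a q u \<tau>"
    define y where "y = (\<lambda>(a, b, q). b - a + N * q)"
    \<comment> \<open>The two inequalities with \<open>Y\<close> keep the shifts in the range for
      which the constants of \<open>squeeze\<close> hold: a bound on \<open>b\<close> alone would
      not survive, since a step may move a side outward.\<close>
    define P where "P = (\<lambda>n (a, b, q). a \<le> b \<and> 0 \<le> q \<and> q \<le> q1 \<and> b + y (a, b, q) \<le> Y \<and> - a + y (a, b, q) \<le> Y \<and>
      sandwiched 1 b q u (\<tau> + real n * T) \<and> sandwiched (-1) a q u (\<tau> + real n * T))"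
    define R where "R = (\<lambda>(n::nat) (a, b, q) (a', b', q'). y (a', b', q') \<le> \<rho> * y (a, b, q) \<and> \<bar>b' - b\<bar> \<le> 2 * y (a, b, q))"
    have "\<exists>g. \<forall>n. P n (g n) \<and> R n (g n) (g (Suc n))"
    proof (rule dependent_nat_choice)
      show "\<exists>x. P 0 x"
      proof (rule exI[of _ "(a, b, q)"])
        have "N * q \<le> 1" using q q0 N mult_left_mono[of q q0 N] by linarith
        then show "P 0 (a, b, q)" using ab q q0 a b Sa Sb by (auto simp: P_def y_def Y_def)
      qed
      fix X n assume PX: "P n X"
      obtain a b q where X: "X = (a, b, q)" by (cases X)
      define h where "h = b - a"
      let ?\<tau> = "\<tau> + real n * T"
      have st: "a \<le> b" "0 \<le> q" "q \<le> q1" "b + (h + N * q) \<le> Y" "- a + (h + N * q) \<le> Y"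
        "sandwiched 1 b q u ?\<tau>" "sandwiched (-1) a q u ?\<tau>"
        using PX by (auto simp: P_def X y_def h_def)
      have h: "0 \<le> h" using st by (simp add: h_def)
      have Bq: "0 \<le> B * q" "N * q = 4 * (B * q)" using B st by (auto simp: N_def)
      have ab: "\<bar>a\<bar> \<le> Y" "\<bar>b\<bar> \<le> Y" using st h Bq by auto
      have "?\<tau> \<ge> \<tau>" using T by simp
      then have un: "sol ?\<tau> u" by (rule sol_mono[OF u])
      from sq[OF un ab st(1-3,6,7)] obtain a' b' where
        a'b': "a' \<le> b'" "b' - a' \<le> (1 - \<kappa> / 2) * h + B * q"
         "b' \<le> b + \<kappa> / 4 * h + B * q" "a - \<kappa> / 4 * h - B * q \<le> a'"
         and S: "\<forall>t\<ge>?\<tau> + 2. sandwiched 1 b' ((B * q + h) * exp (- rate * (t - ?\<tau> - 2))) u t \<and>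
            sandwiched (-1) a' ((B * q + h) * exp (- rate * (t - ?\<tau> - 2))) u t"
        unfolding h_def by blast
      define q' where "q' = (B * q + h) * \<omega>"
      have S': "sandwiched 1 b' q' u (\<tau> + real (Suc n) * T)" "sandwiched (-1) a' q' u (\<tau> + real (Suc n) * T)"
      proof -
        have eq: "\<tau> + real (Suc n) * T = ?\<tau> + 2 + s" by (simp add: T_def algebra_simps)
        show "sandwiched 1 b' q' u (\<tau> + real (Suc n) * T)" "sandwiched (-1) a' q' u (\<tau> + real (Suc n) * T)"
          unfolding eq q'_def \<omega>_def using S s(1) by (auto dest!: spec[of _ "?\<tau> + 2 + s"])
      qed
      have q': "0 \<le> q'" "q' \<le> q1"
      proof -
        show "0 \<le> q'" using Bq h \<omega> by (simp add: q'_def)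
        have "B * q \<le> B * q1" using st B by (intro mult_left_mono) auto
        then have "B * q + h \<le> B * q1 + 2 * Y + 1" using ab by (simp add: h_def)
        then have "q' \<le> (B * q1 + 2 * Y + 1) * \<omega>" unfolding q'_def using \<omega> by (intro mult_right_mono) auto
        then show "q' \<le> q1" using \<omega>(4) by (simp add: mult.commute)
      qed
      have Nq': "N * q' \<le> B * q + \<kappa> / 4 * h"
      proof -
        have "N * q' = 4 * (B * \<omega>) * (B * q) + (N * \<omega>) * h" by (simp add: q'_def N_def algebra_simps)
        also have "\<dots> \<le> 4 * (1 / 4) * (B * q) + \<kappa> / 4 * h"
          using \<omega> Bq h by (intro add_mono mult_right_mono mult_left_mono) auto
        finally show ?thesis by simp
      qed
      have y': "b' - a' + N * q' \<le> (1 - \<kappa> / 4) * h + 2 * (B * q)"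
      proof -
        have "(1 - \<kappa> / 2) * h + \<kappa> / 4 * h = (1 - \<kappa> / 4) * h" by (simp add: algebra_simps)
        then show ?thesis using a'b'(2) Nq' by linarith
      qed
      \<comment> \<open>The decrease of \<open>y\<close> is at least the outward motion allowed to
        either side, which preserves the two inequalities with \<open>Y\<close>.\<close>
      have yle: "b' - a' + N * q' \<le> h + N * q - \<kappa> / 4 * h - B * q"
      proof -
        have "(1 - \<kappa> / 4) * h = h - \<kappa> / 4 * h" by (simp add: algebra_simps)
        then show ?thesis using y' Bq by linarith
      qed
      have \<kappa>h: "0 \<le> \<kappa> / 4 * h" "\<kappa> / 4 * h \<le> h"
      proof -
        show "0 \<le> \<kappa> / 4 * h" using \<kappa> h by simp
        have "\<kappa> / 4 * h \<le> 1 * h" using \<kappa> h by (intro mult_right_mono) auto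
        then show "\<kappa> / 4 * h \<le> h" by simp
      qed
      have contr: "b' - a' + N * q' \<le> \<rho> * (h + N * q)"
      proof -
        have "1 / 2 * (N * q) \<le> \<rho> * (N * q)" using \<rho> Bq by (intro mult_right_mono) auto
        then show ?thesis using y' Bq unfolding \<rho>_def distrib_left by linarith
      qed
      have move: "\<bar>b' - b\<bar> \<le> 2 * (h + N * q)"
      proof -
        have "2 * (h + N * q) = 2 * h + 8 * (B * q)" unfolding Bq(2) by simp
        moreover have "b' - b \<le> h + B * q" using a'b'(3) \<kappa>h(2) by linarith
        moreover have "- (b' - b) \<le> 2 * h + B * q" using a'b'(1,4) \<kappa>h(2) h_def by linarith
        ultimately show ?thesis using h Bq(1) by linarith
      qed
      show "\<exists>X'. P (Suc n) X' \<and> R n X X'"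
      proof (intro exI conjI)
        show "P (Suc n) (a', b', q')"
          unfolding P_def y_def prod.case using a'b' q' S' st yle by (intro conjI) linarith+
        show "R n X (a', b', q')"
          unfolding R_def y_def X prod.case h_def[symmetric]
          using contr move by blast
      qed
    qed
    then obtain g where g: "\<And>n. P n (g n)" "\<And>n. R n (g n) (g (Suc n))" by blast
    define A' where "A' = (\<lambda>n. fst (g n))"
    define B' where "B' = (\<lambda>n. fst (snd (g n)))"
    define Q' where "Q' = (\<lambda>n. snd (snd (g n)))"
    have gn: "g n = (A' n, B' n, Q' n)" for n by (simp add: A'_def B'_def Q'_def)
    define yn where "yn = (\<lambda>n. B' n - A' n + N * Q' n)"
    define y0 where "y0 = yn 0"
    have Pn: "A' n \<le> B' n" "0 \<le> Q' n" "Q' n \<le> q1" "B' n + yn n \<le> Y" "- A' n + yn n \<le> Y"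
      "sandwiched 1 (B' n) (Q' n) u (\<tau> + real n * T)" "sandwiched (-1) (A' n) (Q' n) u (\<tau> + real n * T)" for n
      using g(1)[of n] by (auto simp: P_def gn y_def yn_def)
    have Rn: "yn (Suc n) \<le> \<rho> * yn n" "\<bar>B' (Suc n) - B' n\<bar> \<le> 2 * yn n" for n
      using g(2)[of n] by (auto simp: R_def gn y_def yn_def)
    have yn0: "0 \<le> yn n" for n using Pn[of n] N by (simp add: yn_def)
    have yn: "yn n \<le> y0 * \<rho> ^ n" for n
    proof (induction n)
      case (Suc n)
      have "\<rho> * yn n \<le> \<rho> * (y0 * \<rho> ^ n)" using Suc \<rho> by (intro mult_left_mono) auto
      then show ?case using Rn(1)[of n] by (simp add: mult_ac)
    qed (simp add: y0_def)
    have "\<bar>B' (Suc n) - B' n\<bar> \<le> 2 * y0 * \<rho> ^ n" for n using Rn(2)[of n] yn[of n] by simp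
    from geometric_increments_limit[OF _ \<rho>(2) this] \<rho>(1) obtain \<zeta>
      where \<zeta>: "\<And>n. \<bar>B' n - \<zeta>\<bar> \<le> 2 * y0 / (1 - \<rho>) * \<rho> ^ n" by auto
    define K2 where "K2 = 2 * y0 / (1 - \<rho>) + y0"
    have y00: "0 \<le> y0" using yn0 by (simp add: y0_def)
    have K2: "0 \<le> K2" using y00 \<rho> by (simp add: K2_def)
    obtain C1 where C1: "C1 \<ge> 1"
      "\<And>t x x'. \<bar>x - x'\<bar> \<le> K2 \<Longrightarrow> \<bar>U t x - U t x'\<bar> \<le> C1 * Gam t x * \<bar>x - x'\<bar>"
      using U_lipschitz[of K2] by blast
    define C where "C = C1 * exp (\<alpha> * \<bar>\<zeta>\<bar>) * K2 + y0"
    have C: "0 \<le> C" using C1 K2 y00 by (simp add: C_def)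
    have dist: "\<bar>B' n + B * Q' n - \<zeta>\<bar> \<le> K2 * \<rho> ^ n" "\<bar>A' n - B * Q' n - \<zeta>\<bar> \<le> K2 * \<rho> ^ n" "Q' n \<le> y0 * \<rho> ^ n" for n
    proof -
      have 1: "0 \<le> B * Q' n" "N * Q' n = 4 * (B * Q' n)" using B Pn(2)[of n] by (auto simp: N_def)
      have 2: "Q' n \<le> B * Q' n" using mult_right_mono[of 1 B "Q' n"] B Pn(2)[of n] by simp
      have 3: "B' n - A' n + 4 * (B * Q' n) \<le> y0 * \<rho> ^ n" using yn[of n] 1 by (simp add: yn_def)
      have 4: "K2 * \<rho> ^ n = 2 * y0 / (1 - \<rho>) * \<rho> ^ n + y0 * \<rho> ^ n" by (simp add: K2_def distrib_right)
      show "\<bar>B' n + B * Q' n - \<zeta>\<bar> \<le> K2 * \<rho> ^ n" "\<bar>A' n - B * Q' n - \<zeta>\<bar> \<le> K2 * \<rho> ^ n" "Q' n \<le> y0 * \<rho> ^ n"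
        using 1 2 3 4 \<zeta>[of n] Pn(1)[of n] by linarith+
    qed
    show "\<exists>C \<zeta>. \<forall>t\<ge>\<tau>. \<forall>x. \<bar>u t x - U t (x - \<zeta>)\<bar> \<le> C * exp (- r * (t - \<tau>)) * Gam t x"
    proof (intro exI allI impI)
      fix t x assume t: "\<tau> \<le> t"
      define n where "n = nat \<lfloor>(t - \<tau>) / T\<rfloor>"
      have nn: "real n \<le> (t - \<tau>) / T" "(t - \<tau>) / T < real n + 1"
        using t T by (auto simp: n_def)
      have tn: "\<tau> + real n * T \<le> t" using nn(1) T by (simp add: field_simps)
      \<comment> \<open>The time lies before grid point \<open>n + 1\<close>, so passing from the
        discrete to the continuous rate costs one factor \<open>1 / \<rho>\<close>.\<close>
      have "\<rho> ^ n \<le> 1 / \<rho> * exp (- r * (t - \<tau>))"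
      proof -
        have "ln \<rho> < 0" using \<rho> by simp
        then have "(real n + 1) * ln \<rho> \<le> (t - \<tau>) / T * ln \<rho>"
          using nn(2) by (intro mult_right_mono_neg) auto
        also have "\<dots> = - r * (t - \<tau>)" by (simp add: r_def)
        finally have "exp ((real n + 1) * ln \<rho>) \<le> exp (- r * (t - \<tau>))" by simp
        moreover have "exp ((real n + 1) * ln \<rho>) = \<rho> ^ n * \<rho>"
          using \<rho> by (simp add: distrib_right exp_add exp_of_nat_mult)
        ultimately have "\<rho> ^ n * \<rho> \<le> exp (- r * (t - \<tau>))" by (simp only:)
        then show ?thesis using \<rho> by (simp add: pos_le_divide_eq)
      qed
      then have dec: "C * \<rho> ^ n * Gam t x \<le> C * (1 / \<rho> * exp (- r * (t - \<tau>))) * Gam t x"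
        using C Gam_pos[of t x] by (intro mult_right_mono mult_left_mono) auto
      define G where "G = Gam t x"
      have G: "0 < G" using Gam_pos by (simp add: G_def)
      have "sol (\<tau> + real n * T) u" using T by (intro sol_mono[OF u]) simp
      moreover have "\<bar>A' n\<bar> \<le> Y" "\<bar>B' n\<bar> \<le> Y" using Pn(1,4,5)[of n] yn0[of n] by auto
      \<comment> \<open>Between grid points the first conclusion of \<open>squeeze\<close> is used,
        hence the widening of both sides by \<open>B * Q' n\<close>.\<close>
      ultimately have S: "sandwiched 1 (B' n + B * Q' n) (Q' n) u t" "sandwiched (-1) (A' n - B * Q' n) (Q' n) u t"
        using sq[OF _ _ _ Pn(1-3,6,7)] tn by blast+
      have Ulip: "\<bar>U t (x - z) - U t (x - \<zeta>)\<bar> \<le> C1 * exp (\<alpha> * \<bar>\<zeta>\<bar>) * K2 * \<rho> ^ n * G"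
        if z: "\<bar>z - \<zeta>\<bar> \<le> K2 * \<rho> ^ n" for z
      proof -
        have "\<rho> ^ n \<le> 1" using \<rho> by (intro power_le_one) auto
        then have "K2 * \<rho> ^ n \<le> K2 * 1" using K2 by (intro mult_left_mono) auto
        then have "\<bar>z - \<zeta>\<bar> \<le> K2" using z by simp
        then have "\<bar>U t (x - \<zeta>) - U t (x - z)\<bar> \<le> C1 * Gam t (x - \<zeta>) * \<bar>(x - \<zeta>) - (x - z)\<bar>"
          by (intro C1) (simp add: abs_minus_commute)
        also have "\<dots> \<le> C1 * (exp (\<alpha> * \<bar>\<zeta>\<bar>) * G) * (K2 * \<rho> ^ n)"
          using z C1(1) Gam_translate[of t "x - \<zeta>" x] G Gam_pos[of t "x - \<zeta>"] unfolding G_def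
          by (intro mult_mono) (auto simp: abs_minus_commute)
        finally show ?thesis by (simp add: mult_ac abs_minus_commute)
      qed
      have QG: "Q' n * G \<le> y0 * \<rho> ^ n * G" using dist(3)[of n] G by (intro mult_right_mono) auto
      have S': "u t x - U t (x - (B' n + B * Q' n)) \<le> Q' n * G"
        "U t (x - (A' n - B * Q' n)) - u t x \<le> Q' n * G"
        using S[unfolded sandwiched_def, rule_format, of x] by (auto simp: G_def)
      have CG: "C * \<rho> ^ n * G = C1 * exp (\<alpha> * \<bar>\<zeta>\<bar>) * K2 * \<rho> ^ n * G + y0 * \<rho> ^ n * G"
        by (simp add: C_def distrib_right)
      have "\<bar>u t x - U t (x - \<zeta>)\<bar> \<le> C * \<rho> ^ n * G"
      proof (rule abs_leI)
        show "u t x - U t (x - \<zeta>) \<le> C * \<rho> ^ n * G"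
          using Ulip[OF dist(1)[of n]] S'(1) QG CG by linarith
        show "- (u t x - U t (x - \<zeta>)) \<le> C * \<rho> ^ n * G"
          using Ulip[OF dist(2)[of n]] S'(2) QG CG by linarith
      qed
      also have "\<dots> \<le> C * (1 / \<rho> * exp (- r * (t - \<tau>))) * G" using dec by (simp add: G_def)
      finally show "\<bar>u t x - U t (x - \<zeta>)\<bar> \<le> (C / \<rho>) * exp (- r * (t - \<tau>)) * Gam t x"
        by (simp add: G_def)
    qed
  qed
qed

section \<open>Initial data and the restart with a universal rate\<close>

lemma sandwiched_untranslate:
  assumes "sandwiched \<sigma> \<zeta> q (\<lambda>t x. u t (x + s)) t" "0 \<le> q"
  shows "sandwiched \<sigma> (\<zeta> + s) (q * exp (\<alpha> * \<bar>s\<bar>)) u t"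
  unfolding sandwiched_def
proof
  fix x
  have "\<sigma> * (u t (x - s + s) - U t (x - s - \<zeta>)) \<le> q * Gam t (x - s)"
    using assms(1) unfolding sandwiched_def by blast
  also have "\<dots> \<le> q * (exp (\<alpha> * \<bar>s\<bar>) * Gam t x)"
    using Gam_translate[of t "x - s" x] assms(2) by (intro mult_left_mono) auto
  finally show "\<sigma> * (u t x - U t (x - (\<zeta> + s))) \<le> q * exp (\<alpha> * \<bar>s\<bar>) * Gam t x"
    by (simp add: mult_ac diff_diff_eq add.commute)
qed

text \<open>The datum is translated to the left. Far behind, the wave is within
  \<open>q * g0\<close> of 1 and bounds any datum; elsewhere the translated point lies at least
  \<open>s0\<close> ahead of the interface, where the assumed decay makes the difference small
  against the weight.\<close>

lemma initial_upper:
  assumes q: "0 < q" and u: "\<And>x. u x \<le> 1"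
    and close: "\<And>x. \<xi> t \<le> x \<Longrightarrow> u x - U t x \<le> C' * exp (- \<alpha> * (x - \<xi> t))"
  shows "\<exists>s. \<forall>y. u (y + s) - U t y \<le> q * Gam t y"
proof -
  have qg: "0 < q * g0" using q g0 by simp
  obtain M0 where M0: "\<And>t x. x \<le> \<xi> t - M0 \<Longrightarrow> 1 - q * g0 \<le> U t x" using U_behind[OF qg] by blast
  define M where "M = \<bar>M0\<bar>"
  obtain s0 where s0: "0 \<le> s0" "\<bar>C'\<bar> * exp (- \<alpha> * s0) \<le> q * g0" using exp_decay_small[OF alpha(1) qg] by blast
  define s where "s = M + s0"
  show ?thesis
  proof (intro exI[of _ s] allI)
    fix y
    show "u (y + s) - U t y \<le> q * Gam t y"
    proof (cases "y \<le> \<xi> t - M")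
      case True
      then have "1 - q * g0 \<le> U t y" by (intro M0) (auto simp: M_def)
      moreover have "g0 \<le> Gam t y" using Gam_lower[of 0 y t] True by (simp add: M_def)
      then have "q * g0 \<le> q * Gam t y" using q by (intro mult_left_mono) auto
      ultimately show ?thesis using u[of "y + s"] by linarith
    next
      case False
      define p where "p = max 0 (y - \<xi> t)"
      have p: "p - M \<le> y - \<xi> t" "0 \<le> p" "y - \<xi> t \<le> p" using False by (auto simp: p_def M_def)
      have "u (y + s) - U t (y + s) \<le> C' * exp (- \<alpha> * (y + s - \<xi> t))"
        using False s0 by (intro close) (auto simp: s_def)
      also have "\<dots> \<le> \<bar>C'\<bar> * exp (- \<alpha> * (s0 + p))"
      proof (rule mult_mono)
        have "\<alpha> * (s0 + p) \<le> \<alpha> * (y + s - \<xi> t)"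
          using p alpha by (intro mult_left_mono) (auto simp: s_def)
        then show "exp (- \<alpha> * (y + s - \<xi> t)) \<le> exp (- \<alpha> * (s0 + p))" by simp
      qed auto
      also have "\<dots> = (\<bar>C'\<bar> * exp (- \<alpha> * s0)) * exp (- \<alpha> * p)"
        by (simp add: distrib_left exp_diff exp_minus field_simps exp_add)
      also have "\<dots> \<le> (q * g0) * exp (- \<alpha> * p)" using s0 by (intro mult_right_mono) auto
      also have "\<dots> = q * (g0 * exp (- \<alpha> * p))" by simp
      also have "\<dots> \<le> q * Gam t y" using q p by (intro mult_left_mono Gam_lower) auto
      finally have "u (y + s) - U t (y + s) \<le> q * Gam t y" .
      moreover have "U t (y + s) \<le> U t y" using s0 by (intro U_antimono) (auto simp: s_def M_def)
      ultimately show ?thesis by linarith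
    qed
  qed
qed

text \<open>Where the wave exceeds \<open>q * Gam\<close>, that is at most \<open>M\<close> ahead of
  the interface, the translated datum is so close to 1 that the weight covers the defect.\<close>

lemma initial_lower:
  assumes q: "0 < q" and u: "\<And>x. 0 \<le> u x" and lim: "(u \<longlongrightarrow> 1) at_bot"
  shows "\<exists>s. \<forall>y. U t y - u (y + s) \<le> q * Gam t y"
proof -
  obtain M where M: "M \<ge> 0" "\<And>t x. \<xi> t + M \<le> x \<Longrightarrow> U t x \<le> q * Gam t x"
    using U_small_ahead[OF q] by auto
  define \<gamma> where "\<gamma> = g0 * exp (- \<alpha> * M)"
  have "0 < q * \<gamma>" using q g0 by (simp add: \<gamma>_def)
  then have "eventually (\<lambda>x. 1 - q * \<gamma> < u x) at_bot" using lim by (intro order_tendstoD(1)) auto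
  then obtain b where b: "\<And>x. x \<le> b \<Longrightarrow> 1 - q * \<gamma> < u x" by (auto simp: eventually_at_bot_linorder)
  show ?thesis
  proof (intro exI[of _ "b - (\<xi> t + M)"] allI)
    fix y
    show "U t y - u (y + (b - (\<xi> t + M))) \<le> q * Gam t y"
    proof (cases "\<xi> t + M \<le> y")
      case True
      then show ?thesis using M(2)[OF True] u[of "y + (b - (\<xi> t + M))"] by linarith
    next
      case False
      then have "1 - q * \<gamma> < u (y + (b - (\<xi> t + M)))" by (intro b) auto
      moreover have "\<gamma> \<le> Gam t y" unfolding \<gamma>_def using False M(1) by (intro Gam_lower) auto
      then have "q * \<gamma> \<le> q * Gam t y" using q by (intro mult_left_mono) auto
      ultimately show ?thesis using U_bounds(2)[of t y] by linarith
    qed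
  qed
qed

text \<open>\<open>converge\<close> is used twice. The instance with \<open>Z = 0\<close> is fixed
  before the solution appears and provides \<open>r\<close>. The instance with a data-dependent
  \<open>Z\<close> has a data-dependent rate, but it only has to bring the solution close to one
  shift within finite time.\<close>

lemma stability:
  "\<exists>r>0. \<forall>t\<^sub>0 u. sol t\<^sub>0 u \<longrightarrow> (u t\<^sub>0 \<longlongrightarrow> 1) at_bot \<longrightarrow>
     (\<exists>C'. \<forall>x\<ge>\<xi> t\<^sub>0. \<bar>u t\<^sub>0 x - U t\<^sub>0 x\<bar> \<le> C' * exp (- \<alpha> * (x - \<xi> t\<^sub>0))) \<longrightarrow>
     (\<exists>C>0. \<exists>\<zeta>. \<forall>t\<ge>t\<^sub>0. \<forall>x. \<bar>u t x - U t (x - \<zeta>)\<bar> \<le> C * exp (- r * (t - t\<^sub>0)))"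
proof -
  obtain r q1 where r: "r > 0" and q1: "q1 > 0" and conv: "\<And>\<tau> u a b q. sol \<tau> u \<Longrightarrow> \<bar>a\<bar> \<le> 0 \<Longrightarrow> \<bar>b\<bar> \<le> 0 \<Longrightarrow> a \<le> b \<Longrightarrow> 0 \<le> q \<Longrightarrow> q \<le> q1 \<Longrightarrow>
     sandwiched 1 b q u \<tau> \<Longrightarrow> sandwiched (-1) a q u \<tau> \<Longrightarrow>
     (\<exists>C \<zeta>. \<forall>t\<ge>\<tau>. \<forall>x. \<bar>u t x - U t (x - \<zeta>)\<bar> \<le> C * exp (- r * (t - \<tau>)) * Gam t x)"
    using converge[of 0] by (metis order_refl)
  obtain K q0 where K: "K > 0" and q0: "q0 > 0"
    and persist: "\<And>\<tau> u \<sigma> \<zeta> q t. sol \<tau> u \<Longrightarrow> \<sigma> = 1 \<or> \<sigma> = -1 \<Longrightarrow> \<bar>\<zeta>\<bar> \<le> 0 \<Longrightarrow> 0 \<le> q \<Longrightarrow> q \<le> q0 \<Longrightarrow>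
        sandwiched \<sigma> \<zeta> q u \<tau> \<Longrightarrow> \<tau> \<le> t \<Longrightarrow> sandwiched \<sigma> (\<zeta> + \<sigma> * K * q) (q * exp (- rate * (t - \<tau>))) u t"
    using sandwich_persists[of 0] by metis
  show ?thesis
  proof (rule exI[of _ r], rule conjI[OF r], intro allI impI)
    fix t0 u
    assume u: "sol t0 u" and lim: "(u t0 \<longlongrightarrow> 1) at_bot"
      and "\<exists>C'. \<forall>x\<ge>\<xi> t0. \<bar>u t0 x - U t0 x\<bar> \<le> C' * exp (- \<alpha> * (x - \<xi> t0))"
    then obtain C' where close: "\<And>x. \<xi> t0 \<le> x \<Longrightarrow> \<bar>u t0 x - U t0 x\<bar> \<le> C' * exp (- \<alpha> * (x - \<xi> t0))" by blast
    have u01: "0 \<le> u t x" "u t x \<le> 1" if "t0 \<le> t" for t x using u that by (auto simp: sol_def)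
    obtain sp where sp: "sandwiched 1 0 q0 (\<lambda>t x. u t (x + sp)) t0"
      using initial_upper[OF q0, of "u t0" t0 C'] u01 close by (force simp: sandwiched_def)
    obtain sm where sm: "sandwiched (-1) 0 q0 (\<lambda>t x. u t (x + sm)) t0"
      using initial_lower[OF q0 _ lim, of t0] u01 by (auto simp: sandwiched_def)
    define E where "E = exp (\<alpha> * \<bar>sp\<bar>) + exp (\<alpha> * \<bar>sm\<bar>)"
    have up: "sandwiched 1 (K * q0 + sp) (q0 * E * exp (- rate * (t - t0))) u t" if t: "t0 \<le> t" for t
    proof -
      have "sandwiched 1 (0 + 1 * K * q0) (q0 * exp (- rate * (t - t0))) (\<lambda>t x. u t (x + sp)) t"
        by (rule persist[OF sol_translate[OF u]]) (use sp q0 t in auto)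
      then have "sandwiched 1 (0 + 1 * K * q0 + sp) (q0 * exp (- rate * (t - t0)) * exp (\<alpha> * \<bar>sp\<bar>)) u t"
        by (rule sandwiched_untranslate) (use q0 in simp)
      then show ?thesis by (rule sandwiched_mono) (use q0 in \<open>auto simp: E_def algebra_simps\<close>)
    qed
    have lo: "sandwiched (-1) (- K * q0 + sm) (q0 * E * exp (- rate * (t - t0))) u t" if t: "t0 \<le> t" for t
    proof -
      have "sandwiched (-1) (0 + (-1) * K * q0) (q0 * exp (- rate * (t - t0))) (\<lambda>t x. u t (x + sm)) t"
        by (rule persist[OF sol_translate[OF u]]) (use sm q0 t in auto)
      then have "sandwiched (-1) (0 + (-1) * K * q0 + sm) (q0 * exp (- rate * (t - t0)) * exp (\<alpha> * \<bar>sm\<bar>)) u t"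
        by (rule sandwiched_untranslate) (use q0 in simp)
      then show ?thesis by (rule sandwiched_mono) (use q0 in \<open>auto simp: E_def algebra_simps\<close>)
    qed
    define a where "a = - K * q0 + sm"
    define b where "b = max a (K * q0 + sp)"
    define Z where "Z = \<bar>a\<bar> + \<bar>b\<bar>"
    have "0 \<le> Z" by (simp add: Z_def)
    \<comment> \<open>The admissible error \<open>q2\<close> depends on \<open>Z\<close>, hence on
      the data; the exponential decay from persistence brings the initial error below it while the
      two sides stay fixed.\<close>
    from converge[OF this] obtain r1 q2 where r1: "r1 > 0" and q2: "q2 > 0" and conv1: "\<And>\<tau> u a b q. sol \<tau> u \<Longrightarrow> \<bar>a\<bar> \<le> Z \<Longrightarrow> \<bar>b\<bar> \<le> Z \<Longrightarrow> a \<le> b \<Longrightarrow> 0 \<le> q \<Longrightarrow> q \<le> q2 \<Longrightarrow>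
     sandwiched 1 b q u \<tau> \<Longrightarrow> sandwiched (-1) a q u \<tau> \<Longrightarrow>
     (\<exists>C \<zeta>. \<forall>t\<ge>\<tau>. \<forall>x. \<bar>u t x - U t (x - \<zeta>)\<bar> \<le> C * exp (- r1 * (t - \<tau>)) * Gam t x)"
      by metis
    obtain s1 where s1: "0 \<le> s1" "q0 * E * exp (- rate * s1) \<le> q2" using exp_decay_small[OF rate_pos q2] by blast
    define t1 where "t1 = t0 + s1"
    have t1: "t0 \<le> t1" "t1 - t0 = s1" using s1 by (auto simp: t1_def)
    have "sandwiched 1 b q2 u t1" by (rule sandwiched_mono[OF up[OF t1(1)]]) (use s1 t1 in \<open>auto simp: b_def\<close>)
    moreover have "sandwiched (-1) a q2 u t1" by (rule sandwiched_mono[OF lo[OF t1(1)]]) (use s1 t1 in \<open>auto simp: a_def\<close>)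
    ultimately obtain C1 \<zeta> where C1: "\<And>t x. t1 \<le> t \<Longrightarrow> \<bar>u t x - U t (x - \<zeta>)\<bar> \<le> C1 * exp (- r1 * (t - t1)) * Gam t x"
      using conv1[OF sol_mono[OF u t1(1)], of a b q2] q2 by (auto simp: Z_def b_def)
    obtain s2 where s2: "0 \<le> s2" "(\<bar>C1\<bar> * exp (\<alpha> * \<bar>\<zeta>\<bar>)) * exp (- r1 * s2) \<le> q1"
      using exp_decay_small[OF r1 q1] by blast
    define t2 where "t2 = t1 + s2"
    have t2: "t0 \<le> t2" "t1 \<le> t2" using t1 s2 by (auto simp: t2_def)
    \<comment> \<open>Recentring at the limiting shift makes both sides equal to zero, the situation
      of the first instance. The limit \<open>\<zeta>3\<close> found for \<open>v\<close> is added
      to \<zeta>.\<close>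
    define v where "v = (\<lambda>t x. u t (x + \<zeta>))"
    have vU: "\<bar>v t2 x - U t2 x\<bar> \<le> q1 * Gam t2 x" for x
    proof -
      have "\<bar>v t2 x - U t2 x\<bar> \<le> C1 * exp (- r1 * s2) * Gam t2 (x + \<zeta>)"
        using C1[OF t2(2), of "x + \<zeta>"] by (simp add: v_def t2_def)
      also have "\<dots> \<le> (\<bar>C1\<bar> * exp (- r1 * s2)) * (exp (\<alpha> * \<bar>\<zeta>\<bar>) * Gam t2 x)"
        using Gam_translate[of t2 "x + \<zeta>" x] Gam_pos[of t2 "x + \<zeta>"] by (intro mult_mono) auto
      also have "\<dots> = ((\<bar>C1\<bar> * exp (\<alpha> * \<bar>\<zeta>\<bar>)) * exp (- r1 * s2)) * Gam t2 x" by (simp add: mult_ac)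
      also have "\<dots> \<le> q1 * Gam t2 x" using s2 Gam_pos[of t2 x] by (intro mult_right_mono) auto
      finally show ?thesis .
    qed
    have vs: "sol t2 v" unfolding v_def by (rule sol_translate[OF sol_mono[OF u t2(1)]])
    have "sandwiched 1 0 q1 v t2" "sandwiched (-1) 0 q1 v t2" using vU by (auto simp: sandwiched_def abs_le_iff)
    then obtain C3 \<zeta>3 where C3: "\<And>t x. t2 \<le> t \<Longrightarrow> \<bar>v t x - U t (x - \<zeta>3)\<bar> \<le> C3 * exp (- r * (t - t2)) * Gam t x"
      using conv[OF vs, of 0 0 q1] q1 by auto
    define C where "C = (\<bar>C3\<bar> + 1) * exp (r * (t2 - t0))"
    show "\<exists>C>0. \<exists>\<zeta>. \<forall>t\<ge>t0. \<forall>x. \<bar>u t x - U t (x - \<zeta>)\<bar> \<le> C * exp (- r * (t - t0))"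
    proof (rule exI[of _ C], rule conjI, simp add: C_def add_nonneg_pos,
        rule exI[of _ "\<zeta> + \<zeta>3"], intro allI impI)
      fix t x assume t: "t0 \<le> t"
      have Ce: "C * exp (- r * (t - t0)) = (\<bar>C3\<bar> + 1) * exp (- r * (t - t2))"
        by (simp add: C_def mult.assoc exp_add[symmetric] algebra_simps)
      show "\<bar>u t x - U t (x - (\<zeta> + \<zeta>3))\<bar> \<le> C * exp (- r * (t - t0))"
      proof (cases "t2 \<le> t")
        case True
        have "\<bar>u t x - U t (x - (\<zeta> + \<zeta>3))\<bar> \<le> C3 * exp (- r * (t - t2)) * Gam t (x - \<zeta>)"
          using C3[OF True, of "x - \<zeta>"] by (simp add: v_def diff_diff_eq)
        also have "\<dots> \<le> ((\<bar>C3\<bar> + 1) * exp (- r * (t - t2))) * 1"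
          using Gam_less[of t "x - \<zeta>"] Gam_pos[of t "x - \<zeta>"] by (intro mult_mono) auto
        finally show ?thesis unfolding Ce by simp
      next
        case False
        \<comment> \<open>Before \<open>t2\<close> the trivial bound suffices, because the
          exponential counted from \<open>t2\<close> is then at least 1.\<close>
        have "\<bar>u t x - U t (x - (\<zeta> + \<zeta>3))\<bar> \<le> 1"
          using u01[OF t, of x] U_bounds[of t "x - (\<zeta> + \<zeta>3)"] by (simp add: abs_le_iff)
        also have "1 \<le> exp (- r * (t - t2))" using False r by (simp add: mult_nonneg_nonpos)
        also have "1 * \<dots> \<le> (\<bar>C3\<bar> + 1) * exp (- r * (t - t2))" by (intro mult_right_mono) auto
        finally show ?thesis unfolding Ce by simp
      qed
    qed
  qed
qed

end

section \<open>Positive mean speed and a smoothed interface\<close>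

context ignition_front
begin

text \<open>The interface moves with positive mean speed because the profile
  \<open>v = b - 2 + 2 (1 + e^x)^(-k)\<close> is, for small \<open>k\<close>, a subsolution travelling with speed \<open>k / 2\<close>:
  \<open>v'' + (k / 2) v'\<close> is nonnegative except where \<open>v \<ge> a\<close>, and there the reaction dominates.\<close>

lemma mean_speed:
  assumes ab: "\<theta> < a" "a < b" "b < 1" and m: "0 < m" and fm: "\<And>t u. u \<in> {a..b} \<Longrightarrow> m \<le> f t u"
    and f0: "\<And>t u. u \<le> 1 \<Longrightarrow> 0 \<le> f t u"
  shows "\<exists>c>0. \<exists>C. \<forall>s t. s \<le> t \<longrightarrow> c * (t - s) - C \<le> \<xi> t - \<xi> s"
proof -
  \<comment> \<open>\<open>4 * k \<le> m\<close> lets the reaction outweigh the residual of the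
    profile. The third entry makes the profile so slowly varying that it stays above
    \<open>a\<close> up to the point where that residual changes sign.\<close>
  define k where "k = Min {1, m / 4, ((b - a) / 8)\<^sup>2}"
  have k: "0 < k" "k \<le> 1" "4 * k \<le> m" "k \<le> ((b - a) / 8)\<^sup>2" using ab m by (auto simp: k_def)
  have klog: "2 * k * ln (2 + 2 / k) \<le> b - a"
  proof -
    let ?y = "2 + 2 / k"
    have y: "0 < ?y" using k by (simp add: add_pos_pos)
    have "ln (sqrt ?y) \<le> sqrt ?y" using y ln_le_minus_one[of "sqrt ?y"] by (simp add: less_imp_le)
    then have "ln ?y \<le> 2 * sqrt ?y" using y by (simp add: ln_sqrt)
    then have "2 * k * ln ?y \<le> 2 * k * (2 * sqrt ?y)" using k by (intro mult_left_mono) auto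
    also have "\<dots> = 4 * sqrt (k\<^sup>2 * ?y)" using k by (simp add: real_sqrt_mult)
    also have "\<dots> \<le> 4 * sqrt (4 * k)"
    proof -
      have "k\<^sup>2 * ?y = 2 * k * k + 2 * k" using k by (simp add: power2_eq_square distrib_left)
      also have "\<dots> \<le> 2 * k * 1 + 2 * k" using k by (intro add_right_mono mult_left_mono) auto
      finally show ?thesis by simp
    qed
    also have "\<dots> = 8 * sqrt k" by (simp add: real_sqrt_mult)
    also have "sqrt k \<le> (b - a) / 8" using k ab by (intro real_le_lsqrt) auto
    finally show ?thesis by simp
  qed
  define c where "c = k / 2"
  define E where "E = (\<lambda>x::real. 1 + exp x)"
  have E: "0 < E x" "1 \<le> E x" for x by (auto simp: E_def add_pos_pos)
  define v where "v = (\<lambda>x. b - 2 + 2 * E x powr (- k))"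
  define v1 where "v1 = (\<lambda>x. - 2 * k * (exp x * E x powr (- k - 1)))"
  define F where "F = (\<lambda>x. exp x * E x powr (- k - 2))"
  define v2 where "v2 = (\<lambda>x. - 2 * k * (F x * (E x - (k + 1) * exp x)))"
  have Ed: "(E has_real_derivative exp x) (at x)" for x
    unfolding E_def by (auto intro!: derivative_eq_intros)
  have Ep: "((\<lambda>x. E x powr r) has_real_derivative r * E x powr (r - 1) * exp x) (at x)" for r x
    using DERIV_chain2[OF has_real_derivative_powr[OF E(1)] Ed] .
  have vd: "(v has_real_derivative v1 x) (at x)" for x
    unfolding v_def v1_def
    by (rule DERIV_cong[OF DERIV_add[OF DERIV_const DERIV_cmult[OF Ep]]]) (simp add: algebra_simps)
  have Epp: "E x powr (- k - 1) = E x * E x powr (- k - 2)" for x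
  proof -
    have e: "1 + (- k - 2) = - k - 1" by simp
    show ?thesis using powr_mult_base[of "E x" "- k - 2"] E(1)[of x] unfolding e by simp
  qed
  have v1d: "(v1 has_real_derivative v2 x) (at x)" for x
  proof -
    have "((\<lambda>x. exp x * E x powr (- k - 1)) has_real_derivative
       exp x * E x powr (- k - 1) + (- k - 1) * E x powr (- k - 1 - 1) * exp x * exp x) (at x)"
      by (intro DERIV_mult DERIV_exp Ep)
    from DERIV_cmult[OF this, of "- 2 * k"] show ?thesis
      unfolding v1_def v2_def by (rule DERIV_cong) (simp add: Epp F_def algebra_simps)
  qed
  \<comment> \<open>The last factor changes sign where \<open>exp x = (2 + k) / k\<close>. To the
    right of that point the profile is a subsolution even without reaction; to the left it lies in
    \<open>{a..b}\<close>, where the reaction is at least \<open>m\<close>.\<close>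
  have vv: "v2 x + c * v1 x = - 2 * k * (F x * (1 + k / 2 - k / 2 * exp x))" for x
    unfolding v2_def v1_def Epp F_def c_def by (simp add: E_def algebra_simps)
  have F: "0 \<le> F x" "F x \<le> 1" for x
  proof -
    show "0 \<le> F x" by (simp add: F_def)
    have "F x \<le> E x * E x powr (- k - 2)"
      unfolding F_def using E[of x] by (intro mult_right_mono) (auto simp: E_def)
    also have "\<dots> = E x powr (- k - 1)" by (simp add: Epp)
    also have "\<dots> \<le> E x powr 0" using E[of x] k by (intro powr_mono) auto
    finally show "F x \<le> 1" using E(1)[of x] by simp
  qed
  have v_le: "v x \<le> b" for x
  proof -
    have "E x powr (- k) \<le> E x powr 0" using E[of x] k by (intro powr_mono) auto
    then show ?thesis using E(1)[of x] by (simp add: v_def)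
  qed
  have v_ge: "a \<le> v x" if "exp x \<le> (2 + k) / k" for x
  proof -
    have "E x \<le> 2 + 2 / k" using that k by (simp add: E_def field_simps)
    then have "ln (E x) \<le> ln (2 + 2 / k)" using E[of x] by simp
    then have "2 * k * ln (E x) \<le> 2 * k * ln (2 + 2 / k)" using k by (intro mult_left_mono) auto
    then have 1: "2 * (k * ln (E x)) \<le> b - a" using klog by linarith
    have "E x powr (- k) = exp (- (k * ln (E x)))" using E(1)[of x] by (simp add: powr_def)
    then have "1 - k * ln (E x) \<le> E x powr (- k)"
      using exp_ge_add_one_self[of "- (k * ln (E x))"] by simp
    then show ?thesis using 1 by (simp add: v_def)
  qed
  have sub: "- (c * v1 x) - v2 x \<le> f t (v x)" for t x
  proof (cases "exp x \<le> (2 + k) / k")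
    case True
    have "2 * k * (F x * (1 + k / 2 - k / 2 * exp x)) \<le> 2 * k * (1 * 2)"
    proof (rule mult_left_mono)
      show "F x * (1 + k / 2 - k / 2 * exp x) \<le> 1 * 2"
      proof (rule mult_mono)
        have "0 \<le> k / 2 * exp x" using k by simp
        then show "1 + k / 2 - k / 2 * exp x \<le> 2" using k by linarith
        have "k / 2 * exp x \<le> k / 2 * ((2 + k) / k)" using True k by (intro mult_left_mono) auto
        also have "\<dots> = 1 + k / 2" using k by (simp add: field_simps)
        finally show "0 \<le> 1 + k / 2 - k / 2 * exp x" by simp
      qed (use F in auto)
    qed (use k in auto)
    then have "- (c * v1 x) - v2 x \<le> m" using vv[of x] k by linarith
    also have "m \<le> f t (v x)" using v_ge[OF True] v_le by (intro fm) auto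
    finally show ?thesis .
  next
    case False
    have "k / 2 * ((2 + k) / k) \<le> k / 2 * exp x" using False k by (intro mult_left_mono) auto
    moreover have "k / 2 * ((2 + k) / k) = 1 + k / 2" using k by (simp add: field_simps)
    ultimately have "1 + k / 2 - k / 2 * exp x \<le> 0" by linarith
    then have "2 * k * (F x * (1 + k / 2 - k / 2 * exp x)) \<le> 0"
      using F[of x] k by (intro mult_nonneg_nonpos) auto
    moreover have "0 \<le> f t (v x)" using v_le[of x] ab by (intro f0) auto
    ultimately show ?thesis using vv[of x] by linarith
  qed
  obtain M where M: "\<And>t x. x \<le> \<xi> t - M \<Longrightarrow> b \<le> U t x" using U_behind[of "1 - b"] ab by auto
  \<comment> \<open>Beyond \<open>x1\<close> the power is at most 1/2, so the profile is at most
    \<open>b - 1\<close> and lies below any positive solution.\<close>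
  define x1 where "x1 = ln 2 / k"
  have v_neg: "v x \<le> 0" if "x1 \<le> x" for x
  proof -
    have "E x powr (- k) \<le> exp x powr (- k)" unfolding E_def using k by (intro powr_mono2') auto
    also have "\<dots> = exp (- k * x)" by (simp add: powr_def)
    also have "\<dots> \<le> exp (- ln 2)"
    proof -
      have "ln 2 \<le> k * x" using that k by (simp add: x1_def field_simps)
      then show ?thesis by simp
    qed
    also have "\<dots> = 1 / 2" by (simp add: exp_minus)
    finally show ?thesis using ab by (simp add: v_def)
  qed
  show ?thesis
  proof (rule exI[of _ c], rule conjI, simp add: c_def k, rule exI[of _ "M + x1"], intro allI impI)
    fix s T :: real assume sT: "s \<le> T"
    \<comment> \<open>With this starting position, every point either lies so far behind \<xi> that
      \<open>U \<ge> b\<close>, or sees a nonpositive value of the profile.\<close>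
    define X where "X = \<xi> s - M - x1"
    define h where "h = (\<lambda>t::real. X + c * (t - s))"
    define w where "w = (\<lambda>t x. v (x - h t) - U t x)"
    have hd: "(h has_real_derivative c) (at t)" for t
      unfolding h_def by (auto intro!: derivative_eq_intros)
    have sh: "((\<lambda>x. x - z) has_real_derivative 1) (at y)" for y z :: real
      by (auto intro!: derivative_eq_intros)
    have heat: "heat_at (\<lambda>t x. v (x - h t)) t x (- c * v1 (x - h t) - v2 (x - h t))" for t x
    proof (rule heat_atI)
      have "((\<lambda>t. x - h t) has_real_derivative - c) (at t)" using hd by (auto intro!: derivative_eq_intros)
      from DERIV_chain2[OF vd this]
      show "((\<lambda>t. v (x - h t)) has_real_derivative - c * v1 (x - h t)) (at t)" by (simp add: mult.commute)
      show "((\<lambda>x. v (x - h t)) has_real_derivative v1 (y - h t)) (at y)" for y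
        using DERIV_chain2[OF vd sh] by simp
      show "((\<lambda>y. v1 (y - h t)) has_real_derivative v2 (x - h t)) (at x)"
        using DERIV_chain2[OF v1d sh] by simp
    qed simp
    have "w T (h T) \<le> 0"
    proof (rule max_principle[where S = UNIV and w = w and a = s and b = T and L = L and B = 1])
      have vc: "continuous_on UNIV v"
        by (intro continuous_at_imp_continuous_on ballI DERIV_isCont[OF vd])
      have "continuous_on ({s..T} \<times> UNIV) (\<lambda>p. v (snd p - h (fst p)))"
        unfolding h_def by (rule continuous_on_compose2[OF vc]) (auto intro!: continuous_intros)
      then show "continuous_on ({s..T} \<times> UNIV) (\<lambda>(t, x). w t x)"
        unfolding w_def case_prod_beta' by (intro continuous_intros U_cont)
      show "w t x \<le> 1" for t x
        using v_le[of "x - h t"] U_bounds(1)[of t x] ab unfolding w_def by linarith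
      show "w s x \<le> 0" for x
      proof (cases "x \<le> \<xi> s - M")
        case True
        then show ?thesis using M[OF True] v_le[of "x - h s"] by (simp add: w_def)
      next
        case False
        then have "v (x - h s) \<le> 0" by (intro v_neg) (simp add: h_def X_def)
        then show ?thesis using U_bounds(1)[of s x] by (simp add: w_def)
      qed
      show "x \<in> interior UNIV \<and> (\<exists>d. heat_at w t x d \<and> d \<le> L * w t x)"
        if t: "t \<in> {s<..T}" and w: "0 < w t x" for t x
      proof (intro conjI exI)
        show "heat_at w t x ((- c * v1 (x - h t) - v2 (x - h t)) - f t (U t x))"
          unfolding w_def using heat_at_diff[OF heat heat_wave[of 0]] by simp
        have "U t x < v (x - h t)" using w by (simp add: w_def)
        then have "\<bar>f t (v (x - h t)) - f t (U t x)\<bar> \<le> L * w t x"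
          using f_lip[of "v (x - h t)" "U t x" t] U_bounds[of t x] v_le[of "x - h t"] ab
          by (simp add: w_def)
        then show "(- c * v1 (x - h t) - v2 (x - h t)) - f t (U t x) \<le> L * w t x"
          using sub[of "x - h t" t] by simp
      qed simp
    qed (use sT in auto)
    then have "v 0 \<le> U T (h T)" by (simp add: w_def)
    \<comment> \<open>At the centre of the travelling profile the wave exceeds \<theta>, while it is
      at most \<theta> from the interface onwards; so the interface has not been overtaken.\<close>
    moreover have "a \<le> v 0" by (rule v_ge) (use k in simp)
    ultimately have gt: "\<theta> < U T (h T)" using ab by linarith
    have "h T < \<xi> T"
    proof (rule ccontr)
      assume "\<not> h T < \<xi> T"
      then have le: "\<xi> T \<le> h T" by simp
      have "c\<^sub>0 * (h T - \<xi> T) \<ge> 0" using c0 le by simp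
      then have "\<theta> * exp (- c\<^sub>0 * (h T - \<xi> T)) \<le> \<theta> * 1" using theta by (intro mult_left_mono) auto
      then show False using U_ahead[OF le] gt by linarith
    qed
    then show "c * (T - s) - (M + x1) \<le> \<xi> T - \<xi> s" by (simp add: h_def X_def)
  qed
qed

text \<open>A sliding average turns the mean speed into a pointwise lower bound on the derivative.\<close>

lemma smooth_interface:
  assumes c: "0 < c" and speed: "\<And>s t. s \<le> t \<Longrightarrow> c * (t - s) - C \<le> \<xi> t - \<xi> s"
  shows "\<exists>\<eta> \<eta>' D. (\<forall>t. (\<eta> has_real_derivative \<eta>' t) (at t)) \<and> (\<forall>t. c / 2 \<le> \<eta>' t) \<and> (\<forall>t. \<bar>\<eta> t - \<xi> t\<bar> \<le> D)"
proof -
  \<comment> \<open>A window so long that the defect \<open>C\<close> in the mean speed uses up at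
    most half of \<open>c * T\<close>.\<close>
  define T where "T = 2 * \<bar>C\<bar> / c + 1"
  have T: "T > 0" using c by (simp add: T_def add_nonneg_pos)
  have TC: "c / 2 * T \<le> c * T - C"
  proof -
    have "c * T = 2 * \<bar>C\<bar> + c" using c by (simp add: T_def distrib_left)
    moreover have "c / 2 * T = (c * T) / 2" by simp
    ultimately show ?thesis using c by linarith
  qed
  have "V-lipschitz_on UNIV \<xi>" using V xi_lip by (intro lipschitz_onI) (auto simp: dist_real_def)
  then have "isCont \<xi> x" for x
    using lipschitz_on_continuous_on[of V UNIV \<xi>] by (simp add: continuous_on_eq_continuous_at)
  then obtain F where F: "\<And>x. (F has_real_derivative \<xi> x) (at x)"
    using einterval_antiderivative[of "-\<infinity>" "\<infinity>" \<xi>] by (auto simp: has_real_derivative_iff_has_vector_derivative)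
  \<comment> \<open>The average of \<xi> over \<open>{t..t + T}\<close>, written through an
    antiderivative; its derivative is the difference quotient of \<xi> over the window.\<close>
  define \<eta> where "\<eta> = (\<lambda>t. (F (t + T) - F t) / T)"
  define \<eta>' where "\<eta>' = (\<lambda>t. (\<xi> (t + T) - \<xi> t) / T)"
  show ?thesis
  proof (intro exI conjI allI)
    show "(\<eta> has_real_derivative \<eta>' t) (at t)" for t
      unfolding \<eta>_def \<eta>'_def
      by (intro DERIV_cdivide DERIV_diff F) (use F[of "t + T"] in \<open>simp add: DERIV_shift\<close>)
    show "c / 2 \<le> \<eta>' t" for t
    proof -
      have "c * T - C \<le> \<xi> (t + T) - \<xi> t" using speed[of t "t + T"] T by simp
      then have "c / 2 * T \<le> \<xi> (t + T) - \<xi> t" using TC by linarith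
      then show ?thesis unfolding \<eta>'_def pos_le_divide_eq[OF T] .
    qed
    show "\<bar>\<eta> t - \<xi> t\<bar> \<le> V * T" for t
    proof -
      have "t < t + T" using T by simp
      from MVT2[OF this, of F \<xi>] F obtain z where z: "t < z" "z < t + T" "F (t + T) - F t = T * \<xi> z" by auto
      have "\<eta> t = \<xi> z" using z T by (simp add: \<eta>_def)
      moreover have "V * \<bar>z - t\<bar> \<le> V * T" using z V by (intro mult_left_mono) auto
      ultimately show ?thesis using xi_lip[of z t] by simp
    qed
  qed
qed

end

section \<open>Stability for ignition nonlinearities\<close>

text \<open>Continuity in time is uniform in space, so it combines with the continuity of a single
  time slice into joint continuity.\<close>

lemma cauchy_solution_continuous:
  assumes "cauchy_solution f t\<^sub>0 u\<^sub>0 u"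
  shows "continuous_on ({t\<^sub>0..} \<times> UNIV) (\<lambda>p. u (fst p) (snd p))"
  unfolding continuous_on_iff
proof (intro ballI allI impI)
  fix p e assume p: "p \<in> {t\<^sub>0..} \<times> (UNIV :: real set)" and e: "(0::real) < e"
  obtain t x where tx: "p = (t, x)" "t\<^sub>0 \<le> t" using p by (cases p) auto
  have "uniform_limit UNIV u (u t) (at t within {t\<^sub>0..})"
    using assms tx unfolding cauchy_solution_def by blast
  then have "eventually (\<lambda>s. \<forall>y. dist (u s y) (u t y) < e / 2) (at t within {t\<^sub>0..})"
    using e by (auto dest: uniform_limitD[where e = "e / 2"])
  then obtain d1 where d1: "d1 > 0" "\<And>s y. s \<in> {t\<^sub>0..} \<Longrightarrow> s \<noteq> t \<Longrightarrow> dist s t < d1 \<Longrightarrow> dist (u s y) (u t y) < e / 2"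
    unfolding eventually_at by blast
  have "u t \<in> Cb_unif" using assms tx unfolding cauchy_solution_def by blast
  then have "uniformly_continuous_on UNIV (u t)" by (simp add: Cb_unif_def)
  then obtain d2 where d2: "d2 > 0" "\<And>y. dist y x < d2 \<Longrightarrow> dist (u t y) (u t x) < e / 2"
    using e half_gt_zero[OF e] unfolding uniformly_continuous_on_def by (metis UNIV_I dist_commute)
  show "\<exists>d>0. \<forall>p'\<in>{t\<^sub>0..} \<times> UNIV. dist p' p < d \<longrightarrow> dist (u (fst p') (snd p')) (u (fst p) (snd p)) < e"
  proof (intro exI[of _ "min d1 d2"] conjI ballI impI)
    fix p' assume p': "p' \<in> {t\<^sub>0..} \<times> (UNIV :: real set)" "dist p' p < min d1 d2"
    obtain s y where sy: "p' = (s, y)" by (cases p')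
    have "dist s t < d1" "dist y x < d2"
      using p'(2) dist_fst_le[of p' p] dist_snd_le[of p' p] by (auto simp: sy tx)
    then have "dist (u s y) (u t y) < e / 2" "dist (u t y) (u t x) < e / 2"
      using d1(2)[of s y] d2(2)[of y] p' e by (cases "s = t"; auto simp: sy)+
    then show "dist (u (fst p') (snd p')) (u (fst p) (snd p)) < e"
      using dist_triangle[of "u s y" "u t x" "u t y"] by (simp add: sy tx)
  qed (use d1 d2 in auto)
qed

text \<open>The maximum principle asks for an a priori bound. Continuity in the uniform topology
  bounds the solution near each time, and bisection patches these bounds over a compact
  interval.\<close>

lemma cauchy_solution_bounded:
  assumes u: "cauchy_solution f t\<^sub>0 u\<^sub>0 u" and T: "t\<^sub>0 \<le> T"
  shows "\<exists>B. \<forall>t\<in>{t\<^sub>0..T}. \<forall>x. \<bar>u t x\<bar> \<le> B"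
proof -
  define P where "P = (\<lambda>a b. \<exists>B. \<forall>t\<in>{a..b} \<inter> {t\<^sub>0..}. \<forall>x. \<bar>u t x\<bar> \<le> B)"
  have "P t\<^sub>0 T"
  proof (rule Bolzano[OF T])
    fix a b c assume "P a b" "P b c" "a \<le> b" "b \<le> (c::real)"
    then obtain B1 B2 where B: "\<And>t x. t \<in> {a..b} \<inter> {t\<^sub>0..} \<Longrightarrow> \<bar>u t x\<bar> \<le> B1"
      "\<And>t x. t \<in> {b..c} \<inter> {t\<^sub>0..} \<Longrightarrow> \<bar>u t x\<bar> \<le> B2" unfolding P_def by blast
    have "\<bar>u t x\<bar> \<le> max B1 B2" if "t \<in> {a..c} \<inter> {t\<^sub>0..}" for t x
      using B(1)[of t x] B(2)[of t x] that by (cases "t \<le> b") auto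
    then show "P a c" unfolding P_def by blast
  next
    fix t assume t: "t\<^sub>0 \<le> t" "t \<le> T"
    have "uniform_limit UNIV u (u t) (at t within {t\<^sub>0..})"
      using u t unfolding cauchy_solution_def by blast
    then have "eventually (\<lambda>s. \<forall>y. dist (u s y) (u t y) < 1) (at t within {t\<^sub>0..})"
      by (auto dest: uniform_limitD[where e = 1])
    then obtain d where d: "d > 0" "\<And>s y. s \<in> {t\<^sub>0..} \<Longrightarrow> s \<noteq> t \<Longrightarrow> dist s t < d \<Longrightarrow> dist (u s y) (u t y) < 1"
      unfolding eventually_at by blast
    have "u t \<in> Cb_unif" using u t unfolding cauchy_solution_def by blast
    then obtain B where B: "\<And>x. \<bar>u t x\<bar> \<le> B" by (auto simp: Cb_unif_def bounded_iff)
    show "\<exists>d>0. \<forall>a b. a \<le> t \<and> t \<le> b \<and> b - a < d \<longrightarrow> P a b"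
    proof (intro exI[of _ d] conjI allI impI)
      fix a b assume ab: "a \<le> t \<and> t \<le> b \<and> b - a < d"
      have "\<bar>u s x\<bar> \<le> B + 1" if "s \<in> {a..b} \<inter> {t\<^sub>0..}" for s x
      proof (cases "s = t")
        case False
        then have "dist (u s x) (u t x) < 1" using that ab by (intro d) (auto simp: dist_real_def)
        then show ?thesis using B[of x] by (simp add: dist_real_def)
      qed (use B[of x] in simp)
      then show "P a b" unfolding P_def by blast
    qed (rule d)
  qed
  then show ?thesis unfolding P_def by auto
qed

lemma classical_solution_heat_at:
  assumes "classical_solution f I u" "t \<in> I"
  shows "heat_at u t x (f t (u t x))"
proof -
  obtain ut ux uxx where u: "\<forall>t\<in>I. \<forall>x.
       ((\<lambda>s. u s x) has_real_derivative ut t x) (at t) \<and>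
       (u t has_real_derivative ux t x) (at x) \<and>
       (ux t has_real_derivative uxx t x) (at x) \<and>
       ut t x = uxx t x + f t (u t x)"
    using assms(1) unfolding classical_solution_def by blast
  show ?thesis
    by (rule heat_atI[where wt = "ut t x" and wx = "ux t" and wxx = "uxx t x"])
      (use u assms(2) in \<open>blast, blast, blast, simp\<close>)
qed

text \<open>The interval [0,1] is invariant because the reaction is negative above 1 and zero below
  0.\<close>

lemma cauchy_solution_range:
  assumes f: "H1 f \<theta>" and u: "cauchy_solution f t\<^sub>0 u\<^sub>0 u" and u0: "\<And>x. u\<^sub>0 x \<in> {0..1}" and T: "t\<^sub>0 \<le> T"
  shows "u T x \<in> {0..1}"
proof -
  obtain B where B: "\<And>t x. t \<in> {t\<^sub>0..T} \<Longrightarrow> \<bar>u t x\<bar> \<le> B" using cauchy_solution_bounded[OF u T] by blast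
  have cont: "continuous_on ({t\<^sub>0..T} \<times> UNIV) (\<lambda>p. u (fst p) (snd p))"
    by (rule continuous_on_subset[OF cauchy_solution_continuous[OF u]]) auto
  have heat: "heat_at u t x (f t (u t x))" if "t\<^sub>0 < t" for t x
    using u that by (intro classical_solution_heat_at) (auto simp: cauchy_solution_def)
  have init: "u t\<^sub>0 x \<in> {0..1}" for x using u u0 by (simp add: cauchy_solution_def)
  have f_neg: "f t y < 0" if "1 < y" for t y using f that unfolding H1_def by blast
  have f_zero: "f t y = 0" if "y \<le> 0" for t y using f that unfolding H1_def by auto
  have "u T x - 1 \<le> 0"
  proof (rule max_principle[where S = UNIV and w = "\<lambda>t x. u t x - 1" and a = t\<^sub>0 and b = T and B = B and L = 0])
    show "continuous_on ({t\<^sub>0..T} \<times> UNIV) (\<lambda>(t, x). u t x - 1)"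
      unfolding case_prod_beta' by (intro continuous_intros cont)
    show "u t x - 1 \<le> B" if "t \<in> {t\<^sub>0..T}" for t x using B[OF that, of x] by simp
    show "x \<in> interior UNIV \<and> (\<exists>d. heat_at (\<lambda>t x. u t x - 1) t x d \<and> d \<le> 0 * (u t x - 1))"
      if "t \<in> {t\<^sub>0<..T}" "0 < u t x - 1" for t x
    proof (intro conjI exI)
      show "heat_at (\<lambda>t x. u t x - 1) t x (f t (u t x) - 0)"
        by (rule heat_at_diff[OF heat heat_at_time]) (use that in auto)
      show "f t (u t x) - 0 \<le> 0 * (u t x - 1)" using f_neg[of "u t x" t] that by simp
    qed simp
  qed (use init T in auto)
  moreover have "- u T x \<le> 0"
  proof (rule max_principle[where S = UNIV and w = "\<lambda>t x. - u t x" and a = t\<^sub>0 and b = T and B = B and L = 0])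
    show "continuous_on ({t\<^sub>0..T} \<times> UNIV) (\<lambda>(t, x). - u t x)"
      unfolding case_prod_beta' by (intro continuous_intros cont)
    show "- u t x \<le> B" if "t \<in> {t\<^sub>0..T}" for t x using B[OF that, of x] by simp
    show "x \<in> interior UNIV \<and> (\<exists>d. heat_at (\<lambda>t x. - u t x) t x d \<and> d \<le> 0 * - u t x)"
      if "t \<in> {t\<^sub>0<..T}" "0 < - u t x" for t x
    proof (intro conjI exI)
      have "heat_at (\<lambda>t x. - 1 * u t x) t x (- 1 * f t (u t x))"
        by (rule heat_at_cmult[OF heat]) (use that in auto)
      then show "heat_at (\<lambda>t x. - u t x) t x (- 1 * f t (u t x))" by simp
      show "- 1 * f t (u t x) \<le> 0 * - u t x" using f_zero[of "u t x" t] that by simp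
    qed simp
  qed (use init T in auto)
  ultimately show ?thesis by simp
qed

text \<open>The bound is uniform in time because \<open>f_inf\<close> is positive and continuous on
  a compact interval inside the ignition range.\<close>

lemma reaction_lower_bound:
  assumes "H1 f \<theta>" "H2 f \<theta>"
  shows "\<exists>a b m. \<theta> < a \<and> a < b \<and> b < 1 \<and> 0 < m \<and> (\<forall>t. \<forall>u\<in>{a..b}. m \<le> f t u)"
proof -
  have \<theta>: "0 < \<theta>" "\<theta> < 1" using assms(1) by (auto simp: H1_def)
  obtain f_inf L where lip: "L-lipschitz_on {0..} f_inf"
    and pos: "\<And>u. u \<in> {\<theta><..<1} \<Longrightarrow> 0 < f_inf u"
    and le: "\<And>t u. u \<in> {\<theta>..1} \<Longrightarrow> f_inf u \<le> f t u"
    using assms(2) unfolding H2_def by blast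
  define a where "a = \<theta> + (1 - \<theta>) / 3"
  define b where "b = \<theta> + (1 - \<theta>) / 2"
  have ab: "\<theta> < a" "a < b" "b < 1" using \<theta> by (auto simp: a_def b_def field_simps)
  have "continuous_on {a..b} f_inf"
    by (rule continuous_on_subset[OF lipschitz_on_continuous_on[OF lip]]) (use ab \<theta> in auto)
  from continuous_attains_inf[OF compact_Icc _ this] ab obtain y where
    y: "y \<in> {a..b}" "\<And>z. z \<in> {a..b} \<Longrightarrow> f_inf y \<le> f_inf z" by auto
  have "0 < f_inf y" using y(1) ab by (intro pos) auto
  moreover have "f_inf y \<le> f t u" if "u \<in> {a..b}" for t u
    using y(2)[OF that] le[of u t] that ab by auto
  ultimately show ?thesis using ab by blast
qed

text \<open>(H3) in integrated form, by the mean value theorem. Strictly above \<theta> the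
  one-sided notion of differentiability agrees with the two-sided one, so \<open>deriv\<close> is
  the actual derivative.\<close>

lemma reaction_dissipative:
  assumes "H1 f \<theta>" "H3 f \<theta>"
  shows "\<exists>\<theta>\<^sub>s \<beta>. \<theta> < \<theta>\<^sub>s \<and> \<theta>\<^sub>s < 1 \<and> 0 < \<beta> \<and> (\<forall>t u v. \<theta>\<^sub>s \<le> u \<longrightarrow> u \<le> v \<longrightarrow> f t v - f t u \<le> - \<beta> * (v - u))"
proof -
  obtain \<theta>\<^sub>s \<beta> where ts: "\<theta> < \<theta>\<^sub>s" "\<theta>\<^sub>s < 1" "0 < \<beta>" and d: "\<And>t u. \<theta>\<^sub>s \<le> u \<Longrightarrow> deriv (f t) u \<le> - \<beta>"
    using assms(2) unfolding H3_def by blast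
  have der: "(f t has_real_derivative deriv (f t) u) (at u)" if "\<theta>\<^sub>s \<le> u" for t u
  proof -
    have "C1_within {\<theta>..} (f t)" using assms(1) unfolding H1_def by blast
    then obtain g where "\<forall>u\<in>{\<theta>..}. (f t has_real_derivative g u) (at u within {\<theta>..})"
      unfolding C1_within_def by blast
    then have "(f t has_real_derivative g u) (at u within {\<theta>..})" using that ts by simp
    moreover have "at u within {\<theta>..} = at u"
      using that ts by (intro at_within_interior) (simp add: interior_real_atLeast)
    ultimately show ?thesis by (metis DERIV_imp_deriv)
  qed
  have "f t v - f t u \<le> - \<beta> * (v - u)" if uv: "\<theta>\<^sub>s \<le> u" "u \<le> v" for t u v
  proof (cases "u = v")
    case False
    then have "u < v" using uv by simp
    from MVT2[OF this, of "f t" "deriv (f t)"] der uv obtain z where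
      z: "u < z" "z < v" "f t v - f t u = (v - u) * deriv (f t) z" by force
    have "(v - u) * deriv (f t) z \<le> (v - u) * (- \<beta>)"
      using z uv by (intro mult_left_mono d) auto
    then show ?thesis using z(3) by (simp add: mult.commute)
  qed simp
  then show ?thesis using ts by blast
qed

text \<open>Translates the properties of the given wave into the locale. The points with content are
  joint differentiability from continuous partial derivatives, the integrated form of (H3), and the
  Lipschitz bound for \<xi>.\<close>

lemma ignition_wave_front:
  assumes H1: "H1 f \<theta>" and H3: "H3 f \<theta>" and wave: "ignition_wave f \<theta> U \<xi>"
  shows "\<exists>Ut Ux Uxx \<theta>\<^sub>s \<beta> L c\<^sub>0 V. ignition_front f U Ut Ux Uxx \<xi> \<theta> \<theta>\<^sub>s \<beta> L c\<^sub>0 V"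
proof -
  obtain \<theta>\<^sub>s \<beta> where ts: "\<theta> < \<theta>\<^sub>s" "\<theta>\<^sub>s < 1" "0 < \<beta>"
    and dec: "\<And>t u v. \<theta>\<^sub>s \<le> u \<Longrightarrow> u \<le> v \<Longrightarrow> f t v - f t u \<le> - \<beta> * (v - u)"
    using reaction_dissipative[OF H1 H3] by blast
  obtain L0 where L0: "\<And>t. L0-lipschitz_on {-1..2} (f t)"
    using H1 unfolding H1_def locally_uniformly_Lipschitz_def by blast
  define L where "L = max 1 L0"
  have lip: "\<bar>f t u - f t v\<bar> \<le> L * \<bar>u - v\<bar>" if "u \<in> {-1..2}" "v \<in> {-1..2}" for t u v
  proof -
    have "\<bar>f t u - f t v\<bar> \<le> L0 * \<bar>u - v\<bar>" using lipschitz_onD[OF L0 that] by (simp add: dist_real_def)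
    also have "\<dots> \<le> L * \<bar>u - v\<bar>" by (intro mult_right_mono) (auto simp: L_def)
    finally show ?thesis .
  qed
  note W = wave[unfolded ignition_wave_def]
  note W' = W[THEN conjunct2, THEN conjunct2]
  note W'' = W'[THEN conjunct2, THEN conjunct2]
  have gtw: "generalized_traveling_wave f U" by (rule W[THEN conjunct1])
  have int: "interface_location U \<xi>" by (rule W[THEN conjunct2, THEN conjunct1])
  have C1: "\<xi> C1_differentiable_on UNIV" by (rule W'[THEN conjunct1])
  have bdd: "bounded (range (deriv \<xi>))" by (rule W''[THEN conjunct1])
  have decr: "\<And>t x. deriv (U t) x < 0"
    by (rule W''[THEN conjunct2, THEN conjunct1, rule_format])
  note steep = W''[THEN conjunct2, THEN conjunct2, THEN conjunct1, rule_format]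
  note profile = W''[THEN conjunct2, THEN conjunct2, THEN conjunct2]
  obtain w c\<^sub>0 where c0: "c\<^sub>0 > 0" "\<And>x. 0 \<le> x \<Longrightarrow> w x = \<theta> * exp (- c\<^sub>0 * x)"
    and w: "\<And>t x. 0 \<le> x \<Longrightarrow> U t (x + \<xi> t) \<le> w x"
    using profile by (elim exE conjE) (rule that; blast)
  obtain Ut Ux Uxx where cont: "continuous_on (UNIV \<times> UNIV) (\<lambda>(t, x). Ut t x)"
      "continuous_on (UNIV \<times> UNIV) (\<lambda>(t, x). Ux t x)"
    and dt: "\<And>t x. ((\<lambda>s. U s x) has_real_derivative Ut t x) (at t)"
    and dx: "\<And>t x. (U t has_real_derivative Ux t x) (at x)"
    and dxx: "\<And>t x. (Ux t has_real_derivative Uxx t x) (at x)"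
    and eq: "\<And>t x. Ut t x = Uxx t x + f t (U t x)"
    using gtw unfolding generalized_traveling_wave_def classical_solution_def by blast
  have Ux: "deriv (U t) x = Ux t x" for t x by (rule DERIV_imp_deriv[OF dx])
  have xi_d: "(\<xi> has_real_derivative deriv \<xi> x) (at x)" for x
  proof -
    have "\<xi> differentiable at x" using C1 by (simp add: C1_differentiable_on_eq)
    then show ?thesis by (simp add: DERIV_deriv_iff_real_differentiable)
  qed
  obtain V where V: "\<And>x. \<bar>deriv \<xi> x\<bar> \<le> V" using bdd by (auto simp: bounded_iff)
  have "ignition_front f U Ut Ux Uxx \<xi> \<theta> \<theta>\<^sub>s \<beta> L c\<^sub>0 V"
  proof
    show "0 \<le> V" using V[of 0] by simp
    show "((\<lambda>(t, x). U t x) has_derivative (\<lambda>(h, k). Ut t x * h + Ux t x * k)) (at (t, x))" for t x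
    proof -
      \<comment> \<open>Total differentiability follows from the time derivative at the point
        together with continuity of the space derivative, which the rule expects as a bounded linear
        map.\<close>
      have "((\<lambda>(t, x). U t x) has_derivative (\<lambda>(h, k). Ut t x * h + blinfun_mult_right (Ux t x) k))
        (at (t, x) within UNIV \<times> UNIV)"
      proof (rule has_derivative_partialsI)
        show "((\<lambda>s. U s x) has_derivative (*) (Ut t x)) (at t within UNIV)"
          using dt[of x t] by (simp add: has_field_derivative_def)
        show "(U s has_derivative blinfun_apply (blinfun_mult_right (Ux s y))) (at y within UNIV)" for s y
          using dx[of s y] by (simp add: has_field_derivative_def)
        have "continuous_on (UNIV \<times> UNIV) (\<lambda>p. blinfun_mult_right (Ux (fst p) (snd p)))"
          using cont(2) unfolding case_prod_beta'
          by (rule bounded_linear.continuous_on[OF bounded_linear_blinfun_mult_right])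
        then show "continuous (at (t, x) within UNIV \<times> UNIV) (\<lambda>(t, x). blinfun_mult_right (Ux t x))"
          by (simp add: case_prod_beta' continuous_on_eq_continuous_within)
      qed auto
      then show ?thesis by simp
    qed
    show "Ux t x < 0" for t x using decr[of t x] by (simp add: Ux)
    show "\<exists>C>0. \<forall>t x. \<bar>x - \<xi> t\<bar> \<le> M \<longrightarrow> Ux t x \<le> - C" for M
    proof -
      \<comment> \<open>The locale allows any \<open>M\<close>, whereas steepness is available for
        positive widths only.\<close>
      obtain C where C: "C > 0" "\<And>t x. x \<in> {- (\<bar>M\<bar> + 1)..\<bar>M\<bar> + 1} \<Longrightarrow> Ux t (x + \<xi> t) < - C"
        using steep[of "\<bar>M\<bar> + 1"] unfolding Ux by (meson abs_ge_zero add_nonneg_pos zero_less_one)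
      have "Ux t x \<le> - C" if "\<bar>x - \<xi> t\<bar> \<le> M" for t x
        using C(2)[of "x - \<xi> t" t] that by (simp add: abs_le_iff)
      then show ?thesis using C(1) by blast
    qed
    show "U t x \<le> \<theta> * exp (- c\<^sub>0 * (x - \<xi> t))" if "\<xi> t \<le> x" for t x
      using w[of "x - \<xi> t" t] c0(2)[of "x - \<xi> t"] that by simp
    show "\<exists>M. \<forall>t x. x \<le> \<xi> t - M \<longrightarrow> 1 - \<epsilon> \<le> U t x" if \<epsilon>: "\<epsilon> > 0" for \<epsilon>
    proof -
      have "uniform_limit UNIV (\<lambda>x t. U t (x + \<xi> t)) (\<lambda>t. 1) at_bot"
        using int by (simp add: interface_location_def)
      from uniform_limitD[OF this \<epsilon>] obtain N where N: "\<And>x t. x \<le> N \<Longrightarrow> dist (U t (x + \<xi> t)) 1 < \<epsilon>"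
        by (auto simp: eventually_at_bot_linorder)
      have "1 - \<epsilon> \<le> U t x" if "x \<le> \<xi> t - (- N)" for t x
        using N[of "x - \<xi> t" t] that by (simp add: dist_real_def abs_less_iff)
      then show ?thesis by blast
    qed
    show "\<bar>\<xi> t - \<xi> s\<bar> \<le> V * \<bar>t - s\<bar>" for t s
      using field_differentiable_bound[of UNIV \<xi> "deriv \<xi>" V t s] xi_d V by simp
    show "U t x \<in> {0<..<1}" for t x using gtw by (simp add: generalized_traveling_wave_def)
  qed (use ts dec lip c0 dxx eq H1 in \<open>auto simp: L_def H1_def\<close>)
  then show ?thesis by blast
qed

theorem theorem1p3:
  fixes f u\<^sub>f :: "real \<Rightarrow> real \<Rightarrow> real" and \<theta> :: real and \<xi>\<^sub>f :: "real \<Rightarrow> real"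
  assumes "H1 f \<theta>" and "H2 f \<theta>" and "H3 f \<theta>"
    and "ignition_wave f \<theta> u\<^sub>f \<xi>\<^sub>f"
  shows "\<forall>\<alpha>\<^sub>0>0. \<exists>r>0. \<forall>t\<^sub>0 u\<^sub>0.
     u\<^sub>0 \<in> Cb_unif \<and> (\<forall>x. u\<^sub>0 x \<in> {0..1}) \<and> (u\<^sub>0 \<longlongrightarrow> 1) at_bot \<and>
     (\<exists>C'>0. \<forall>x. \<bar>u\<^sub>0 x - u\<^sub>f t\<^sub>0 x\<bar> \<le> C' * exp (- \<alpha>\<^sub>0 * (x - \<xi>\<^sub>f t\<^sub>0))) \<longrightarrow>
     (\<forall>u. cauchy_solution f t\<^sub>0 u\<^sub>0 u \<longrightarrow>
       (\<exists>C>0. \<exists>\<zeta>. \<forall>t\<ge>t\<^sub>0.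
          (SUP x. \<bar>u t x - u\<^sub>f t (x - \<zeta>)\<bar>) \<le> C * exp (- r * (t - t\<^sub>0))))"
proof (intro allI impI)
  fix \<alpha>\<^sub>0 :: real assume \<alpha>0: "0 < \<alpha>\<^sub>0"
  obtain Ut Ux Uxx \<theta>\<^sub>s \<beta> L c\<^sub>0 V where "ignition_front f u\<^sub>f Ut Ux Uxx \<xi>\<^sub>f \<theta> \<theta>\<^sub>s \<beta> L c\<^sub>0 V"
    using ignition_wave_front[OF assms(1,3,4)] by blast
  then interpret ignition_front f u\<^sub>f Ut Ux Uxx \<xi>\<^sub>f \<theta> \<theta>\<^sub>s \<beta> L c\<^sub>0 V .
  obtain a b m where ab: "\<theta> < a" "a < b" "b < 1" "0 < m" "\<And>t u. u \<in> {a..b} \<Longrightarrow> m \<le> f t u"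
    using reaction_lower_bound[OF assms(1,2)] by blast
  have f_nonneg: "0 \<le> f t u" if le: "u \<le> 1" for t u
  proof -
    consider "u \<in> {..\<theta>} \<union> {1}" | "u \<in> {\<theta><..<1}" using le by fastforce
    then show ?thesis
    proof cases
      case 1
      then have "f t u = 0" using assms(1) unfolding H1_def by blast
      then show ?thesis by simp
    next
      case 2
      then have "0 < f t u" using assms(1) unfolding H1_def by blast
      then show ?thesis by simp
    qed
  qed
  obtain c C\<^sub>s where c: "c > 0" and speed: "\<And>s t. s \<le> t \<Longrightarrow> c * (t - s) - C\<^sub>s \<le> \<xi>\<^sub>f t - \<xi>\<^sub>f s"
    using mean_speed[OF ab f_nonneg] by blast
  obtain \<eta> \<eta>' D where eta: "\<And>t. (\<eta> has_real_derivative \<eta>' t) (at t)" "\<And>t. c / 2 \<le> \<eta>' t"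
    "\<And>t. \<bar>\<eta> t - \<xi>\<^sub>f t\<bar> \<le> D"
    using smooth_interface[OF c speed] by blast
  \<comment> \<open>The three entries reflect the decay of the initial difference, the lower bound
    \<open>c / 2\<close> for the speed of \<eta>, and the decay exponent of the wave. None of them
    involves \<open>t\<^sub>0\<close> or \<open>u\<^sub>0\<close>.\<close>
  define \<alpha> where "\<alpha> = Min {\<alpha>\<^sub>0, c / 4, c\<^sub>0 / 2}"
  have \<alpha>: "0 < \<alpha>" "\<alpha> \<le> \<alpha>\<^sub>0" "2 * \<alpha> \<le> c / 2" "2 * \<alpha> \<le> c\<^sub>0"
    using \<alpha>0 c c0 by (auto simp: \<alpha>_def)
  interpret weighted_front f u\<^sub>f Ut Ux Uxx \<xi>\<^sub>f \<theta> \<theta>\<^sub>s \<beta> L c\<^sub>0 V \<eta> \<eta>' \<alpha> "c / 2" D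
    by unfold_locales (use eta \<alpha> c in auto)
  obtain r where r: "r > 0" and stable: "\<And>t\<^sub>0 u. sol t\<^sub>0 u \<Longrightarrow> (u t\<^sub>0 \<longlongrightarrow> 1) at_bot \<Longrightarrow>
     (\<exists>C'. \<forall>x\<ge>\<xi>\<^sub>f t\<^sub>0. \<bar>u t\<^sub>0 x - u\<^sub>f t\<^sub>0 x\<bar> \<le> C' * exp (- \<alpha> * (x - \<xi>\<^sub>f t\<^sub>0))) \<Longrightarrow>
     (\<exists>C>0. \<exists>\<zeta>. \<forall>t\<ge>t\<^sub>0. \<forall>x. \<bar>u t x - u\<^sub>f t (x - \<zeta>)\<bar> \<le> C * exp (- r * (t - t\<^sub>0)))"
    using stability by blast
  show "\<exists>r>0. \<forall>t\<^sub>0 u\<^sub>0.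
     u\<^sub>0 \<in> Cb_unif \<and> (\<forall>x. u\<^sub>0 x \<in> {0..1}) \<and> (u\<^sub>0 \<longlongrightarrow> 1) at_bot \<and>
     (\<exists>C'>0. \<forall>x. \<bar>u\<^sub>0 x - u\<^sub>f t\<^sub>0 x\<bar> \<le> C' * exp (- \<alpha>\<^sub>0 * (x - \<xi>\<^sub>f t\<^sub>0))) \<longrightarrow>
     (\<forall>u. cauchy_solution f t\<^sub>0 u\<^sub>0 u \<longrightarrow>
       (\<exists>C>0. \<exists>\<zeta>. \<forall>t\<ge>t\<^sub>0.
          (SUP x. \<bar>u t x - u\<^sub>f t (x - \<zeta>)\<bar>) \<le> C * exp (- r * (t - t\<^sub>0))))"
  proof (rule exI[of _ r], rule conjI[OF r], intro allI impI, elim conjE exE)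
    fix t\<^sub>0 u\<^sub>0 u C'
    assume u01: "\<forall>x. u\<^sub>0 x \<in> {0..1}" and lim: "(u\<^sub>0 \<longlongrightarrow> 1) at_bot"
      and u: "cauchy_solution f t\<^sub>0 u\<^sub>0 u" and C': "0 < C'"
      and close: "\<forall>x. \<bar>u\<^sub>0 x - u\<^sub>f t\<^sub>0 x\<bar> \<le> C' * exp (- \<alpha>\<^sub>0 * (x - \<xi>\<^sub>f t\<^sub>0))"
    have ut0: "u t\<^sub>0 = u\<^sub>0" using u by (simp add: cauchy_solution_def)
    have "sol t\<^sub>0 u"
      unfolding sol_def
    proof (intro conjI allI impI)
      show "continuous_on ({t\<^sub>0..} \<times> UNIV) (\<lambda>p. u (fst p) (snd p))"
        by (rule cauchy_solution_continuous[OF u])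
      show "u t x \<in> {0..1}" if "t\<^sub>0 \<le> t" for t x
        by (rule cauchy_solution_range[OF assms(1) u _ that]) (use u01 in blast)
      show "heat_at u t x (f t (u t x))" if "t\<^sub>0 < t" for t x
        using u that by (intro classical_solution_heat_at) (auto simp: cauchy_solution_def)
    qed
    moreover have "\<exists>C'. \<forall>x\<ge>\<xi>\<^sub>f t\<^sub>0. \<bar>u t\<^sub>0 x - u\<^sub>f t\<^sub>0 x\<bar> \<le> C' * exp (- \<alpha> * (x - \<xi>\<^sub>f t\<^sub>0))"
    proof (intro exI[of _ C'] allI impI)
      fix x assume x: "\<xi>\<^sub>f t\<^sub>0 \<le> x"
      \<comment> \<open>Lowering the exponent weakens the bound only ahead of the interface, which
        is where \<open>stability\<close> asks for it.\<close>
      have "\<alpha> * (x - \<xi>\<^sub>f t\<^sub>0) \<le> \<alpha>\<^sub>0 * (x - \<xi>\<^sub>f t\<^sub>0)" using \<alpha> x by (intro mult_right_mono) auto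
      then have "C' * exp (- \<alpha>\<^sub>0 * (x - \<xi>\<^sub>f t\<^sub>0)) \<le> C' * exp (- \<alpha> * (x - \<xi>\<^sub>f t\<^sub>0))"
        using C' by (intro mult_left_mono) auto
      then show "\<bar>u t\<^sub>0 x - u\<^sub>f t\<^sub>0 x\<bar> \<le> C' * exp (- \<alpha> * (x - \<xi>\<^sub>f t\<^sub>0))"
        using close[rule_format, of x] unfolding ut0 by linarith
    qed
    ultimately obtain C \<zeta> where C: "C > 0"
      "\<And>t x. t\<^sub>0 \<le> t \<Longrightarrow> \<bar>u t x - u\<^sub>f t (x - \<zeta>)\<bar> \<le> C * exp (- r * (t - t\<^sub>0))"
      using stable[of t\<^sub>0 u] lim unfolding ut0 by blast
    have "(SUP x. \<bar>u t x - u\<^sub>f t (x - \<zeta>)\<bar>) \<le> C * exp (- r * (t - t\<^sub>0))" if "t\<^sub>0 \<le> t" for t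
      by (intro cSUP_least C(2) that) simp
    then show "\<exists>C>0. \<exists>\<zeta>. \<forall>t\<ge>t\<^sub>0.
        (SUP x. \<bar>u t x - u\<^sub>f t (x - \<zeta>)\<bar>) \<le> C * exp (- r * (t - t\<^sub>0))"
      using C(1) by blast
  qed
qed

end
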